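(* Let $n\ge 1$. Then $$\sum_{R\in R(\mathcal{S}^C_n)} q^{c(R)}=\sum_{R\in R(\mathcal{S}^C_n)} q^{f(R)}=\sum_{\mathbf{a}\in\mathcal{A}^C(n)} q^{\,n-d^C(\mathbf{a})}$$ as polynomials in $q$, where $\mathcal{S}^C_n$ is the type $C_n$ Shi arrangement in $\mathbb{R}^n$, $c(R)$ and $f(R)$ are the numbers of ceilings and floors of the region $R$, and $d^C(\mathbf{a})$ is the number of distinct absolute values of the nonzero numbers appearing in $\mathbf{a}$.
   Context: The regions of a finite set $\mathcal{H}$ of affine hyperplanes in $\mathbb{R}^n$ are the connected components of $\mathbb{R}^n\setminus\bigcup_{H\in\mathcal{H}}H$; $R(\mathcal{H})$ denotes the set of regions. The type $C_n$ Shi arrangement in $\mathbb{R}^n$ is $$\mathcal{S}^C_n=\{x_i-x_j=0,\ x_i+x_j=0,\ 2x_k=0\mid 1\le i<j\le n,\ 1\le k\le n\}\cup\{x_i-x_j=1,\ x_i+x_j=1,\ 2x_k=1\mid 1\le i<j\le n,\ 1\le k\le n\}.$$ A hyperplane $H$ of the arrangement is a wall of a region $R$ if it is the affine span of a codimension-1 face of $R$. A wall $H$ of $R$ is a floor if $H$ does not contain the origin and $R$ and the origin lie in opposite half-spaces defined by $H$; it is a ceiling if $H$ does not contain the origin and $R$ and the origin lie in the same half-space defined by $H$. $f(R)$ is the number of floors and $c(R)$ the number of ceilings of $R$. $\mathcal{A}^C(n)=\{(a_1,\dots,a_n)\mid a_i\in\{-n,\dots,-1,0,1,\dots,n\},\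 1\le i\le n\}$. *)

theory Defs
  imports "HOL-Analysis.Analysis" "HOL-Computational_Algebra.Polynomial"
begin

text \<open>
  The space of dimension \<open>n\<close> is \<open>real ^ 'n\<close>, where \<open>'n\<close> is an arbitrary finite linearly ordered
  index type with \<open>n = CARD('n)\<close> elements; the linear order gives meaning to \<open>i < j\<close>.
  An arrangement is the set of its hyperplanes, each hyperplane being a set of points.
\<close>

definition shi_C :: "(real ^ 'n::{finite,linorder}) set set" where
  "shi_C =
     ({{x. x $ i - x $ j = 0} | i j. i < j} \<union> {{x. x $ i + x $ j = 0} | i j. i < j} \<union>
      {{x. 2 * x $ k = 0} | k. True}) \<union>
     ({{x. x $ i - x $ j = 1} | i j. i < j} \<union> {{x. x $ i + x $ j = 1} | i j. i < j} \<union>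
      {{x. 2 * x $ k = 1} | k. True})"

definition regions :: "'a::topological_space set set \<Rightarrow> 'a set set" where
  "regions \<H> = components (- \<Union>\<H>)"

text \<open>
  Regions are open, and \<open>face_of\<close> only sees boundary points belonging to the set, so the faces of
  a region are taken to be those of its closure.
\<close>

definition walls :: "'a::euclidean_space set set \<Rightarrow> 'a set \<Rightarrow> 'a set set" where
  "walls \<H> R = {H \<in> \<H>. \<exists>F. F facet_of closure R \<and> H = affine hull F}"

text \<open>
  In the next two definitions the choice of the equation \<open>a \<bullet> x = b\<close> of \<open>H\<close> is immaterial: replacing
  \<open>(a, b)\<close> by \<open>(- a, - b)\<close> exchanges the two half-spaces, hence the existential quantifier.
\<close>

definition opposite_half_spaces :: "'a::euclidean_space set \<Rightarrow> 'a set \<Rightarrow> 'a set \<Rightarrow> bool" where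
  "opposite_half_spaces H A B \<longleftrightarrow>
     (\<exists>a b. a \<noteq> 0 \<and> H = {x. a \<bullet> x = b} \<and> A \<subseteq> {x. a \<bullet> x < b} \<and> B \<subseteq> {x. a \<bullet> x > b})"

definition same_half_space :: "'a::euclidean_space set \<Rightarrow> 'a set \<Rightarrow> 'a set \<Rightarrow> bool" where
  "same_half_space H A B \<longleftrightarrow>
     (\<exists>a b. a \<noteq> 0 \<and> H = {x. a \<bullet> x = b} \<and> A \<subseteq> {x. a \<bullet> x < b} \<and> B \<subseteq> {x. a \<bullet> x < b})"

definition num_floors :: "'a::euclidean_space set set \<Rightarrow> 'a set \<Rightarrow> nat" where
  "num_floors \<H> R = card {H \<in> walls \<H> R. 0 \<notin> H \<and> opposite_half_spaces H R {0}}"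

definition num_ceilings :: "'a::euclidean_space set set \<Rightarrow> 'a set \<Rightarrow> nat" where
  "num_ceilings \<H> R = card {H \<in> walls \<H> R. 0 \<notin> H \<and> same_half_space H R {0}}"

definition seqs_C :: "(int ^ 'n) set" where
  "seqs_C = {a. \<forall>i. a $ i \<in> {- int CARD('n)..int CARD('n)}}"

definition distinct_abs :: "int ^ 'n \<Rightarrow> nat" where
  "distinct_abs a = card {\<bar>a $ i\<bar> | i. a $ i \<noteq> 0}"

end

theory Submission
  imports Defs
begin

text \<open>
  Put \<open>x_{-i} = - x_i\<close> and order the \<open>2 n\<close> symbols by \<open>1 < \<dots> < n < -n < \<dots> < -1\<close>. The arrangement
  consists of the hyperplanes \<open>x_s = x_t\<close> for \<open>s \<noteq> t\<close> and \<open>x_s - x_t = 1\<close> for \<open>s < t\<close>, so a region is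
  determined by the linear order \<open>L\<close> it induces on the symbols and by the set \<open>D\<close> of the pairs \<open>s < t\<close>
  with \<open>x_s - x_t > 1\<close>. The \<open>(L, D)\<close> that occur are those where \<open>L\<close> is compatible with negation and
  \<open>D\<close> is a symmetric upper set in the poset of the pairs \<open>s < t\<close> in \<open>L\<close>. Up to the symmetry, the
  floors are the minimal elements of \<open>D\<close> and the ceilings are the maximal elements of its complement.
  Hence both sums run over the pairs of an \<open>L\<close> and a symmetric antichain \<open>E\<close>, weighted by the size
  of \<open>E\<close>.

  The pairs in \<open>E\<close> link the symbols into chains. A sequence also links the symbols into chains, by
  joining neighbouring symbols of equal value. Fix \<open>E\<close> with \<open>2 e\<close> chains that differ from their
  negatives; then \<open>E\<close> has \<open>n - e\<close> elements up to symmetry. There are \<open>2^e n (n-1) \<dots> (n-e+1)\<close>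
  sequences that induce \<open>E\<close>, and the same number of orders \<open>L\<close> that make \<open>E\<close> an antichain. For the
  latter, read \<open>L\<close> from its centre outwards: the antichain condition says that the chains are served
  first-in first-out, starting from a palindromic queue made of the chains that cross the centre.
\<close>

section \<open>Chains of signed symbols\<close>

text \<open>The count depends only on the number \<open>e\<close> of pairs of opposite chains, not
  on their lengths. To see why, count the words that serve a queue whose chains have
  \<open>t\<close> letters while \<open>2 e\<close> chains with \<open>2 k\<close> letters in all
  can still be started, and put \<open>N = t + k\<close>. Their number is
  \<open>(t + 1) * 2 ^ e\<close> times the product of the \<open>e - 1\<close> factors
  \<open>N, N - 1, ...\<close>. This is linear in \<open>t\<close>, so when the first letter starts
  a chain of length \<open>l\<close>, the sum over all such chains involves the lengths only through
  their total. Allowing chains to be cut at the centre then replaces the factor \<open>t + 1\<close>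
  by \<open>N - e + 1\<close>, which completes the falling factorial.

  Orders and sequences are never matched one by one: for fixed \<open>E\<close> the two families
  merely have the same size. Only the passage from upper sets to antichains is an explicit
  bijection, once through floors and once through ceilings.\<close>

locale signed_order =
  fixes neg :: "'a::finite \<Rightarrow> 'a" and prec :: "'a \<Rightarrow> 'a \<Rightarrow> bool"
  assumes neg_neg [simp]: "neg (neg s) = s"
    and neg_ne [simp]: "neg s \<noteq> s"
    and prec_irrefl [simp]: "\<not> prec s s"
    and prec_trans [trans]: "prec s t \<Longrightarrow> prec t u \<Longrightarrow> prec s u"
    and prec_total: "s \<noteq> t \<Longrightarrow> prec s t \<or> prec t s"
    and prec_neg [simp]: "prec (neg s) (neg t) \<longleftrightarrow> prec t s"
begin

lemma neg_inj [simp]: "neg s = neg t \<longleftrightarrow> s = t"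
  by (metis neg_neg)

lemma inj_neg [simp]: "inj_on neg A"
  by (simp add: inj_on_def)

lemma neg_in_image [simp]: "neg s \<in> neg ` A \<longleftrightarrow> s \<in> A"
  by auto

lemma in_neg_image: "s \<in> neg ` A \<longleftrightarrow> neg s \<in> A"
  by (metis neg_in_image neg_neg)

lemma prec_asym: "prec s t \<Longrightarrow> \<not> prec t s"
  using prec_irrefl prec_trans by blast

end

text \<open>
  \<open>E\<close> joins the consecutive elements of every block of a partition of the symbols that is invariant
  under negation. The axiom \<open>E_self\<close> says that at most one block, the zero block, is its own negative.
\<close>

locale chains = signed_order neg prec for neg :: "'a::finite \<Rightarrow> 'a" and prec +
  fixes E :: "('a \<times> 'a) set"
  assumes E_prec: "(s, t) \<in> E \<Longrightarrow> prec s t"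
    and E_sym: "(s, t) \<in> E \<Longrightarrow> (neg t, neg s) \<in> E"
    and E_fun: "(s, t) \<in> E \<Longrightarrow> (s, u) \<in> E \<Longrightarrow> t = u"
    and E_self: "(c, neg c) \<in> E \<Longrightarrow> (d, neg d) \<in> E \<Longrightarrow> c = d"
begin

lemma E_sym_iff: "(neg t, neg s) \<in> E \<longleftrightarrow> (s, t) \<in> E"
  using E_sym[of s t] E_sym[of "neg t" "neg s"] by auto

lemma E_inj: "(s, u) \<in> E \<Longrightarrow> (t, u) \<in> E \<Longrightarrow> s = t"
  using E_sym E_fun neg_inj by metis

definition chain :: "'a \<Rightarrow> 'a set" where "chain s = E\<^sup>* `` {s}"

definition succs :: "'a \<Rightarrow> 'a list" where
  "succs s = (if s \<in> Domain E then [THE t. (s, t) \<in> E] else [])"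

definition flip :: "'a \<Rightarrow> 'a" where "flip b = neg (THE a. (a, b) \<in> E)"

definition twin :: "'a \<Rightarrow> 'a set" where "twin h = chain h \<union> neg ` chain h"

definition heads :: "'a set \<Rightarrow> 'a set" where "heads X = X - Range E"

text \<open>Stable sets are unions of chains outside the zero block, closed under negation.\<close>

definition stable :: "'a set \<Rightarrow> bool" where
  "stable X \<longleftrightarrow> (\<forall>a b. (a, b) \<in> E \<longrightarrow> (a \<in> X \<longleftrightarrow> b \<in> X)) \<and> (\<forall>s\<in>X. neg s \<in> X \<and> neg s \<notin> chain s)"

lemma heads_empty_set [simp]: "heads {} = {}"
  by (simp add: heads_def)

lemma succs_eq: "(s, t) \<in> E \<Longrightarrow> succs s = [t]"
proof -
  assume st: "(s, t) \<in> E"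
  then have "(THE t. (s, t) \<in> E) = t" by (rule the_equality) (use E_fun st in blast)
  then show ?thesis using st by (auto simp: succs_def)
qed

lemma succs_Nil: "s \<notin> Domain E \<Longrightarrow> succs s = []"
  by (simp add: succs_def)

lemma set_succs: "set (succs s) = E `` {s}"
  by (cases "s \<in> Domain E") (auto simp: succs_eq succs_Nil dest: E_fun)

lemma flip_eq: "(a, b) \<in> E \<Longrightarrow> flip b = neg a"
  unfolding flip_def using E_inj by (metis the_equality)

lemma flip_flip: "b \<in> Range E \<Longrightarrow> flip (flip b) = b"
  using E_sym flip_eq by fastforce

lemma flip_Range: "b \<in> Range E \<Longrightarrow> flip b \<in> Range E"
  using E_sym flip_eq by fastforce

lemma chain_prec: "t \<in> chain s \<Longrightarrow> t = s \<or> prec s t"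
proof -
  assume "t \<in> chain s"
  then have "(s, t) \<in> E\<^sup>*" by (simp add: chain_def)
  then show ?thesis by induction (auto dest: E_prec prec_trans)
qed

lemma chain_refl [simp]: "s \<in> chain s" by (simp add: chain_def)

lemma chain_trans: "t \<in> chain s \<Longrightarrow> u \<in> chain t \<Longrightarrow> u \<in> chain s"
  by (simp add: chain_def)

lemma chain_step: "(s, t) \<in> E \<Longrightarrow> t \<in> chain s"
  by (auto simp: chain_def)

lemma chain_E: "t \<in> chain s \<Longrightarrow> (t, u) \<in> E \<Longrightarrow> u \<in> chain s"
  by (auto simp: chain_def)

lemma chain_insert: "(s, t) \<in> E \<Longrightarrow> chain s = insert s (chain t)"
proof -
  assume st: "(s, t) \<in> E"
  have "u \<in> insert s (chain t)" if "u \<in> chain s" for u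
    using that unfolding chain_def Image_singleton_iff
    by (rule converse_rtranclE) (use st E_fun in auto)
  then show ?thesis using chain_trans[OF chain_step[OF st]] by auto
qed

lemma chain_not: "(s, t) \<in> E \<Longrightarrow> s \<notin> chain t"
  using chain_prec E_prec prec_asym prec_irrefl by metis

lemma chain_single: "s \<notin> Domain E \<Longrightarrow> chain s = {s}"
  unfolding chain_def by (auto elim: converse_rtranclE)

lemma chain_succs: "chain s = insert s (\<Union>(chain ` set (succs s)))"
  by (cases "s \<in> Domain E") (auto simp: succs_eq succs_Nil chain_insert chain_single)

lemma chain_last: "t \<in> chain s \<Longrightarrow> t \<noteq> s \<Longrightarrow> \<exists>u\<in>chain s. (u, t) \<in> E"
  unfolding chain_def by (auto elim: rtranclE)

lemma chain_neg: "neg s \<in> chain (neg t) \<longleftrightarrow> t \<in> chain s"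
proof -
  have *: "neg s \<in> chain (neg t)" if "t \<in> chain s" for s t
  proof -
    from that have "(s, t) \<in> E\<^sup>*" by (simp add: chain_def)
    then have "(neg t, neg s) \<in> E\<^sup>*"
      by induction (auto intro: converse_rtrancl_into_rtrancl E_sym)
    then show ?thesis by (simp add: chain_def)
  qed
  show ?thesis using *[of t s] *[of "neg s" "neg t"] by auto
qed

lemma chain_linear: "t \<in> chain s \<Longrightarrow> u \<in> chain s \<Longrightarrow> u \<in> chain t \<or> t \<in> chain u"
proof -
  assume t: "t \<in> chain s" and u: "u \<in> chain s"
  from t have "(s, t) \<in> E\<^sup>*" by (simp add: chain_def)
  then show ?thesis
  proof induction
    case base then show ?case using u by simp
  next
    case (step y z)
    then show ?case using chain_insert[of y z] chain_E[of y u z] by auto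
  qed
qed

lemma chain_linear': "s \<in> chain t \<Longrightarrow> s \<in> chain u \<Longrightarrow> u \<in> chain t \<or> t \<in> chain u"
  using chain_linear[of "neg t" "neg s" "neg u"] by (auto simp: chain_neg)

lemma head_ex: "\<exists>h. h \<notin> Range E \<and> s \<in> chain h"
proof -
  have "acyclic E"
  proof -
    have "(s, t) \<in> E\<^sup>+ \<Longrightarrow> prec s t" for s t
      by (induction rule: trancl_induct) (auto dest: E_prec prec_trans)
    then show ?thesis unfolding acyclic_def using prec_irrefl by blast
  qed
  then have "wf E" by (simp add: finite_acyclic_wf)
  then show ?thesis
  proof (induction s)
    case (less s)
    then show ?case using chain_refl chain_step chain_trans by (metis RangeE)
  qed
qed

lemma head_chain: "h \<notin> Range E \<Longrightarrow> h \<in> chain s \<Longrightarrow> h = s"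
  using chain_last by blast

lemma finite_chain [simp]: "finite (chain s)" by simp

lemma card_chain: "card (chain s) = Suc (\<Sum>t\<leftarrow>succs s. card (chain t))"
  by (cases "s \<in> Domain E") (auto simp: succs_eq succs_Nil chain_insert chain_not chain_single)

lemma stable_chain: "stable X \<Longrightarrow> t \<in> chain s \<Longrightarrow> t \<in> X \<longleftrightarrow> s \<in> X"
proof -
  assume X: "stable X" and "t \<in> chain s"
  then have "(s, t) \<in> E\<^sup>*" by (simp add: chain_def)
  then show ?thesis by induction (use X in \<open>auto simp: stable_def\<close>)
qed

lemma stable_neg: "stable X \<Longrightarrow> neg s \<in> X \<longleftrightarrow> s \<in> X"
  unfolding stable_def by (metis neg_neg)

text \<open>A chain is linearly ordered by reachability, so if it contained \<open>t\<close> and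
  \<open>neg t\<close>, one of them would lie in the chain of the other, which stability
  excludes.\<close>

lemma stable_separated: assumes "stable X" "h \<in> X" shows "chain h \<inter> neg ` chain h = {}"
proof (rule ccontr)
  assume "chain h \<inter> neg ` chain h \<noteq> {}"
  then obtain t where t: "t \<in> chain h" "neg t \<in> chain h" by (auto simp: in_neg_image)
  then have "neg t \<in> chain t \<or> neg (neg t) \<in> chain (neg t)" using chain_linear by auto
  moreover have "t \<in> X" "neg t \<in> X" using assms t stable_chain stable_neg by blast+
  ultimately show False using assms(1) unfolding stable_def by blast
qed

lemma stable_twin: "stable X \<Longrightarrow> h \<in> X \<Longrightarrow> twin h \<subseteq> X"
  unfolding twin_def using stable_chain stable_neg by auto

lemma card_twin: "stable X \<Longrightarrow> h \<in> X \<Longrightarrow> card (twin h) = 2 * card (chain h)"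
  unfolding twin_def using stable_separated by (subst card_Un_disjoint) (auto simp: card_image)

text \<open>A chain that starts at a head is closed under predecessors as well as successors,
  because a letter has at most one predecessor. Negation exchanges the two.\<close>

lemma twin_E: assumes "h \<notin> Range E" "(a, b) \<in> E" shows "a \<in> twin h \<longleftrightarrow> b \<in> twin h"
proof -
  have 1: "a \<in> chain h \<longleftrightarrow> b \<in> chain h" if "(a, b) \<in> E" for a b
  proof
    assume "b \<in> chain h"
    then show "a \<in> chain h" using assms(1) chain_last[of b h] that E_inj by fastforce
  qed (use that chain_E in blast)
  show ?thesis using 1[OF assms(2)] 1[OF E_sym[OF assms(2)]]
    by (auto simp: twin_def in_neg_image)
qed

lemma stable_diff: assumes "stable X" "h \<in> heads X" shows "stable (X - twin h)"
  using assms twin_E unfolding stable_def heads_def by (auto simp: twin_def in_neg_image)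

lemma card_diff: assumes "stable X" "h \<in> heads X" shows "card X = card (X - twin h) + 2 * card (chain h)"
proof -
  have "twin h \<subseteq> X" using assms stable_twin by (auto simp: heads_def)
  then have "card (X - twin h) = card X - card (twin h)" "card (twin h) \<le> card X"
    by (simp_all add: card_Diff_subset card_mono)
  then show ?thesis using card_twin assms by (simp add: heads_def)
qed

lemma card_Dom_chain: "card (chain h \<inter> Domain E) = card (chain h) - 1"
proof -
  have "bij_betw (\<lambda>s. THE t. (s, t) \<in> E) (chain h \<inter> Domain E) (chain h - {h})"
  proof (rule bij_betw_imageI)
    have the: "(THE t. (s, t) \<in> E) = t" if "(s, t) \<in> E" for s t
      using that E_fun by blast
    show "inj_on (\<lambda>s. THE t. (s, t) \<in> E) (chain h \<inter> Domain E)"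
      by (auto simp: inj_on_def the dest: E_inj)
    show "(\<lambda>s. THE t. (s, t) \<in> E) ` (chain h \<inter> Domain E) = chain h - {h}"
    proof (intro equalityI subsetI)
      fix t assume "t \<in> (\<lambda>s. THE t. (s, t) \<in> E) ` (chain h \<inter> Domain E)"
      then obtain s where "s \<in> chain h" "(s, t) \<in> E" using the by auto
      then show "t \<in> chain h - {h}" using chain_E chain_not[of s t] by auto
    next
      fix t assume "t \<in> chain h - {h}"
      then obtain u where "u \<in> chain h" "(u, t) \<in> E" using chain_last by auto
      then show "t \<in> (\<lambda>s. THE t. (s, t) \<in> E) ` (chain h \<inter> Domain E)"
        using the by force
    qed
  qed
  then show ?thesis by (simp add: bij_betw_same_card)
qed

lemma card_chain_pos [simp]: "0 < card (chain h)"
  by (subst card_chain) simp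

text \<open>The twin consists of two disjoint chains with one head each; the head of the negative
  chain is the negative of the last letter of \<open>chain h\<close>.\<close>

lemma card_heads_diff: assumes "stable X" "h \<in> heads X"
  shows "card (heads X) = card (heads (X - twin h)) + 2"
proof -
  have h: "h \<in> X" "h \<notin> Range E" using assms by (auto simp: heads_def)
  have "card (heads (twin h)) = 2"
  proof -
    have 1: "chain h - Range E = {h}" using h chain_last by auto
    have "card (chain h - Domain E) = 1"
      using card_Dom_chain[of h] card_chain_pos[of h] card_Int_Diff[OF finite_chain, of h "Domain E"] by linarith
    moreover have "neg ` chain h - Range E = neg ` (chain h - Domain E)"
    proof -
      have "neg s \<in> Range E \<longleftrightarrow> s \<in> Domain E" for s
        by (metis Domain_iff E_sym_iff Range_iff neg_neg)
      then show ?thesis by auto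
    qed
    ultimately have 2: "card (neg ` chain h - Range E) = 1" by (simp add: card_image)
    have "heads (twin h) = (chain h - Range E) \<union> (neg ` chain h - Range E)"
      by (auto simp: heads_def twin_def)
    moreover have "(chain h - Range E) \<inter> (neg ` chain h - Range E) = {}"
      using stable_separated[OF assms(1) h(1)] by auto
    ultimately show ?thesis using 1 2 by (simp add: card_Un_disjoint)
  qed
  moreover have "heads X = heads (X - twin h) \<union> heads (twin h)"
    using stable_twin[OF assms(1) h(1)] by (auto simp: heads_def)
  moreover have "heads (X - twin h) \<inter> heads (twin h) = {}" by (auto simp: heads_def)
  ultimately show ?thesis by (simp add: card_Un_disjoint)
qed

lemma sum_heads: assumes "stable X" shows "(\<Sum>h\<in>heads X. card (chain h)) = card X"
proof -
  have "X = (\<Union>h\<in>heads X. chain h)"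
  proof (intro equalityI subsetI)
    fix s assume "s \<in> X"
    then show "s \<in> (\<Union>h\<in>heads X. chain h)"
      using head_ex[of s] assms stable_chain by (auto simp: heads_def)
  next
    fix s assume "s \<in> (\<Union>h\<in>heads X. chain h)"
    then show "s \<in> X" using assms stable_chain by (auto simp: heads_def)
  qed
  moreover have "card (\<Union>h\<in>heads X. chain h) = (\<Sum>h\<in>heads X. card (chain h))"
  proof (rule card_UN_disjoint)
    show "\<forall>i\<in>heads X. \<forall>j\<in>heads X. i \<noteq> j \<longrightarrow> chain i \<inter> chain j = {}"
      using chain_linear' head_chain by (metis heads_def Diff_iff disjoint_iff)
  qed auto
  ultimately show ?thesis by simp
qed

definition total :: "'a list \<Rightarrow> nat" where "total Q = (\<Sum>q\<leftarrow>Q. card (chain q))"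

lemma total_simps [simp]: "total [] = 0" "total (q # Q) = card (chain q) + total Q" "total (Q @ Q') = total Q + total Q'"
  by (simp_all add: total_def)

lemma total_succs: "card (chain s) = Suc (total (succs s))"
  unfolding total_def by (rule card_chain)

text \<open>
  \<open>fifo Q X v\<close>: the word \<open>v\<close> serves the queue \<open>Q\<close> first-in first-out. At every step one may also
  start a new chain from \<open>X\<close>, which uses up its negative, and the successor of a letter joins the
  queue.
\<close>

inductive fifo :: "'a list \<Rightarrow> 'a set \<Rightarrow> 'a list \<Rightarrow> bool" where
  fifo_Nil: "fifo [] {} []"
| fifo_start: "h \<in> heads X \<Longrightarrow> fifo (Q @ succs h) (X - twin h) v \<Longrightarrow> fifo Q X (h # v)"
| fifo_cont: "fifo (Q @ succs q) X v \<Longrightarrow> fifo (q # Q) X (q # v)"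

abbreviation words :: "'a list \<Rightarrow> 'a set \<Rightarrow> 'a list set" where
  "words Q X \<equiv> {v. fifo Q X v}"

text \<open>Integer-valued, so that the subtraction is not truncated.\<close>

definition ffact :: "nat \<Rightarrow> nat \<Rightarrow> int" where "ffact n j = (\<Prod>i<j. int n - int i)"

lemma ffact_0 [simp]: "ffact n 0 = 1" by (simp add: ffact_def)
lemma ffact_Suc: "ffact n (Suc j) = ffact n j * (int n - int j)" by (simp add: ffact_def)
lemma ffact_Suc_Suc: "ffact (Suc n) (Suc j) = (int n + 1) * ffact n j"
  unfolding ffact_def by (subst prod.lessThan_Suc_shift) simp

lemma fifo_Collect:
  "(words Q X) = (if Q = [] \<and> X = {} then {[]} else {})
     \<union> (\<Union>h\<in>heads X. (#) h ` (words (Q @ succs h) (X - twin h)))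
     \<union> (case Q of [] \<Rightarrow> {} | q # Q' \<Rightarrow> (#) q ` (words (Q' @ succs q) X))"
  (is "_ = ?R")
proof (intro equalityI subsetI)
  fix v assume "v \<in> (words Q X)"
  then have "fifo Q X v" by simp
  then show "v \<in> ?R"
    by cases auto
qed (auto intro: fifo.intros split: list.splits if_splits)

text \<open>Letters of the queue have predecessors and heads have none, so the first letter of a
  word tells whether it starts a chain or continues one.\<close>

lemma card_fifo_rec:
  assumes "set Q \<subseteq> Range E"
    and "\<And>h. h \<in> heads X \<Longrightarrow> finite (words (Q @ succs h) (X - twin h))"
    and "\<And>q Q'. Q = q # Q' \<Longrightarrow> finite (words (Q' @ succs q) X)"
  shows "finite (words Q X)"
    "card (words Q X) = (if Q = [] \<and> X = {} then 1 else 0)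
      + (\<Sum>h\<in>heads X. card (words (Q @ succs h) (X - twin h)))
      + (case Q of [] \<Rightarrow> 0 | q # Q' \<Rightarrow> card (words (Q' @ succs q) X))"
    (is "_ = ?R")
proof -
  let ?A = "(if Q = [] \<and> X = {} then {[]} else {}) :: 'a list set"
  let ?B = "\<lambda>h. (#) h ` (words (Q @ succs h) (X - twin h))"
  let ?C = "(case Q of [] \<Rightarrow> {} | q # Q' \<Rightarrow> (#) q ` (words (Q' @ succs q) X))"
  have fin: "finite ?A" "finite (\<Union>h\<in>heads X. ?B h)" "finite ?C"
    using assms by (auto split: list.splits)
  show "finite (words Q X)" by (subst fifo_Collect) (use fin in blast)
  have B: "card (\<Union>h\<in>heads X. ?B h) = (\<Sum>h\<in>heads X. card (words (Q @ succs h) (X - twin h)))"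
  proof (subst card_UN_disjoint)
    show "\<forall>i\<in>heads X. finite (?B i)" using assms by auto
  qed (auto simp: card_image)
  have C: "card ?C = (case Q of [] \<Rightarrow> 0 | q # Q' \<Rightarrow> card (words (Q' @ succs q) X))"
    by (auto simp: card_image split: list.splits)
  have "?A \<inter> (\<Union>h\<in>heads X. ?B h) = {}" by auto
  moreover have "(?A \<union> (\<Union>h\<in>heads X. ?B h)) \<inter> ?C = {}"
    using assms(1) by (auto simp: heads_def split: list.splits if_splits)
  ultimately show "card (words Q X) = ?R"
    using fin by (subst fifo_Collect) (simp add: card_Un_disjoint B C)
qed

lemma heads_empty: "stable X \<Longrightarrow> heads X = {} \<Longrightarrow> X = {}"
  using sum_heads[of X] by simp

lemma set_succs_Range: "set (succs s) \<subseteq> Range E" by (auto simp: set_succs)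

text \<open>Induction on the length \<open>total Q + k\<close> of the words, along their first
  letter. The value at \<open>e = 0\<close>, where \<open>k = 0\<close>, fits the general formula if
  the factor \<open>ffact n (- 1)\<close> is read as \<open>1 / (n + 1)\<close>.\<close>

lemma card_fifo:
  assumes "stable X" "set Q \<subseteq> Range E" "card (heads X) = 2 * e" "card X = 2 * k"
  shows "finite (words Q X) \<and> int (card (words Q X)) =
     (case e of 0 \<Rightarrow> 1 | Suc e' \<Rightarrow> int (Suc (total Q)) * 2 ^ e * ffact (total Q + k) e')"
  using assms
proof (induction "total Q + k" arbitrary: Q X e k rule: less_induct)
  case (less Q k X e)
  let ?W = "\<lambda>h. words (Q @ succs h) (X - twin h)"
  have rec_head: "finite (?W h) \<and>
      int (card (?W h)) =
        (case e - 1 of 0 \<Rightarrow> 1 | Suc e' \<Rightarrow> int (total Q + card (chain h)) * 2 ^ (e - 1) * ffact (total Q + k - 1) e')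
      \<and> 0 < e \<and> 0 < k"
    if h: "h \<in> heads X" for h
  proof -
    have e: "card (heads (X - twin h)) = 2 * (e - 1)" "0 < e"
      using card_heads_diff[OF less.prems(1) h] less.prems(3) by auto
    have k: "card (X - twin h) = 2 * (k - card (chain h))" "card (chain h) \<le> k"
      using card_diff[OF less.prems(1) h] less.prems(4) by auto
    \<comment> \<open>The letter \<open>h\<close> is served at once and only the rest of its chain
      joins the queue, so the factor \<open>Suc (total Q)\<close> of the formula becomes
      \<open>total Q + card (chain h)\<close>.\<close>
    have l: "Suc (total (Q @ succs h)) = total Q + card (chain h)" using total_succs[of h] by simp
    have lk: "total (Q @ succs h) + (k - card (chain h)) = total Q + k - 1" using l k(2) by linarith
    have k0: "0 < k" using k(2) card_chain_pos[of h] by linarith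
    have lt: "total (Q @ succs h) + (k - card (chain h)) < total Q + k" using lk k0 by linarith
    show ?thesis
      using less.hyps[OF lt stable_diff[OF less.prems(1) h] _ e(1) k(1)] set_succs_Range[of h] less.prems(2) e(2) k0
      unfolding l lk by auto
  qed
  have rec_cont: "finite (words (Q' @ succs q) X) \<and>
      int (card (words (Q' @ succs q) X)) =
        (case e of 0 \<Rightarrow> 1 | Suc e' \<Rightarrow> int (total Q) * 2 ^ e * ffact (total Q + k - 1) e') \<and> 0 < total Q"
    if Q: "Q = q # Q'" for q Q'
  proof -
    have l: "Suc (total (Q' @ succs q)) = total Q" using total_succs[of q] Q by simp
    then have lk: "total (Q' @ succs q) + k = total Q + k - 1" "0 < total Q" by linarith+
    show ?thesis
      using less.hyps[of "Q' @ succs q" k X e] set_succs_Range[of q] less.prems Q lk unfolding l lk by auto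
  qed
  note rec = card_fifo_rec[OF less.prems(2)] 
  have fin: "finite (words Q X)"
    by (rule rec(1)) (use rec_head rec_cont in auto)
  have card: "int (card (words Q X)) = (if Q = [] \<and> X = {} then 1 else 0)
      + (\<Sum>h\<in>heads X. int (card (?W h)))
      + (case Q of [] \<Rightarrow> 0 | q # Q' \<Rightarrow> int (card (words (Q' @ succs q) X)))"
    using rec_head rec_cont by (subst rec(2)) (auto split: list.splits)
  show ?case
  proof (cases e)
    case 0
    then have "heads X = {}" using less.prems(3) by simp
    then have "X = {}" using heads_empty less.prems(1) by blast
    have "int (card (words Q X)) = 1"
    proof (cases Q)
      case Nil
      then show ?thesis using card \<open>X = {}\<close> \<open>heads X = {}\<close> by simp
    next
      case (Cons q Q')
      then show ?thesis using card \<open>heads X = {}\<close> rec_cont[OF Cons] 0 by simp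
    qed
    then show ?thesis using 0 fin by simp
  next
    case (Suc e')
    then have ne: "heads X \<noteq> {}" using less.prems(3) by auto
    then have "X \<noteq> {}" by (auto simp: heads_def)
    from ne obtain n where n: "total Q + k = Suc n" using rec_head by (metis ex_in_conv add_is_0 not0_implies_Suc not_gr0)
    have T: "(case Q of [] \<Rightarrow> 0 | q # Q' \<Rightarrow> int (card (words (Q' @ succs q) X)))
       = int (total Q) * 2 ^ e * ffact n e'"
    proof (cases Q)
      case Nil then show ?thesis by simp
    next
      case (Cons q Q')
      then show ?thesis using rec_cont[OF Cons] Suc n by simp
    qed
    have c: "int (card (words Q X)) = 
      (\<Sum>h\<in>heads X. int (card (?W h))) + int (total Q) * 2 ^ e * ffact n e'"
      using card T \<open>X \<noteq> {}\<close> by simp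
    show ?thesis
    proof (cases e')
      case 0
      have "(\<Sum>h\<in>heads X. int (card (?W h))) = (\<Sum>h\<in>heads X. 1)"
        by (intro sum.cong refl) (use rec_head Suc 0 in auto)
      then show ?thesis using c Suc 0 less.prems(3) fin by simp
    next
      case (Suc e'')
      have "(\<Sum>h\<in>heads X. int (card (?W h)))
         = (\<Sum>h\<in>heads X. (int (total Q) + int (card (chain h))) * (2 ^ e' * ffact n e''))"
        by (intro sum.cong refl) (use rec_head \<open>e = Suc e'\<close> Suc n in \<open>auto simp: algebra_simps\<close>)
      also have "\<dots> = (int (card (heads X)) * int (total Q) + int (\<Sum>h\<in>heads X. card (chain h))) * (2 ^ e' * ffact n e'')"
        by (simp only: sum_distrib_right[symmetric] sum.distrib of_nat_sum sum_constant)
      also have "\<dots> = (2 * int e * int (total Q) + 2 * int k) * (2 ^ e' * ffact n e'')"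
        using sum_heads[OF less.prems(1)] less.prems(3,4) by simp
      finally have s: "(\<Sum>h\<in>heads X. int (card (?W h)))
        = (2 * int e * int (total Q) + 2 * int k) * (2 ^ e' * ffact n e'')" .
      have kk: "int k = int n + 1 - int (total Q)" using n by linarith
      have f: "ffact n e' = ffact n e'' * (int n - int e'')" using ffact_Suc Suc by simp
      have "int (card (words Q X)) = 2 ^ e * ffact n e'' *
          ((int e * int (total Q) + (int n + 1 - int (total Q))) + int (total Q) * (int n - int e''))"
        unfolding c s kk f using \<open>e = Suc e'\<close> by (simp add: algebra_simps)
      \<comment> \<open>With \<open>t = total Q\<close> and \<open>e = e'' + 2\<close>, the
        coefficients of \<open>t\<close> add up to \<open>e - 1 + n - e'' = n + 1\<close>.\<close>
      also have "(int e * int (total Q) + (int n + 1 - int (total Q))) + int (total Q) * (int n - int e'')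
         = (int n + 1) * int (Suc (total Q))"
        using \<open>e = Suc e'\<close> Suc by (simp add: algebra_simps)
      also have "2 ^ e * ffact n e'' * ((int n + 1) * int (Suc (total Q))) = int (Suc (total Q)) * 2 ^ e * ffact (Suc n) e'"
        using ffact_Suc_Suc[of n e''] Suc by simp
      finally show ?thesis using \<open>e = Suc e'\<close> fin n by simp
    qed
  qed
qed

end

section \<open>Words in which chains may cross the centre\<close>

context chains begin

definition avail :: "'a list \<Rightarrow> 'a set" where "avail Q = - (\<Union>q\<in>set Q. twin q)"

text \<open>
  The second half of the zero block starts at the letter of \<open>mid\<close>, which is the centre of every
  palindromic queue.
\<close>

definition mid :: "'a list" where
  "mid = (if \<exists>c. (c, neg c) \<in> E then [neg (THE c. (c, neg c) \<in> E)] else [])"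

text \<open>
  \<open>\<rho>\<close> lists the chains that cross the centre, from the middle of the queue outwards. A chain cut
  before \<open>r\<close> contributes \<open>r\<close>, and its negative, cut at the mirrored place, contributes \<open>flip r\<close>.
\<close>

primrec grow :: "'a list \<Rightarrow> 'a list \<Rightarrow> 'a list \<Rightarrow> bool" where
  "grow [] Q v = fifo Q (avail Q) v"
| "grow (r # \<rho>) Q v = (r \<in> avail Q \<inter> Range E \<and> grow \<rho> (r # Q @ [flip r]) v)"

lemma mid_self: "(c, neg c) \<in> E \<Longrightarrow> mid = [neg c]"
proof -
  assume c: "(c, neg c) \<in> E"
  then have "(THE c. (c, neg c) \<in> E) = c" by (rule the_equality) (use E_self c in blast)
  then show ?thesis using c by (auto simp: mid_def)
qed

lemma mid_none: "(\<And>c. (c, neg c) \<notin> E) \<Longrightarrow> mid = []"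
  by (simp add: mid_def)

lemma neg_twin: "neg s \<in> twin h \<longleftrightarrow> s \<in> twin h"
  by (auto simp: twin_def in_neg_image)

text \<open>With \<open>p\<close> the predecessor of \<open>r\<close> one has
  \<open>flip r = neg p\<close>, so the negatives of \<open>chain (flip r)\<close> are the letters
  that lead to \<open>p\<close>. Cutting \<open>chain h\<close> before \<open>r\<close> leaves these
  letters and \<open>chain r\<close>.\<close>

lemma chain_split:
  assumes "h \<notin> Range E" "r \<in> chain h" "r \<in> Range E"
  shows "chain h = chain r \<union> neg ` chain (flip r)" "chain r \<inter> neg ` chain (flip r) = {}"
proof -
  obtain p where p: "(p, r) \<in> E" using assms by auto
  have "p \<in> chain h" using assms chain_last[OF assms(2)] p E_inj by blast
  show "chain h = chain r \<union> neg ` chain (flip r)"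
  proof (intro equalityI subsetI)
    fix s assume s: "s \<in> chain h"
    have "s \<in> chain r \<or> p \<in> chain s"
      using chain_linear[OF s \<open>p \<in> chain h\<close>] chain_insert[OF p] by auto
    then show "s \<in> chain r \<union> neg ` chain (flip r)"
      using chain_neg[of s p] by (auto simp: in_neg_image flip_eq[OF p])
  next
    fix s assume "s \<in> chain r \<union> neg ` chain (flip r)"
    moreover have "s \<in> chain h" if "p \<in> chain s"
      using chain_linear'[OF that \<open>p \<in> chain h\<close>] head_chain[OF assms(1)] by auto
    ultimately show "s \<in> chain h"
      using chain_neg[of s p] chain_trans[OF assms(2)] by (auto simp: in_neg_image flip_eq[OF p])
  qed
  show "chain r \<inter> neg ` chain (flip r) = {}"
  proof (rule ccontr)
    assume "chain r \<inter> neg ` chain (flip r) \<noteq> {}"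
    then obtain s where "s \<in> chain r" "s \<in> neg ` chain (flip r)" by blast
    then have "s \<in> chain r" "neg s \<in> chain (neg p)" by (simp_all only: in_neg_image flip_eq[OF p])
    then show False using chain_neg[of s p] chain_trans chain_not[OF p] by blast
  qed
qed

lemma twin_split:
  assumes "h \<notin> Range E" "r \<in> chain h" "r \<in> Range E"
  shows "twin h = twin r \<union> twin (flip r)" "card (chain h) = card (chain r) + card (chain (flip r))"
proof -
  note s = chain_split[OF assms]
  show "twin h = twin r \<union> twin (flip r)" unfolding twin_def s(1) by (auto simp: image_Un image_image)
  show "card (chain h) = card (chain r) + card (chain (flip r))"
    using s(2) unfolding s(1) by (subst card_Un_disjoint) (auto simp: card_image)
qed

lemma card_heads: "stable X \<Longrightarrow> card (X \<inter> Range E) + card (heads X) = card X"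
  unfolding heads_def using card_Int_Diff[of X "Range E"] by simp

lemma grow_Collect: "{(\<rho>, v). grow \<rho> Q v} = (Pair []) ` (words Q (avail Q)) \<union>
    (\<Union>r\<in>avail Q \<inter> Range E. (\<lambda>(\<rho>, v). (r # \<rho>, v)) ` {(\<rho>, v). grow \<rho> (r # Q @ [flip r]) v})"
  (is "_ = ?R")
proof (intro equalityI subsetI)
  fix x assume "x \<in> {(\<rho>, v). grow \<rho> Q v}"
  then obtain \<rho> v where "x = (\<rho>, v)" "grow \<rho> Q v" by auto
  then show "x \<in> ?R"
    by (cases \<rho>) (auto simp: image_iff)
qed auto

text \<open>
  Cutting a chain moves it and its negative from \<open>avail Q\<close> into the queue, so \<open>total Q + k\<close>, the
  number of letters of the word, does not change.
\<close>

lemma card_grow: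
  assumes "stable (avail Q)" "set Q \<subseteq> Range E" "card (heads (avail Q)) = 2 * e" "card (avail Q) = 2 * k"
  shows "finite {(\<rho>, v). grow \<rho> Q v} \<and> int (card {(\<rho>, v). grow \<rho> Q v}) = 2 ^ e * ffact (total Q + k) e"
  using assms
proof (induction e arbitrary: Q k)
  case 0
  then have e: "avail Q = {}" using heads_empty by simp
  then have "k = 0" using 0 by simp
  show ?case using card_fifo[OF 0] unfolding grow_Collect[of Q] e by (simp add: card_image inj_on_def)
next
  case (Suc e)
  let ?F = "\<lambda>r. {(\<rho>, v). grow \<rho> (r # Q @ [flip r]) v}"
  let ?n = "total Q + k"
  have step: "finite (?F r) \<and> int (card (?F r)) = 2 ^ e * ffact ?n e" if r: "r \<in> avail Q \<inter> Range E" for r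
  proof -
    obtain h where h: "h \<notin> Range E" "r \<in> chain h" using head_ex by blast
    have hh: "h \<in> heads (avail Q)" using h r stable_chain[OF Suc.prems(1) h(2)] by (auto simp: heads_def)
    have s: "twin h = twin r \<union> twin (flip r)" "card (chain h) = card (chain r) + card (chain (flip r))"
      using twin_split[OF h] r by auto
    have avail: "avail (r # Q @ [flip r]) = avail Q - twin h" unfolding s avail_def by auto
    have k: "card (avail Q - twin h) = 2 * (k - card (chain h))" "card (chain h) \<le> k"
      using card_diff[OF Suc.prems(1) hh] Suc.prems(4) by auto
    have n: "total (r # Q @ [flip r]) + (k - card (chain h)) = ?n" using s(2) k(2) by simp
    have "card (heads (avail Q - twin h)) = 2 * e"
      using card_heads_diff[OF Suc.prems(1) hh] Suc.prems(3) by simp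
    then show ?thesis
      using Suc.IH[of "r # Q @ [flip r]" "k - card (chain h)"] stable_diff[OF Suc.prems(1) hh] Suc.prems(2) r flip_Range k
      unfolding avail n by auto
  qed
  have fif: "finite (words Q (avail Q))"
    "int (card (words Q (avail Q))) = int (Suc (total Q)) * 2 ^ Suc e * ffact ?n e"
    using card_fifo[OF Suc.prems] by auto
  let ?B = "\<Union>r\<in>avail Q \<inter> Range E. (\<lambda>(\<rho>, v). (r # \<rho>, v)) ` ?F r"
  have cB: "card ?B = (\<Sum>r\<in>avail Q \<inter> Range E. card (?F r))"
  proof (subst card_UN_disjoint)
    show "\<forall>i\<in>avail Q \<inter> Range E. finite ((\<lambda>(\<rho>, v). (i # \<rho>, v)) ` ?F i)" using step by blast
    show "(\<Sum>i\<in>avail Q \<inter> Range E. card ((\<lambda>(\<rho>, v). (i # \<rho>, v)) ` ?F i)) = (\<Sum>r\<in>avail Q \<inter> Range E. card (?F r))"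
      by (intro sum.cong refl card_image) (auto simp: inj_on_def)
  qed auto
  \<comment> \<open>A chain can be cut before each of its letters but the first, so all letters of
    \<open>avail Q\<close> except the \<open>2 * Suc e\<close> heads are possible cuts.\<close>
  have cr: "int (card (avail Q \<inter> Range E)) = 2 * int k - 2 * int (Suc e)"
    using card_heads[OF Suc.prems(1)] Suc.prems(3,4) by simp
  have "int (card ?B) = (\<Sum>r\<in>avail Q \<inter> Range E. 2 ^ e * ffact ?n e)"
    unfolding cB of_nat_sum by (intro sum.cong refl) (use step in blast)
  also have "\<dots> = (2 * int k - 2 * int (Suc e)) * (2 ^ e * ffact ?n e)"
    by (simp only: sum_constant cr)
  finally have iB: "int (card ?B) = (2 * int k - 2 * int (Suc e)) * (2 ^ e * ffact ?n e)" .
  have fB: "finite ?B" by (intro finite_UN_I finite_imageI) (use step in auto)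
  have "card {(\<rho>, v). grow \<rho> Q v} = card (words Q (avail Q)) + card ?B"
    unfolding grow_Collect[of Q]
    by (subst card_Un_disjoint) (use fif fB in \<open>auto simp: card_image inj_on_def\<close>)
  \<comment> \<open>Up to the common factor \<open>2 ^ e * ffact ?n e\<close>, the words without a
    further cut contribute \<open>2 * (total Q + 1)\<close> and the others
    \<open>2 * k - 2 * (e + 1)\<close>. The sum is \<open>2 * (?n - e)\<close>, which is what
    \<open>2 ^ Suc e * ffact ?n (Suc e)\<close> asks for.\<close>
  then have "int (card {(\<rho>, v). grow \<rho> Q v}) = 2 ^ Suc e * ffact ?n (Suc e)"
    using fif(2) iB by (simp add: ffact_Suc algebra_simps)
  moreover have "finite {(\<rho>, v). grow \<rho> Q v}" unfolding grow_Collect[of Q] using fif fB by blast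
  ultimately show ?case by simp
qed

text \<open>Negation maps a chain from \<open>s\<close> to \<open>neg s\<close> to itself and
  reverses it. Peeling off both ends leads to its middle, which is an arc and not a letter because
  \<open>neg\<close> has no fixed point.\<close>

lemma self_arc: "neg s \<in> chain s \<Longrightarrow> \<exists>c\<in>chain s. (c, neg c) \<in> E"
proof (induction "card (chain s)" arbitrary: s rule: less_induct)
  case less
  obtain t where t: "(s, t) \<in> E"
    using less.prems chain_single[of s] by (metis DomainE neg_ne singletonD)
  show ?case
  proof (cases "t = neg s")
    case True then show ?thesis using t chain_refl by blast
  next
    case False
    have "neg s \<in> chain t" using less.prems chain_insert[OF t] by auto
    then obtain u where "u \<in> chain t" "(u, neg s) \<in> E" using chain_last False by metis
    then have "neg t \<in> chain t" using E_inj E_sym[OF t] by blast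
    moreover have "card (chain t) < card (chain s)" using chain_insert[OF t] chain_not[OF t] by simp
    ultimately show ?thesis using less.hyps chain_insert[OF t] by blast
  qed
qed

text \<open>Otherwise \<open>self_arc\<close> would produce a second arc \<open>(d, neg d)\<close>
  beyond \<open>c\<close>, against \<open>E_self\<close>.\<close>

lemma mid_separated: assumes c: "(c, neg c) \<in> E" shows "chain (neg c) \<inter> neg ` chain (neg c) = {}"
proof (rule ccontr)
  assume "chain (neg c) \<inter> neg ` chain (neg c) \<noteq> {}"
  then obtain t where t: "t \<in> chain (neg c)" "neg t \<in> chain (neg c)" by (auto simp: in_neg_image)
  then have "neg t \<in> chain t \<or> neg (neg t) \<in> chain (neg t)" using chain_linear by auto
  then obtain d where "d \<in> chain (neg c)" "(d, neg d) \<in> E" using self_arc t chain_trans by blast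
  then show False using E_self[OF c] chain_not[OF c] by blast
qed

lemma mid_cases: obtains (self) c where "(c, neg c) \<in> E" "mid = [neg c]" "avail mid = - twin (neg c)"
  | (none) "\<And>c. (c, neg c) \<notin> E" "mid = []" "avail mid = UNIV"
proof (cases "\<exists>c. (c, neg c) \<in> E")
  case True
  then obtain c where "(c, neg c) \<in> E" by blast
  with mid_self show ?thesis by (intro self) (auto simp: avail_def)
next
  case False
  then show ?thesis using mid_none by (intro none) (auto simp: avail_def)
qed

lemma mid_Range: "set mid \<subseteq> Range E"
  by (rule mid_cases) auto

lemma twin_mid: assumes c: "(c, neg c) \<in> E" "h \<notin> Range E" "neg c \<in> chain h" shows "twin (neg c) = twin h"
  using twin_split(1)[OF c(2,3)] c by (auto simp: flip_eq)

text \<open>A chain from \<open>s\<close> to \<open>neg s\<close> contains an arc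
  \<open>(d, neg d)\<close>. By \<open>E_self\<close> there is at most one such arc, and it lies in
  the zero block.\<close>

lemma stable_mid: "stable (avail mid)"
proof (cases rule: mid_cases)
  case (self c)
  obtain h where h: "h \<notin> Range E" "neg c \<in> chain h" using head_ex by blast
  show ?thesis unfolding stable_def self(3) twin_mid[OF self(1) h]
  proof (intro conjI allI impI ballI)
    fix s assume s: "s \<in> - twin h"
    show "neg s \<notin> chain s"
    proof
      assume "neg s \<in> chain s"
      then obtain d where "d \<in> chain s" "(d, neg d) \<in> E" using self_arc by blast
      then have "neg s \<in> chain (neg c)" using E_self[OF self(1)] chain_neg by blast
      then show False using s twin_mid[OF self(1) h] by (auto simp: twin_def in_neg_image)
    qed
  qed (use twin_E[OF h(1)] neg_twin in auto)
next
  case none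
  then show ?thesis unfolding stable_def using self_arc by blast
qed

lemma card_mid: "2 * total mid + card (avail mid) = CARD('a)"
proof (cases rule: mid_cases)
  case (self c)
  have "card (twin (neg c)) = 2 * card (chain (neg c))"
    unfolding twin_def using mid_separated[OF self(1)] by (subst card_Un_disjoint) (auto simp: card_image)
  moreover have "card (avail mid) = CARD('a) - card (twin (neg c))"
    unfolding self(3) by (simp add: Compl_eq_Diff_UNIV card_Diff_subset)
  moreover have "card (twin (neg c)) \<le> CARD('a)" by (simp add: card_mono)
  moreover have "total mid = card (chain (neg c))" using self(2) by simp
  ultimately show ?thesis by simp
next
  case none
  have "total mid = 0" using none(2) by simp
  then show ?thesis unfolding none(3) by simp
qed

lemma even_stable: "stable X \<Longrightarrow> even (card X) \<and> even (card (heads X))"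
proof (induction "card X" arbitrary: X rule: less_induct)
  case less
  show ?case
  proof (cases "heads X = {}")
    case True
    then have "X = {}" using heads_empty less.prems by blast
    then show ?thesis by simp
  next
    case False
    then obtain h where h: "h \<in> heads X" by blast
    then show ?thesis
      using less.hyps[OF _ stable_diff[OF less.prems h]] card_diff[OF less.prems h] card_heads_diff[OF less.prems h] card_chain_pos[of h]
      by simp
  qed
qed

text \<open>The number \<open>e\<close> of the overview: the blocks other than the zero block,
  counted up to sign.\<close>

definition nblocks :: nat where "nblocks = card (heads (avail mid)) div 2"

lemma nblocks: "card (heads (avail mid)) = 2 * nblocks"
  using even_stable[OF stable_mid] by (simp add: nblocks_def)

lemma card_grow_mid: "int (card {(\<rho>, v). grow \<rho> mid v}) = 2 ^ nblocks * ffact (CARD('a) div 2) nblocks"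
proof -
  obtain k where k: "card (avail mid) = 2 * k" using even_stable[OF stable_mid] by blast
  then have "total mid + k = CARD('a) div 2" using card_mid by simp
  then show ?thesis using card_grow[OF stable_mid mid_Range nblocks k] by simp
qed

end

section \<open>The order in which a word lists its letters\<close>

primrec before :: "'a list \<Rightarrow> ('a \<times> 'a) set" where
  "before [] = {}"
| "before (h # v) = {h} \<times> set v \<union> before v"

lemma before_set: "(a, b) \<in> before v \<Longrightarrow> a \<in> set v \<and> b \<in> set v"
  by (induction v) auto

lemma before_total: "a \<in> set v \<Longrightarrow> b \<in> set v \<Longrightarrow> a \<noteq> b \<Longrightarrow> (a, b) \<in> before v \<or> (b, a) \<in> before v"
  by (induction v) auto

lemma before_irrefl: "distinct v \<Longrightarrow> (a, a) \<notin> before v"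
  by (induction v) auto

lemma before_trans: "distinct v \<Longrightarrow> (a, b) \<in> before v \<Longrightarrow> (b, c) \<in> before v \<Longrightarrow> (a, c) \<in> before v"
  by (induction v) (auto dest: before_set)

lemma before_asym: "distinct v \<Longrightarrow> (a, b) \<in> before v \<Longrightarrow> (b, a) \<notin> before v"
  using before_irrefl before_trans by metis

lemma before_filter: "before (filter P v) = {(a, b) \<in> before v. P a \<and> P b}"
  by (induction v) auto

lemma before_append: "before (u @ v) = before u \<union> before v \<union> set u \<times> set v"
  by (induction u) auto

lemma before_rev: "before (rev v) = (before v)\<inverse>"
  by (induction v) (auto simp: before_append)

lemma before_map: "(a, b) \<in> before v \<Longrightarrow> (f a, f b) \<in> before (map f v)"
  by (induction v) auto

lemma before_last:
  assumes "distinct w" "b \<in> set w" "\<And>c. c \<in> set w \<Longrightarrow> c \<noteq> b \<Longrightarrow> (c, b) \<in> before w"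
  shows "\<exists>qs. w = qs @ [b]"
proof -
  obtain qs l where w: "w = qs @ [l]" using assms(2) by (metis empty_iff list.set(1) rev_exhaust)
  have "l = b"
  proof (rule ccontr)
    assume "l \<noteq> b"
    then have "(l, b) \<in> before w" using assms(3) w by simp
    moreover have "(b, l) \<in> before w" using assms(2) \<open>l \<noteq> b\<close> w by (auto simp: before_append)
    ultimately show False using assms(1) before_asym by metis
  qed
  then show ?thesis using w by simp
qed

lemma before_unique: "distinct u \<Longrightarrow> distinct v \<Longrightarrow> set u = set v \<Longrightarrow> before u \<subseteq> before v \<Longrightarrow> u = v"
proof (induction u arbitrary: v)
  case Nil then show ?case by simp
next
  case (Cons h u)
  obtain g w where v: "v = g # w" using Cons.prems(3) by (cases v) auto
  have "g = h"
  proof (rule ccontr)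
    assume "g \<noteq> h"
    then have "g \<in> set u" "h \<in> set w" using Cons.prems v by (metis insert_iff list.set(2))+
    then have "(h, g) \<in> before v" "(g, h) \<in> before v" using Cons.prems(4) v by auto
    then show False using Cons.prems(2) before_asym by metis
  qed
  moreover have "u = w"
  proof (rule Cons.IH)
    show "set u = set w" using Cons.prems v \<open>g = h\<close> by (simp add: insert_ident)
    show "before u \<subseteq> before w"
    proof
      fix x assume x: "x \<in> before u"
      then have "x \<in> before v" using Cons.prems(4) by auto
      moreover have "fst x \<noteq> h" using x before_set[of "fst x" "snd x" u] Cons.prems(1) by auto
      ultimately show "x \<in> before w" using v \<open>g = h\<close> by auto
    qed
  qed (use Cons.prems v in auto)
  ultimately show ?case using v by simp
qed

section \<open>First-in first-out service as a property of the order\<close>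

context chains begin

lemma E_irrefl: "(s, s) \<notin> E"
  using E_prec prec_irrefl by blast

text \<open>
  For the word \<open>v\<close> of the letters on one side of the centre, read outwards, \<open>queue v\<close> consists of
  the letters whose predecessors lie on the other side.
\<close>

definition queue :: "'a list \<Rightarrow> 'a list" where
  "queue v = filter (\<lambda>b. \<exists>a. (a, b) \<in> E \<and> a \<notin> set v) v"

primrec valid :: "'a list \<Rightarrow> bool" where
  "valid [] = True"
| "valid (h # v) = (valid v \<and> h \<notin> set v \<and> (\<forall>a\<in>set v. (a, h) \<notin> E) \<and>
     (\<forall>b. (h, b) \<in> E \<longrightarrow> (\<exists>qs. queue v = qs @ [b])))"

lemma valid_distinct: "valid v \<Longrightarrow> distinct v"
  by (induction v) auto

lemma distinct_queue: "distinct v \<Longrightarrow> distinct (queue v)"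
  by (simp add: queue_def)

lemma queue_Nil [simp]: "queue [] = []"
  by (simp add: queue_def)

lemma set_queue: "b \<in> set (queue v) \<longleftrightarrow> b \<in> set v \<and> (\<exists>a. (a, b) \<in> E \<and> a \<notin> set v)"
  by (auto simp: queue_def)

text \<open>One step of the service: reading \<open>h\<close> removes it from the front of the
  queue, if it was pending, and puts its successor at the back.\<close>

lemma queue_Cons: assumes "valid (h # v)"
  shows "queue (h # v) @ succs h = (if h \<in> Range E then [h] else []) @ queue v"
proof -
  have h: "(\<exists>a. (a, h) \<in> E \<and> a \<notin> set (h # v)) \<longleftrightarrow> h \<in> Range E"
    using assms E_irrefl by (auto simp: Range_iff)
  have d: "distinct (queue v)" using assms valid_distinct distinct_queue by simp
  have eq: "queue (h # v) = (if h \<in> Range E then [h] else [])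
      @ filter (\<lambda>b. \<exists>a. (a, b) \<in> E \<and> a \<notin> set (h # v)) v"
    unfolding queue_def
    by (cases "h \<in> Range E") (simp_all only: filter.simps h if_True if_False append.simps simp_thms)
  show ?thesis
  proof (cases "h \<in> Domain E")
    case True
    then obtain b where b: "(h, b) \<in> E" by auto
    then obtain qs where qs: "queue v = qs @ [b]" using assms by auto
    have "filter (\<lambda>b. \<exists>a. (a, b) \<in> E \<and> a \<notin> set (h # v)) v = filter (\<lambda>x. x \<noteq> b) (queue v)"
      unfolding queue_def filter_filter
      by (intro filter_cong refl) (use b E_fun E_inj in \<open>metis insert_iff list.set(2)\<close>)
    also have "\<dots> = qs" using d qs by (auto simp: filter_id_conv)
    finally show ?thesis using eq qs succs_eq[OF b] by simp
  next
    case False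
    have "filter (\<lambda>b. \<exists>a. (a, b) \<in> E \<and> a \<notin> set (h # v)) v = queue v"
      unfolding queue_def by (intro filter_cong refl) (use False in auto)
    then show ?thesis using eq succs_Nil[OF False] by simp
  qed
qed

abbreviation earlier :: "'a list \<Rightarrow> 'a \<Rightarrow> 'a \<Rightarrow> bool" where
  "earlier v a a' \<equiv> a \<notin> set v \<and> a' \<in> set v \<or> (a, a') \<in> before v"

text \<open>First-in first-out without a queue: arcs that start earlier end earlier. A letter
  outside \<open>v\<close> lies beyond the centre or was read before, so it counts as earlier than
  the letters of \<open>v\<close>, but two letters outside \<open>v\<close> are not
  compared.\<close>

lemma valid_iff: assumes "distinct v"
  shows "valid v \<longleftrightarrow> (\<forall>a b. (a, b) \<in> E \<and> a \<in> set v \<longrightarrow> (a, b) \<in> before v) \<and>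
    (\<forall>a b a' b'. (a, b) \<in> E \<and> (a', b') \<in> E \<and> b \<in> set v \<and> earlier v a a'
       \<longrightarrow> (b, b') \<in> before v)"
  using assms
proof (induction v)
  case Nil then show ?case by simp
next
  case (Cons h v)
  note IH = Cons.IH[OF distinct.simps(2)[THEN iffD1, OF Cons.prems, THEN conjunct2]]
  have hv: "h \<notin> set v" "distinct v" using Cons.prems by auto
  show ?case
  proof (intro iffI conjI allI impI)
    fix a b assume valid: "valid (h # v)" and ab: "(a, b) \<in> E \<and> a \<in> set (h # v)"
    show "(a, b) \<in> before (h # v)"
    proof (cases "a = h")
      case True
      then obtain qs where "queue v = qs @ [b]" using valid ab by auto
      then have "b \<in> set v" using set_queue[of b v] by auto
      then show ?thesis using True by simp
    next
      case False
      then show ?thesis using IH valid ab by simp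
    qed
  next
    fix a b a' b'
    assume valid: "valid (h # v)" and ab: "(a, b) \<in> E \<and> (a', b') \<in> E \<and> b \<in> set (h # v) \<and>
      earlier (h # v) a a'"
    then have IH': "(\<forall>a b. (a, b) \<in> E \<and> a \<in> set v \<longrightarrow> (a, b) \<in> before v)"
      "\<And>a b a' b'. (a, b) \<in> E \<Longrightarrow> (a', b') \<in> E \<Longrightarrow> b \<in> set v \<Longrightarrow> earlier v a a'
         \<Longrightarrow> (b, b') \<in> before v"
      using IH by auto
    have b': "b' \<in> set v"
    proof (cases "a' = h")
      case True
      then obtain qs where "queue v = qs @ [b']" using valid ab by auto
      then show ?thesis using set_queue[of b' v] by auto
    next
      case False
      then have "a' \<in> set v" using ab before_set[of a a'] by auto
      then show ?thesis using IH'(1) ab before_set by metis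
    qed
    show "(b, b') \<in> before (h # v)"
    proof (cases "b = h")
      case True then show ?thesis using b' by simp
    next
      case False
      then have bv: "b \<in> set v" using ab by simp
      show ?thesis
      proof (cases "a' = h")
        case True
        then obtain qs where qs: "queue v = qs @ [b']" using valid ab by auto
        have "a \<notin> set (h # v)" using True ab hv before_set[of a h v] by auto
        then have "b \<in> set (queue v)" "b \<noteq> b'" using ab bv set_queue E_inj[of a b a'] True by auto
        then have "(b, b') \<in> before (queue v)" using qs by (auto simp: before_append)
        then show ?thesis unfolding queue_def before_filter by auto
      next
        case False
        have "earlier v a a'" using ab False hv before_set[of a a'] by auto
        then show ?thesis using IH'(2) ab bv by auto
      qed
    qed
  next
    assume C: "(\<forall>a b. (a, b) \<in> E \<and> a \<in> set (h # v) \<longrightarrow> (a, b) \<in> before (h # v)) \<and>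
      (\<forall>a b a' b'. (a, b) \<in> E \<and> (a', b') \<in> E \<and> b \<in> set (h # v) \<and>
        earlier (h # v) a a' \<longrightarrow> (b, b') \<in> before (h # v))"
    then have C1: "\<And>a b. (a, b) \<in> E \<Longrightarrow> a \<in> set (h # v) \<Longrightarrow> (a, b) \<in> before (h # v)"
      and C2: "\<And>a b a' b'. (a, b) \<in> E \<Longrightarrow> (a', b') \<in> E \<Longrightarrow> b \<in> set (h # v) \<Longrightarrow>
        earlier (h # v) a a' \<Longrightarrow> (b, b') \<in> before (h # v)"
      by blast+
    have "valid v"
      unfolding IH
    proof (intro conjI allI impI)
      fix a b assume "(a, b) \<in> E \<and> a \<in> set v"
      then show "(a, b) \<in> before v" using C1[of a b] hv by auto
    next
      fix a b a' b'
      assume ab: "(a, b) \<in> E \<and> (a', b') \<in> E \<and> b \<in> set v \<and> earlier v a a'"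
      then have "(b, b') \<in> before (h # v)"
        by (intro C2[of a b a' b']) (auto dest: before_set)
      then show "(b, b') \<in> before v" using ab hv by auto
    qed
    moreover have "(a, h) \<notin> E" if "a \<in> set v" for a
      using C1[of a h] that hv before_set[of a h v] by auto
    \<comment> \<open>Any other pending letter has its predecessor outside \<open>h # v\<close>,
      hence earlier than \<open>h\<close>, so it comes before \<open>b\<close>.\<close>
    moreover have "\<exists>qs. queue v = qs @ [b]" if hb: "(h, b) \<in> E" for b
    proof (rule before_last)
      have b: "b \<in> set v" using C1[of h b] hb hv before_set[of h b v] by auto
      then show "b \<in> set (queue v)" using hb hv by (auto simp: set_queue)
      fix c assume c: "c \<in> set (queue v)" "c \<noteq> b"
      then obtain a where a: "(a, c) \<in> E" "a \<notin> set v" "c \<in> set v" by (auto simp: set_queue)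
      then have "a \<noteq> h" using E_fun[OF hb] c by auto
      then have "(c, b) \<in> before (h # v)" using C2[OF a(1) hb] a by auto
      then have "(c, b) \<in> before v" using a hv by auto
      then show "(c, b) \<in> before (queue v)" using c \<open>b \<in> set (queue v)\<close> unfolding queue_def before_filter by auto
    qed (use hv distinct_queue in auto)
    ultimately show "valid (h # v)" using hv by auto
  qed
qed

lemma valid_chain: assumes "valid v" "s \<in> set v" shows "chain s \<subseteq> set v"
proof
  fix t assume "t \<in> chain s"
  then have "(s, t) \<in> E\<^sup>*" by (simp add: chain_def)
  then show "t \<in> set v"
  proof induction
    case base then show ?case using assms by simp
  next
    case (step y z)
    then have "(y, z) \<in> before v" using valid_iff[OF valid_distinct[OF assms(1)]] assms(1) by blast
    then show ?case using before_set by metis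
  qed
qed

text \<open>A system of representatives of the pairs \<open>s\<close>, \<open>neg s\<close> in
  \<open>X\<close>; it arises because starting a chain discards its negative.\<close>

definition half :: "'a set \<Rightarrow> 'a set \<Rightarrow> bool" where
  "half Y X \<longleftrightarrow> Y \<subseteq> X \<and> Y \<inter> neg ` Y = {} \<and> X \<subseteq> Y \<union> neg ` Y"

definition reach :: "'a list \<Rightarrow> 'a set" where "reach Q = (\<Union>q\<in>set Q. chain q)"

lemma reach_simps [simp]: "reach [] = {}" "reach (q # Q) = chain q \<union> reach Q" "reach (Q @ Q') = reach Q \<union> reach Q'"
  by (auto simp: reach_def)

lemma reach_succs: "chain s = insert s (reach (succs s))"
  using chain_succs[of s] by (simp add: reach_def)

lemma not_reach_succs: "s \<notin> reach (succs s)"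
  by (cases "s \<in> Domain E") (auto simp: succs_eq succs_Nil chain_not)

abbreviation separated :: "'a list \<Rightarrow> bool" where "separated \<equiv> sorted_wrt (\<lambda>a b. chain a \<inter> chain b = {})"

lemma chain_Range: "q \<in> Range E \<Longrightarrow> t \<in> chain q \<Longrightarrow> t \<in> Range E"
  using chain_last by blast

lemma separated_succs: assumes "separated Q" "chain s \<inter> reach Q = {}" shows "separated (Q @ succs s)"
proof (cases "s \<in> Domain E")
  case True
  then obtain t where t: "(s, t) \<in> E" by auto
  then show ?thesis using assms chain_insert[OF t] by (auto simp: succs_eq sorted_wrt_append reach_def)
next
  case False
  then show ?thesis using assms by (simp add: succs_Nil)
qed

lemma separated_Cons: "separated (q # Q) \<longleftrightarrow> chain q \<inter> reach Q = {} \<and> separated Q"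
  by (auto simp: reach_def)

text \<open>A word that serves \<open>Q\<close> consists of the chains hanging from \<open>Q\<close>
  and one chain of each opposite pair in \<open>X\<close>. The disjointness assumptions keep letters
  from being repeated and are restored by both rules of \<open>fifo\<close>.\<close>

lemma fifo_valid:
  assumes "fifo Q X v" "stable X" "set Q \<subseteq> Range E" "separated Q" "reach Q \<inter> X = {}"
  shows "valid v \<and> queue v = Q \<and> (\<exists>Y. set v = reach Q \<union> Y \<and> half Y X)"
  using assms
proof induction
  case fifo_Nil then show ?case by (simp add: half_def)
next
  case (fifo_start h X Q v)
  have h: "h \<in> X" "h \<notin> Range E" using fifo_start by (auto simp: heads_def)
  have fX: "chain h \<subseteq> X" using stable_chain[OF fifo_start.prems(1)] h by auto
  have dis: "chain h \<inter> reach Q = {}" using fX fifo_start.prems(4) by blast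
  have "set (Q @ succs h) \<subseteq> Range E" using fifo_start.prems(2) set_succs_Range by auto
  moreover have "separated (Q @ succs h)" using separated_succs dis fifo_start.prems(3) by blast
  moreover have "reach (Q @ succs h) \<inter> (X - twin h) = {}"
    using fifo_start.prems(4) reach_succs[of h] by (auto simp: twin_def)
  ultimately obtain Y where IH: "valid v" "queue v = Q @ succs h" "set v = reach (Q @ succs h) \<union> Y" "half Y (X - twin h)"
    using fifo_start.IH stable_diff[OF fifo_start.prems(1) fifo_start.hyps(1)] by blast
  have "h \<notin> reach Q" using dis chain_refl[of h] by blast
  then have hv: "h \<notin> set v" using IH(3,4) not_reach_succs[of h] by (auto simp: half_def twin_def)
  have valid: "valid (h # v)" using IH(1,2) hv h succs_eq[of h] by auto
  have "queue (h # v) @ succs h = Q @ succs h" using queue_Cons[OF valid] h IH(2) by simp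
  moreover have "set (h # v) = reach Q \<union> (chain h \<union> Y)" using IH(3) reach_succs[of h] by auto
  moreover have "half (chain h \<union> Y) X"
    using IH(4) stable_separated[OF fifo_start.prems(1) h(1)] stable_twin[OF fifo_start.prems(1) h(1)]
    unfolding half_def twin_def by (auto simp: in_neg_image)
  ultimately show ?case using valid by auto
next
  case (fifo_cont Q q X v)
  have dis: "chain q \<inter> reach Q = {}" "separated Q" using fifo_cont.prems(3) separated_Cons by blast+
  have "set (Q @ succs q) \<subseteq> Range E" using fifo_cont.prems(2) set_succs_Range by auto
  moreover have "separated (Q @ succs q)" using separated_succs dis by blast
  moreover have "reach (Q @ succs q) \<inter> X = {}" using fifo_cont.prems(4) reach_succs[of q] by auto
  ultimately obtain Y where IH: "valid v" "queue v = Q @ succs q" "set v = reach (Q @ succs q) \<union> Y" "half Y X"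
    using fifo_cont.IH fifo_cont.prems(1) by blast
  have qX: "q \<notin> X" using fifo_cont.prems(4) chain_refl[of q] unfolding reach_simps by blast
  have "q \<notin> reach Q" using dis(1) chain_refl[of q] by blast
  then have hv: "q \<notin> set v" using IH(3,4) not_reach_succs[of q] qX by (auto simp: half_def)
  have "(a, q) \<notin> E" if "a \<in> set v" for a
  proof
    assume aq: "(a, q) \<in> E"
    consider "a \<in> reach Q" | "a \<in> reach (succs q)" | "a \<in> X" using \<open>a \<in> set v\<close> IH(3,4) by (auto simp: half_def)
    then show False
    proof cases
      case 1
      then obtain c where "c \<in> set Q" "a \<in> chain c" by (auto simp: reach_def)
      then have "q \<in> reach Q" using chain_E[OF _ aq] by (auto simp: reach_def)
      then show ?thesis using \<open>q \<notin> reach Q\<close> by blast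
    next
      case 2
      then have "a \<in> chain q" using reach_succs by auto
      then show ?thesis using chain_not[OF aq] by blast
    next
      case 3 then show ?thesis using aq qX fifo_cont.prems(1) by (auto simp: stable_def)
    qed
  qed
  then have valid: "valid (q # v)" using IH(1,2) hv succs_eq[of q] by auto
  have "queue (q # v) @ succs q = (q # Q) @ succs q" using queue_Cons[OF valid] IH(2) fifo_cont.prems(2) by auto
  moreover have "set (q # v) = reach (q # Q) \<union> Y" using IH(3) reach_succs[of q] by auto
  ultimately show ?case using valid IH(4) by auto
qed

text \<open>The first letter decides which rule of \<open>fifo\<close> applies: if it has a
  predecessor it is pending and therefore the front of the queue, otherwise it is a head in
  \<open>X\<close>.\<close>

lemma valid_fifo:
  assumes "valid v" "queue v = Q" "set v = reach Q \<union> Y" "half Y X" "stable X" "set Q \<subseteq> Range E" "separated Q" "reach Q \<inter> X = {}"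
  shows "fifo Q X v"
  using assms
proof (induction v arbitrary: Q X Y)
  case Nil
  then have "Q = []" "Y = {}" by auto
  then have "X = {}" using Nil.prems(4) by (simp add: half_def)
  then show ?case using \<open>Q = []\<close> fifo_Nil by simp
next
  case (Cons h v)
  have queue: "Q @ succs h = (if h \<in> Range E then [h] else []) @ queue v"
    using queue_Cons[OF Cons.prems(1)] Cons.prems(2) by simp
  have hv: "h \<notin> set v" "valid v" using Cons.prems(1) by auto
  show ?case
  proof (cases "h \<in> Range E")
    case True
    have "h \<in> set Q"
      unfolding Cons.prems(2)[symmetric] set_queue using True Cons.prems(1) E_irrefl by (auto simp: Range_iff)
    then obtain q Q' where "Q = q # Q'" by (cases Q) auto
    then have Q: "Q = h # Q'" "queue v = Q' @ succs h" using queue True by auto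
    have dis: "chain h \<inter> reach Q' = {}" "separated Q'" using Cons.prems(7) separated_Cons Q(1) by blast+
    have hX: "h \<notin> X" using Cons.prems(8) chain_refl[of h] unfolding Q(1) reach_simps by blast
    have "fifo (Q' @ succs h) X v"
    proof (rule Cons.IH[OF hv(2) Q(2)])
      have "insert h (set v) = insert h (reach (Q' @ succs h) \<union> Y)"
        using Cons.prems(3) Q(1) reach_succs[of h] by auto
      moreover have "h \<notin> reach Q'" using dis(1) chain_refl[of h] by blast
      then have "h \<notin> reach (Q' @ succs h) \<union> Y"
        using hX Cons.prems(4) not_reach_succs[of h] by (auto simp: half_def)
      ultimately show "set v = reach (Q' @ succs h) \<union> Y" using hv(1) by (simp add: insert_ident)
      show "set (Q' @ succs h) \<subseteq> Range E" using Cons.prems(6) Q set_succs_Range by auto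
      show "separated (Q' @ succs h)" using separated_succs dis by blast
      show "reach (Q' @ succs h) \<inter> X = {}" using Cons.prems(8) Q(1) reach_succs[of h] by auto
    qed (use Cons.prems in auto)
    then show ?thesis using Q(1) fifo_cont by simp
  next
    case False
    then have Q: "queue v = Q @ succs h" using queue by simp
    have hQ: "h \<notin> reach Q" using False chain_Range Cons.prems(6) unfolding reach_def by blast
    then have hY: "h \<in> Y" using Cons.prems(3) by auto
    then have hX: "h \<in> X" using Cons.prems(4) by (auto simp: half_def)
    have hh: "h \<in> heads X" using hX False by (simp add: heads_def)
    have fX: "chain h \<subseteq> X" using stable_chain[OF Cons.prems(5)] hX by auto
    have dis: "chain h \<inter> reach Q = {}" using fX Cons.prems(8) by blast
    \<comment> \<open>In a valid word the rest of a chain follows its first letter, so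
      \<open>Y\<close> contains all of \<open>chain h\<close>.\<close>
    have "chain h \<subseteq> set (h # v)" using valid_chain[OF Cons.prems(1)] by auto
    then have fY: "chain h \<subseteq> Y" using Cons.prems(3) dis by auto
    have "fifo (Q @ succs h) (X - twin h) v"
    proof (rule Cons.IH[OF hv(2) Q])
      have "insert h (set v) = insert h (reach (Q @ succs h) \<union> (Y - chain h))"
        using Cons.prems(3) reach_succs[of h] fY hY by auto
      moreover have "h \<notin> reach (Q @ succs h) \<union> (Y - chain h)" using hQ not_reach_succs[of h] by auto
      ultimately show "set v = reach (Q @ succs h) \<union> (Y - chain h)" using hv(1) by (simp add: insert_ident)
      show "half (Y - chain h) (X - twin h)"
        using Cons.prems(4) fY unfolding half_def twin_def by (auto simp: in_neg_image)
      show "stable (X - twin h)" using stable_diff[OF Cons.prems(5) hh] .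
      show "set (Q @ succs h) \<subseteq> Range E" using Cons.prems(6) set_succs_Range by auto
      show "separated (Q @ succs h)" using separated_succs dis Cons.prems(7) by blast
      show "reach (Q @ succs h) \<inter> (X - twin h) = {}" using Cons.prems(8) reach_succs[of h] by (auto simp: twin_def)
    qed
    then show ?thesis using hh fifo_start by simp
  qed
qed

end

section \<open>Symmetric linear orders\<close>

text \<open>Topological sorting: remove a minimal element and put it in front of a list of the
  others.\<close>

lemma ex_sorted_list:
  fixes L :: "('a \<times> 'a) set"
  assumes "finite A" "trans L" "\<And>s. (s, s) \<notin> L" "\<And>s t. s \<in> A \<Longrightarrow> t \<in> A \<Longrightarrow> s \<noteq> t \<Longrightarrow> (s, t) \<in> L \<or> (t, s) \<in> L"
  shows "\<exists>u. distinct u \<and> set u = A \<and> before u \<subseteq> L"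
  using assms(1,4)
proof (induction "card A" arbitrary: A)
  case 0
  then show ?case by (intro exI[of _ "[]"]) auto
next
  case (Suc n)
  have wf: "wf (L \<inter> A \<times> A)"
  proof (rule finite_acyclic_wf)
    have "acyclic L" unfolding acyclic_def trancl_id[OF assms(2)] using assms(3) by blast
    then show "acyclic (L \<inter> A \<times> A)" by (rule acyclic_subset) blast
  qed (use Suc.prems in auto)
  obtain x where "x \<in> A" using Suc.hyps(2) by fastforce
  then have "\<exists>h\<in>A. \<forall>t. (t, h) \<in> L \<inter> A \<times> A \<longrightarrow> t \<notin> A"
    using wf[unfolded wf_eq_minimal, rule_format, of x A] by blast
  then obtain h where h: "h \<in> A" "\<And>t. (t, h) \<in> L \<inter> A \<times> A \<Longrightarrow> t \<notin> A" by blast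
  have A: "n = card (A - {h})" "finite (A - {h})"
    using Suc.hyps(2) Suc.prems(1) h(1) by (simp_all add: card_Diff_singleton)
  then obtain u where u: "distinct u" "set u = A - {h}" "before u \<subseteq> L"
    using Suc.hyps(1)[OF A] Suc.prems(2) by auto
  have "(h, t) \<in> L" if "t \<in> A - {h}" for t
    using Suc.prems(2)[of h t] h(1) h(2)[of t] that by blast
  then have "distinct (h # u)" "set (h # u) = A" "before (h # u) \<subseteq> L"
    using u h(1) by auto
  then show ?case by blast
qed

context signed_order begin

definition symlin :: "('a \<times> 'a) set \<Rightarrow> bool" where
  "symlin L \<longleftrightarrow> (\<forall>s. (s, s) \<notin> L) \<and> trans L \<and> (\<forall>s t. s \<noteq> t \<longrightarrow> (s, t) \<in> L \<or> (t, s) \<in> L) \<and>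
     (\<forall>s t. (s, t) \<in> L \<longrightarrow> (neg t, neg s) \<in> L)"

lemma symlinD:
  assumes "symlin L"
  shows "(s, s) \<notin> L" "(s, t) \<in> L \<Longrightarrow> (t, u) \<in> L \<Longrightarrow> (s, u) \<in> L"
    "s \<noteq> t \<Longrightarrow> (s, t) \<in> L \<or> (t, s) \<in> L" "(s, t) \<in> L \<Longrightarrow> (neg t, neg s) \<in> L"
    "(s, t) \<in> L \<Longrightarrow> (t, s) \<notin> L" "(neg t, neg s) \<in> L \<longleftrightarrow> (s, t) \<in> L"
proof -
  show 1: "\<And>s. (s, s) \<notin> L" and 2: "\<And>s t u. (s, t) \<in> L \<Longrightarrow> (t, u) \<in> L \<Longrightarrow> (s, u) \<in> L"
    and "s \<noteq> t \<Longrightarrow> (s, t) \<in> L \<or> (t, s) \<in> L" and 3: "\<And>s t. (s, t) \<in> L \<Longrightarrow> (neg t, neg s) \<in> L"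
    using assms unfolding symlin_def trans_def by blast+
  show "(s, t) \<in> L \<Longrightarrow> (t, s) \<notin> L" using 1 2 by blast
  show "(neg t, neg s) \<in> L \<longleftrightarrow> (s, t) \<in> L" using 3[of s t] 3[of "neg t" "neg s"] by auto
qed

text \<open>The order in which \<open>v\<close> is preceded by its negative read backwards.\<close>

definition lin_of :: "'a list \<Rightarrow> ('a \<times> 'a) set" where
  "lin_of v = {(s, t). (s \<notin> set v \<and> t \<in> set v) \<or> (s, t) \<in> before v \<or> (neg t, neg s) \<in> before v}"

definition halfword :: "'a list \<Rightarrow> bool" where
  "halfword v \<longleftrightarrow> distinct v \<and> set v \<inter> neg ` set v = {} \<and> set v \<union> neg ` set v = UNIV"

lemma halfword_neg: "halfword v \<Longrightarrow> neg s \<in> set v \<longleftrightarrow> s \<notin> set v"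
  unfolding halfword_def by (metis IntI UNIV_I UnE empty_iff in_neg_image)

lemma lin_of_before: "halfword v \<Longrightarrow> s \<in> set v \<Longrightarrow> (s, t) \<in> lin_of v \<longleftrightarrow> (s, t) \<in> before v"
  using halfword_neg[of v s] before_set[of "neg t" "neg s" v] by (auto simp: lin_of_def)

lemma lin_of_before': "halfword v \<Longrightarrow> t \<notin> set v \<Longrightarrow> (s, t) \<in> lin_of v \<longleftrightarrow> (neg t, neg s) \<in> before v"
  using before_set[of s t v] by (auto simp: lin_of_def)

lemma symlin_lin_of: assumes "halfword v" shows "symlin (lin_of v)"
proof -
  have d: "distinct v" using assms by (simp add: halfword_def)
  note n = halfword_neg[OF assms]
  show ?thesis unfolding symlin_def trans_def
  proof (intro conjI allI impI)
    fix s show "(s, s) \<notin> lin_of v" using before_irrefl[OF d] by (auto simp: lin_of_def)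
  next
    fix s t u assume st: "(s, t) \<in> lin_of v" and tu: "(t, u) \<in> lin_of v"
    show "(s, u) \<in> lin_of v"
    proof (cases "s \<in> set v")
      case True
      then have "(s, t) \<in> before v" using st lin_of_before[OF assms] by blast
      moreover have "(t, u) \<in> before v" using calculation tu lin_of_before[OF assms] before_set by metis
      ultimately show ?thesis using before_trans[OF d] by (auto simp: lin_of_def)
    next
      case False
      show ?thesis
      proof (cases "u \<in> set v")
        case True then show ?thesis using False by (simp add: lin_of_def)
      next
        case u: False
        then have "(neg u, neg t) \<in> before v" using tu lin_of_before'[OF assms] by blast
        moreover have "t \<notin> set v" using calculation before_set n by metis
        then have "(neg t, neg s) \<in> before v" using st lin_of_before'[OF assms] by blast
        ultimately have "(neg u, neg s) \<in> before v" using before_trans[OF d] by blast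
        then show ?thesis by (simp add: lin_of_def)
      qed
    qed
  next
    fix s t :: 'a assume "s \<noteq> t"
    then show "(s, t) \<in> lin_of v \<or> (t, s) \<in> lin_of v"
      using before_total[of s v t] before_total[of "neg s" v "neg t"] n by (auto simp: lin_of_def)
  next
    fix s t assume "(s, t) \<in> lin_of v"
    then show "(neg t, neg s) \<in> lin_of v" using n by (auto simp: lin_of_def)
  qed
qed

lemma inj_lin_of: "inj_on lin_of {v. halfword v}"
proof (rule inj_onI)
  fix u v assume "u \<in> {v. halfword v}" "v \<in> {v. halfword v}" and eq: "lin_of u = lin_of v"
  then have u: "halfword u" and v: "halfword v" by auto
  \<comment> \<open>The letters after the centre are those that come after their negatives, so the
    order determines them.\<close>
  have s: "s \<in> set w \<longleftrightarrow> (neg s, s) \<in> lin_of w" if "halfword w" for w s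
    using halfword_neg[OF that] before_set[of "neg s" s w] by (auto simp: lin_of_def)
  have set: "set u = set v" using s[OF u] s[OF v] eq by blast
  have "before u \<subseteq> before v"
    using lin_of_before[OF u] lin_of_before[OF v] eq set before_set[of _ _ u] by (metis subrelI)
  then show "u = v" using before_unique set u v by (auto simp: halfword_def)
qed

text \<open>The word lists, in the order \<open>L\<close>, the letters that come after their
  negatives; by symmetry they form the second half of \<open>L\<close>.\<close>

lemma ex_lin_of: assumes "symlin L" shows "\<exists>v. halfword v \<and> L = lin_of v"
proof -
  note L = symlinD[OF assms]
  have "trans L" using assms by (simp add: symlin_def)
  then have "\<exists>u. distinct u \<and> set u = {s. (neg s, s) \<in> L} \<and> before u \<subseteq> L"
    by (intro ex_sorted_list) (use L(1,3) in auto)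
  then obtain v where v: "distinct v" "set v = {s. (neg s, s) \<in> L}" "before v \<subseteq> L" by blast
  have n: "(s, neg s) \<in> L \<longleftrightarrow> (neg s, s) \<notin> L" for s
    using L(3)[of s "neg s"] L(5)[of s "neg s"] neg_ne[of s] by fastforce
  have hw: "halfword v"
    using v n by (auto simp: halfword_def in_neg_image)
  have "lin_of v \<subseteq> L"
  proof
    fix x assume "x \<in> lin_of v"
    then obtain s t where x: "x = (s, t)" "(s, t) \<in> lin_of v" by (cases x) auto
    then consider "s \<notin> set v" "t \<in> set v" | "(s, t) \<in> before v" | "(neg t, neg s) \<in> before v"
      by (auto simp: lin_of_def)
    then show "x \<in> L"
    proof cases
      case 1
      then have "(s, neg s) \<in> L" "(neg t, t) \<in> L" using v n by auto
      moreover have "(t, s) \<notin> L"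
      proof
        assume "(t, s) \<in> L"
        then have "(t, neg s) \<in> L" "(neg s, neg t) \<in> L" using L(2,4) calculation(1) by blast+
        then have "(t, neg t) \<in> L" using L(2) by blast
        then show False using L(5) calculation(2) by blast
      qed
      ultimately show ?thesis using L(3)[of s t] 1 x(1) by blast
    qed (use v(3) L(6) x(1) in auto)
  qed
  \<comment> \<open>Both are total orders, so one inclusion implies the other.\<close>
  moreover have "L \<subseteq> lin_of v"
    using calculation symlinD[OF symlin_lin_of[OF hw]] L by (metis subrelI subsetD)
  ultimately show ?thesis using hw by blast
qed

end

section \<open>Orders compatible with the chains, and their number\<close>

context chains begin

text \<open>What \<open>fifo_valid\<close> requires of a queue and, in addition, that no letter and
  its negative both hang from it. The condition survives the enlargement of the queue at both
  ends.\<close>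

definition good_queue :: "'a list \<Rightarrow> bool" where
  "good_queue Q \<longleftrightarrow> set Q \<subseteq> Range E \<and> stable (avail Q) \<and> separated Q \<and> reach Q \<inter> neg ` reach Q = {}"

lemma avail_reach: "avail Q = - (reach Q \<union> neg ` reach Q)"
  by (auto simp: avail_def reach_def twin_def)

lemma good_queue_mid: "good_queue mid"
  unfolding good_queue_def using stable_mid mid_Range
  by (cases rule: mid_cases) (use mid_separated in \<open>auto\<close>)

lemma good_queue_step:
  assumes "good_queue Q" "r \<in> avail Q" "r \<in> Range E"
  shows "good_queue (r # Q @ [flip r])"
proof -
  have X: "stable (avail Q)" using assms by (simp add: good_queue_def)
  obtain h where h: "h \<notin> Range E" "r \<in> chain h" using head_ex by blast
  have hX: "h \<in> avail Q" using stable_chain[OF X h(2)] assms by blast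
  note s = chain_split[OF h assms(3)] and c = twin_split[OF h assms(3)]
  have avail: "avail (r # Q @ [flip r]) = avail Q - twin h" unfolding c avail_def by auto
  have "heads (avail Q) = avail Q - Range E" by (simp add: heads_def)
  then have "stable (avail (r # Q @ [flip r]))" unfolding avail using stable_diff[OF X] hX h(1) by blast
  moreover have clX: "twin h \<subseteq> avail Q" using stable_twin[OF X hX] .
  have dis: "chain r \<inter> chain (flip r) = {}" and
    dis2: "(chain r \<union> chain (flip r)) \<inter> neg ` (chain r \<union> chain (flip r)) = {}"
    using stable_separated[OF X hX] s by (auto simp: image_Un in_neg_image)
  have "chain r \<union> chain (flip r) \<subseteq> avail Q" "neg ` (chain r \<union> chain (flip r)) \<subseteq> avail Q"
    using clX unfolding c by (auto simp: twin_def)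
  then have o: "reach Q \<inter> (chain r \<union> chain (flip r)) = {}" "reach Q \<inter> neg ` (chain r \<union> chain (flip r)) = {}"
    unfolding avail_reach by auto
  have "separated (r # Q @ [flip r])"
    using assms(1) dis o by (auto simp: good_queue_def sorted_wrt_append reach_def)
  moreover have "reach (r # Q @ [flip r]) \<inter> neg ` reach (r # Q @ [flip r]) = {}"
    using assms(1) dis2 o unfolding good_queue_def by (auto simp: in_neg_image)
  ultimately show ?thesis using assms(1,3) flip_Range by (simp add: good_queue_def)
qed

lemma grow_valid:
  "grow \<rho> Q v \<Longrightarrow> good_queue Q \<Longrightarrow>
   valid v \<and> queue v = rev \<rho> @ Q @ map flip \<rho> \<and> set \<rho> \<subseteq> Range E \<and> set v \<inter> neg ` set v = {} \<and> set v \<union> neg ` set v = UNIV"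
proof (induction \<rho> arbitrary: Q)
  case Nil
  have "reach Q \<inter> avail Q = {}" by (auto simp: avail_reach)
  then obtain Y where Y: "valid v" "queue v = Q" "set v = reach Q \<union> Y" "half Y (avail Q)"
    using fifo_valid[of Q "avail Q" v] Nil by (auto simp: good_queue_def)
  have "set v \<inter> neg ` set v = {}" "set v \<union> neg ` set v = UNIV"
    using Y(3,4) Nil(2) unfolding half_def good_queue_def avail_reach by (auto simp: in_neg_image)
  then show ?case using Y by simp
next
  case (Cons r \<rho>)
  then have r: "r \<in> avail Q" "r \<in> Range E" by auto
  show ?case using Cons.IH[OF _ good_queue_step[OF Cons.prems(2) r]] Cons.prems r by auto
qed

text \<open>The last condition keeps the arcs that cross the centre from being nested.\<close>

definition goodword :: "'a list \<Rightarrow> bool" where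
  "goodword v \<longleftrightarrow> valid v \<and> halfword v \<and> map flip (queue v) = rev (queue v)"

lemma map_flip_flip: "set \<rho> \<subseteq> Range E \<Longrightarrow> map (flip \<circ> flip) \<rho> = \<rho>"
  by (induction \<rho>) (auto simp: flip_flip)

lemma grow_goodword: assumes "grow \<rho> mid v" shows "goodword v"
proof -
  note s = grow_valid[OF assms good_queue_mid]
  have m: "map flip mid = rev mid" by (cases rule: mid_cases) (auto simp: flip_eq)
  show ?thesis unfolding goodword_def halfword_def
    using s m valid_distinct map_flip_flip[of \<rho>] by (auto simp: rev_map[symmetric])
qed

text \<open>The queue determines \<open>\<rho>\<close>: its length is
  \<open>2 * length \<rho>\<close> plus the fixed length of \<open>mid\<close>, and it begins with
  \<open>rev \<rho>\<close>.\<close>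

lemma grow_inj: assumes "grow \<rho> mid v" "grow \<rho>' mid v" shows "\<rho> = \<rho>'"
proof -
  have "rev \<rho> @ mid @ map flip \<rho> = rev \<rho>' @ mid @ map flip \<rho>'"
    using grow_valid[OF assms(1) good_queue_mid] grow_valid[OF assms(2) good_queue_mid] by simp
  moreover from this have "length (rev \<rho> @ mid @ map flip \<rho>) = length (rev \<rho>' @ mid @ map flip \<rho>')"
    by (rule arg_cong)
  then have "length \<rho> = length \<rho>'" by simp
  ultimately show ?thesis by simp
qed

text \<open>The first and the last letter are exchanged by \<open>flip\<close> and can be stripped
  off, until at most one letter is left, which \<open>flip\<close> fixes.\<close>

lemma palin_decomp:
  "map flip Q = rev Q \<Longrightarrow> set Q \<subseteq> Range E \<Longrightarrow>
    \<exists>\<rho> m. Q = rev \<rho> @ m @ map flip \<rho> \<and> (m = [] \<or> (\<exists>r. m = [r] \<and> flip r = r))"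
proof (induction "length Q" arbitrary: Q rule: less_induct)
  case less
  show ?case
  proof (cases Q)
    case Nil
    then show ?thesis by (intro exI[of _ "[]"]) auto
  next
    case (Cons r Q1)
    show ?thesis
    proof (cases Q1 rule: rev_cases)
      case Nil
      then show ?thesis using Cons less.prems by (intro exI[of _ "[]"] exI[of _ "[r]"]) auto
    next
      case (snoc Q' r')
      then have Q: "Q = r # Q' @ [r']" using Cons by simp
      then have e: "flip r = r'" "map flip Q' = rev Q'" using less.prems(1) by auto
      obtain \<rho> m where "Q' = rev \<rho> @ m @ map flip \<rho>" "m = [] \<or> (\<exists>r. m = [r] \<and> flip r = r)"
        using less.hyps[of Q'] e Q less.prems(2) by auto
      then show ?thesis using Q e(1) by (intro exI[of _ "\<rho> @ [r]"] exI[of _ m]) auto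
    qed
  qed
qed

lemma valid_E: "valid v \<Longrightarrow> (a, b) \<in> E \<Longrightarrow> a \<in> set v \<Longrightarrow> (a, b) \<in> before v"
  using valid_iff[OF valid_distinct] by blast

lemma goodword_grow: assumes g: "goodword v" shows "\<exists>\<rho>. grow \<rho> mid v"
proof -
  have valid: "valid v" and hw: "halfword v" and pal: "map flip (queue v) = rev (queue v)"
    using g by (auto simp: goodword_def)
  have dq: "distinct (queue v)" using valid valid_distinct distinct_queue by blast
  have QR: "set (queue v) \<subseteq> Range E" using set_queue by auto
  note n = halfword_neg[OF hw]
  obtain \<rho> m where \<rho>: "queue v = rev \<rho> @ m @ map flip \<rho>" and m: "m = [] \<or> (\<exists>r. m = [r] \<and> flip r = r)"
    using palin_decomp[OF pal QR] by blast
  \<comment> \<open>A fixed point of \<open>flip\<close> is the end of an arc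
    \<open>(c, neg c)\<close>. Conversely such an arc crosses the centre, so its end is pending;
    being its own mirror image, it can only be the middle letter.\<close>
  have "m = mid"
  proof (cases "m = []")
    case False
    then obtain r where r: "m = [r]" "flip r = r" using m by blast
    then have "r \<in> Range E" using QR \<rho> by auto
    then obtain p where "(p, r) \<in> E" by auto
    then show ?thesis using r mid_self[of p] flip_eq[of p r] by simp
  next
    case True
    have "(c, neg c) \<notin> E" for c
    proof
      assume c: "(c, neg c) \<in> E"
      have "c \<notin> set v" using valid_E[OF valid c] before_set[of c "neg c" v] n by blast
      then have "neg c \<in> set (queue v)" using c n by (auto simp: set_queue)
      moreover have nc: "flip (neg c) = neg c" using flip_eq[OF c] by simp
      ultimately have "neg c \<in> set \<rho> \<inter> flip ` set \<rho>"
        using True \<rho> QR flip_flip by (auto simp: image_iff) (metis subsetD)+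
      then show False using dq \<rho> by auto
    qed
    then show ?thesis using mid_none True by simp
  qed
  have "grow \<rho> Q v" if "queue v = rev \<rho> @ Q @ map flip \<rho>" "good_queue Q" for \<rho> Q
    using that
  proof (induction \<rho> arbitrary: Q)
    case Nil
    then have Q: "queue v = Q" by simp
    have sub: "reach Q \<subseteq> set v" using valid_chain[OF valid] Q set_queue unfolding reach_def by blast
    have "fifo Q (avail Q) v"
    proof (rule valid_fifo[OF valid Q])
      show "set v = reach Q \<union> (set v - reach Q)" using sub by auto
      show "half (set v - reach Q) (avail Q)"
        unfolding half_def avail_reach using sub n by (auto simp: in_neg_image)
    qed (use Nil.prems(2) in \<open>auto simp: good_queue_def avail_reach\<close>)
    then show ?case by simp
  next
    case (Cons r \<rho>)
    have r: "r \<in> set (queue v)" using Cons.prems(1) by simp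
    have rQ: "r \<notin> set Q" using dq Cons.prems(1) by auto
    have sub: "reach Q \<subseteq> set v"
      using valid_chain[OF valid] Cons.prems(1) set_queue[of _ v] unfolding reach_def by fastforce
    have "r \<notin> reach Q"
    proof
      assume "r \<in> reach Q"
      then obtain q where q: "q \<in> set Q" "r \<in> chain q" by (auto simp: reach_def)
      then obtain u where "u \<in> chain q" "(u, r) \<in> E" using chain_last rQ by blast
      then have "u \<in> set v" "(u, r) \<in> E" using sub q by (auto simp: reach_def)
      then show False using r E_inj by (auto simp: set_queue)
    qed
    moreover have "r \<notin> neg ` reach Q"
      using r sub n by (auto simp: set_queue in_neg_image)
    ultimately have rr: "r \<in> avail Q" "r \<in> Range E" using r QR by (auto simp: avail_reach)
    have "grow \<rho> (r # Q @ [flip r]) v"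
      using Cons.prems(1) by (intro Cons.IH good_queue_step Cons.prems(2) rr) simp
    then show ?case using rr by simp
  qed
  then show ?thesis using \<rho> \<open>m = mid\<close> good_queue_mid by blast
qed

lemma card_goodword: "int (card {v. goodword v}) = 2 ^ nblocks * ffact (CARD('a) div 2) nblocks"
proof -
  have "bij_betw snd {(\<rho>, v). grow \<rho> mid v} {v. goodword v}"
    by (rule bij_betw_imageI)
      (use grow_inj grow_goodword goodword_grow in \<open>force simp: inj_on_def image_iff\<close>)+
  then show ?thesis using card_grow_mid bij_betw_same_card by metis
qed

text \<open>The orders in which no two arcs are nested; by \<open>antichains_linext\<close> these
  are the ones that make \<open>E\<close> an antichain.\<close>

definition linext :: "('a \<times> 'a) set set" where
  "linext = {L. symlin L \<and> E \<subseteq> L \<and>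
     (\<forall>a b a' b'. (a, b) \<in> E \<longrightarrow> (a', b') \<in> E \<longrightarrow> (a, a') \<in> L \<longrightarrow> (b, b') \<in> L)}"

text \<open>For two arcs that cross the centre, the negatives of their starts are again pending
  letters, and negation reverses the order. Hence ends occur in the order of the starts exactly if
  \<open>flip\<close> reverses the queue. All other pairs of arcs are covered by
  \<open>valid\<close>, if necessary after negation.\<close>

lemma linext_lin_of: assumes hw: "halfword v" shows "lin_of v \<in> linext \<longleftrightarrow> goodword v"
proof
  note n = halfword_neg[OF hw]
  have d: "distinct v" using hw by (simp add: halfword_def)
  assume L: "lin_of v \<in> linext"
  then have EL: "E \<subseteq> lin_of v" and mono: "\<And>a b a' b'. (a, b) \<in> E \<Longrightarrow> (a', b') \<in> E \<Longrightarrow>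
      (a, a') \<in> lin_of v \<Longrightarrow> (b, b') \<in> lin_of v"
    by (auto simp: linext_def)
  have valid: "valid v"
    unfolding valid_iff[OF d]
  proof (intro conjI allI impI)
    fix a b assume "(a, b) \<in> E \<and> a \<in> set v"
    then show "(a, b) \<in> before v" using EL lin_of_before[OF hw] by blast
  next
    fix a b a' b' assume *: "(a, b) \<in> E \<and> (a', b') \<in> E \<and> b \<in> set v \<and> earlier v a a'"
    then have "(a, a') \<in> lin_of v" by (auto simp: lin_of_def)
    then show "(b, b') \<in> before v" using * mono lin_of_before[OF hw] by blast
  qed
  let ?Q = "queue v"
  have dq: "distinct ?Q" using d distinct_queue by blast
  have npQ: "flip b \<in> set ?Q" if "b \<in> set ?Q" for b
  proof -
    obtain a where a: "(a, b) \<in> E" "a \<notin> set v" "b \<in> set v" using \<open>b \<in> set ?Q\<close> by (auto simp: set_queue)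
    have "(neg b, neg a) \<in> E" "neg b \<notin> set v" "neg a \<in> set v" using E_sym a n by auto
    then show ?thesis using flip_eq[OF a(1)] by (auto simp: set_queue)
  qed
  have QR: "b \<in> Range E" if "b \<in> set ?Q" for b using that by (auto simp: set_queue)
  have "rev (map flip ?Q) = ?Q"
  proof (rule before_unique)
    have "inj_on flip (set ?Q)" by (rule inj_on_inverseI[of _ flip]) (use QR flip_flip in auto)
    then show "distinct (rev (map flip ?Q))" using dq by (simp add: distinct_map)
    show "set (rev (map flip ?Q)) = set ?Q"
      using npQ QR flip_flip by (auto simp: image_iff) metis
    show "before (rev (map flip ?Q)) \<subseteq> before ?Q"
    proof (rule subrelI)
      fix x y assume xy: "(x, y) \<in> before (rev (map flip ?Q))"
      then have in_map: "(y, x) \<in> before (map flip ?Q)" by (simp only: before_rev converse_iff)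
      then obtain b' b where b: "b \<in> set ?Q" "b' \<in> set ?Q" "y = flip b" "x = flip b'"
        using before_set[OF in_map] by auto
      have "b \<noteq> b'" using in_map b \<open>distinct (rev (map flip ?Q))\<close> before_irrefl[of "map flip ?Q"] by auto
      moreover have "(b', b) \<notin> before ?Q"
      proof
        assume "(b', b) \<in> before ?Q"
        then have "(x, y) \<in> before (map flip ?Q)" using before_map[of b' b ?Q flip] b by simp
        then show False using in_map before_asym[of "map flip ?Q"] \<open>distinct (rev (map flip ?Q))\<close> by auto
      qed
      ultimately have "(b, b') \<in> before ?Q" using b before_total by metis
      then have bb: "(b, b') \<in> before v" by (auto simp: queue_def before_filter)
      obtain a a' where a: "(a, b) \<in> E" "(a', b') \<in> E" using QR[OF b(1)] QR[OF b(2)] by (auto elim!: RangeE)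
      have "(a, a') \<in> lin_of v"
      proof (rule ccontr)
        assume "(a, a') \<notin> lin_of v"
        moreover have "a \<noteq> a'" using a E_fun \<open>b \<noteq> b'\<close> by blast
        ultimately have "(a', a) \<in> lin_of v" using symlinD(3)[OF symlin_lin_of[OF hw]] by blast
        then have "(b', b) \<in> lin_of v" using mono a by blast
        moreover have "(b, b') \<in> lin_of v" using bb by (simp add: lin_of_def)
        ultimately show False using symlinD(5)[OF symlin_lin_of[OF hw]] by blast
      qed
      then have "(neg a', neg a) \<in> lin_of v" using symlinD(4)[OF symlin_lin_of[OF hw]] by blast
      moreover have "x = neg a'" "y = neg a" using b flip_eq a by auto
      ultimately have "(x, y) \<in> lin_of v" by simp
      moreover have "x \<in> set ?Q" "y \<in> set ?Q" using b npQ by auto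
      ultimately show "(x, y) \<in> before ?Q"
        using lin_of_before[OF hw] unfolding queue_def by (auto simp: before_filter)
    qed
  qed (use dq in auto)
  then have "map flip ?Q = rev ?Q" by (metis rev_rev_ident)
  then show "goodword v" using valid hw by (simp add: goodword_def)
next
  note n = halfword_neg[OF hw]
  have d: "distinct v" using hw by (simp add: halfword_def)
  assume "goodword v"
  then have valid: "valid v" and pal: "map flip (queue v) = rev (queue v)" by (auto simp: goodword_def)
  have C2: "\<And>a b a' b'. (a, b) \<in> E \<Longrightarrow> (a', b') \<in> E \<Longrightarrow> b \<in> set v \<Longrightarrow> 
     earlier v a a' \<Longrightarrow> (b, b') \<in> before v"
    using valid_iff[OF d] valid by blast
  have EL: "(a, b) \<in> lin_of v" if ab: "(a, b) \<in> E" for a b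
  proof (cases "a \<in> set v")
    case True then show ?thesis using valid_E[OF valid ab] by (simp add: lin_of_def)
  next
    case False
    then show ?thesis using valid_E[OF valid E_sym[OF ab]] n by (auto simp: lin_of_def)
  qed
  have mono: "(b, b') \<in> lin_of v" if ab: "(a, b) \<in> E" "(a', b') \<in> E" and aa: "(a, a') \<in> lin_of v" for a b a' b'
  proof (cases "a' \<in> set v")
    case True
    then have b': "b' \<in> set v" using valid_E[OF valid ab(2)] before_set by metis
    show ?thesis
    proof (cases "b \<in> set v")
      case b: True
      have "earlier v a a'" using aa True lin_of_before[OF hw] by blast
      then have "(b, b') \<in> before v" using C2[OF ab b] by blast
      then show ?thesis by (simp add: lin_of_def)
    next
      case False then show ?thesis using b' by (simp add: lin_of_def)
    qed
  next
    case False
    then have na: "(neg a', neg a) \<in> before v" using aa lin_of_before'[OF hw] by blast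
    then have av: "neg a' \<in> set v" "neg a \<in> set v" "a \<notin> set v" using before_set n by metis+
    note E' = E_sym[OF ab(1)] E_sym[OF ab(2)]
    \<comment> \<open>Both arcs start before the centre. If only the first crosses it,
      \<open>valid\<close> for the negated arcs gives a contradiction; if neither does, it gives the
      claim; if both do, the palindrome is used.\<close>
    consider "b \<notin> set v" "b' \<in> set v" | "b \<in> set v" "b' \<notin> set v" | "b \<notin> set v" "b' \<notin> set v"
      | "b \<in> set v" "b' \<in> set v" by blast
    then show ?thesis
    proof cases
      case 1 then show ?thesis by (simp add: lin_of_def)
    next
      case 2
      then have "(neg a, neg a') \<in> before v" using C2[OF E'(1) E'(2)] av n by blast
      then show ?thesis using na before_asym[OF d] by blast
    next
      case 3
      have "(neg b', neg b) \<in> before v"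
      proof (rule ccontr)
        assume c: "(neg b', neg b) \<notin> before v"
        have "neg b \<noteq> neg b'" using na E_inj ab before_irrefl[OF d] by auto
        then have "(neg b, neg b') \<in> before v" using c before_total n 3 by metis
        then have "(neg a, neg a') \<in> before v" using C2[OF E'(1) E'(2)] av by blast
        then show False using na before_asym[OF d] by blast
      qed
      then show ?thesis by (simp add: lin_of_def)
    next
      case 4
      have bQ: "b \<in> set (queue v)" "b' \<in> set (queue v)" using 4 ab av False by (auto simp: set_queue)
      have "b \<noteq> b'" using na E_inj ab before_irrefl[OF d] by auto
      moreover have "(b', b) \<notin> before (queue v)"
      proof
        assume "(b', b) \<in> before (queue v)"
        then have "(neg a', neg a) \<in> before (map flip (queue v))"
          using before_map[of b' b "queue v" flip] flip_eq ab by simp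
        then have "(neg a, neg a') \<in> before (queue v)" unfolding pal by (simp add: before_rev)
        then have "(neg a, neg a') \<in> before v" by (auto simp: queue_def before_filter)
        then show False using na before_asym[OF d] by blast
      qed
      ultimately have "(b, b') \<in> before (queue v)" using bQ before_total by metis
      then show ?thesis by (auto simp: queue_def before_filter lin_of_def)
    qed
  qed
  show "lin_of v \<in> linext" using symlin_lin_of[OF hw] EL mono by (auto simp: linext_def)
qed

lemma card_linext: "int (card linext) = 2 ^ nblocks * ffact (CARD('a) div 2) nblocks"
proof -
  have "bij_betw lin_of {v. goodword v} linext"
  proof (rule bij_betw_imageI)
    show "inj_on lin_of {v. goodword v}"
      using inj_lin_of by (rule inj_on_subset) (auto simp: goodword_def)
    show "lin_of ` {v. goodword v} = linext"
    proof (intro equalityI subsetI)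
      fix L assume L: "L \<in> linext"
      then obtain v where "halfword v" "L = lin_of v" using ex_lin_of unfolding linext_def by blast
      then show "L \<in> lin_of ` {v. goodword v}" using linext_lin_of L by auto
    qed (use linext_lin_of in \<open>auto simp: goodword_def\<close>)
  qed
  then show ?thesis using card_goodword bij_betw_same_card by metis
qed

end

section \<open>Chains of an odd function\<close>

context signed_order begin

definition bar :: "'a \<times> 'a \<Rightarrow> 'a \<times> 'a" where "bar e = (neg (snd e), neg (fst e))"

text \<open>The pairs that define the same hyperplane at level 1, by
  \<open>hyp_orbit\<close>.\<close>

definition orbit :: "'a \<times> 'a \<Rightarrow> ('a \<times> 'a) set" where "orbit e = {e, bar e}"

lemma bar_simp [simp]: "bar (s, t) = (neg t, neg s)" by (simp add: bar_def)

lemma bar_bar [simp]: "bar (bar e) = e" by (simp add: bar_def)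

lemma orbit_eq: "orbit e = orbit e' \<longleftrightarrow> e' \<in> orbit e"
proof
  assume "e' \<in> orbit e"
  then show "orbit e = orbit e'" by (auto simp: orbit_def)
qed (auto simp: orbit_def)

definition arcs :: "('a \<Rightarrow> int) \<Rightarrow> ('a \<times> 'a) set" where
  "arcs g = {(s, t). prec s t \<and> g s = g t \<and> (\<forall>u. prec s u \<and> prec u t \<longrightarrow> g u \<noteq> g s)}"

lemma chains_arcs: assumes odd: "\<And>s. g (neg s) = - g s" shows "chains neg prec (arcs g)"
proof unfold_locales
  show "(s, t) \<in> arcs g \<Longrightarrow> prec s t" for s t by (simp add: arcs_def)
  show "(neg t, neg s) \<in> arcs g" if "(s, t) \<in> arcs g" for s t
  proof -
    have "g u \<noteq> g (neg t)" if "prec (neg t) u" "prec u (neg s)" for u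
    proof -
      have "prec s (neg u)" "prec (neg u) t" using that prec_neg by (metis neg_neg)+
      then have "g (neg u) \<noteq> g s" using \<open>(s, t) \<in> arcs g\<close> by (auto simp: arcs_def)
      then show ?thesis using \<open>(s, t) \<in> arcs g\<close> odd by (auto simp: arcs_def)
    qed
    then show ?thesis using that odd by (auto simp: arcs_def)
  qed
  show "t = u" if "(s, t) \<in> arcs g" "(s, u) \<in> arcs g" for s t u
    using that prec_total[of t u] unfolding arcs_def mem_Collect_eq prod.case by metis
  show "c = d" if "(c, neg c) \<in> arcs g" "(d, neg d) \<in> arcs g" for c d
  proof (rule ccontr)
    \<comment> \<open>An arc \<open>(c, neg c)\<close> joins letters of value 0. If \<open>d\<close>
      is a later letter with such an arc, then \<open>d\<close> lies between \<open>c\<close> and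
      \<open>neg c\<close>, so these are not neighbours.\<close>
    have *: False if "(c, neg c) \<in> arcs g" "(d, neg d) \<in> arcs g" "prec c d" for c d
    proof -
      have z: "g c = 0" "g d = 0" using that odd[of c] odd[of d] by (auto simp: arcs_def)
      have "prec d (neg c)" using that prec_trans[of d "neg d" "neg c"] by (auto simp: arcs_def)
      then show False using that z by (auto simp: arcs_def)
    qed
    assume "c \<noteq> d"
    then show False using prec_total[of c d] * that by blast
  qed
qed

end

section \<open>Counting the odd functions with given chains\<close>

context chains begin

definition linked :: "'a \<Rightarrow> 'a \<Rightarrow> bool" where "linked s t \<longleftrightarrow> t \<in> chain s \<or> s \<in> chain t"

lemma linked_sym: "linked s t \<longleftrightarrow> linked t s" by (auto simp: linked_def)

lemma linked_neg: "linked (neg s) (neg t) \<longleftrightarrow> linked s t"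
  by (auto simp: linked_def chain_neg)

lemma linked_head: assumes "h \<notin> Range E" "s \<in> chain h" shows "linked s t \<longleftrightarrow> t \<in> chain h"
proof
  assume "linked s t"
  then show "t \<in> chain h"
    unfolding linked_def using assms chain_trans chain_linear'[of s t h] head_chain by blast
next
  assume "t \<in> chain h" then show "linked s t" using chain_linear assms by (auto simp: linked_def)
qed

lemma linked_stable: "stable X \<Longrightarrow> linked s t \<Longrightarrow> s \<in> X \<longleftrightarrow> t \<in> X"
  unfolding linked_def using stable_chain by blast

text \<open>Set up for induction: \<open>X\<close> holds the letters still to be labelled and
  \<open>U\<close> the absolute values still free.\<close>

definition labels :: "'a set \<Rightarrow> int set \<Rightarrow> ('a \<Rightarrow> int) set" where
  "labels X U = {g. (\<forall>s. g (neg s) = - g s) \<and> (\<forall>s. s \<notin> X \<longrightarrow> g s = 0) \<and>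
     (\<forall>s\<in>X. g s \<noteq> 0 \<and> \<bar>g s\<bar> \<in> U) \<and> (\<forall>s\<in>X. \<forall>t\<in>X. g s = g t \<longleftrightarrow> linked s t)}"

text \<open>The value of \<open>h\<close> spreads to its chain and, negated, to the negative chain.
  Letters with equal values are linked, so no other letter can take \<open>y\<close> or
  \<open>- y\<close>, and \<open>\<bar>y\<bar>\<close> is used up.\<close>

lemma labels_step:
  assumes X: "stable X" and h: "h \<in> heads X"
  shows "bij_betw (\<lambda>g. (g h, \<lambda>s. if s \<in> twin h then 0 else g s)) (labels X U)
    (SIGMA y : {y. y \<noteq> 0 \<and> \<bar>y\<bar> \<in> U}. labels (X - twin h) (U - {\<bar>y\<bar>}))"
    (is "bij_betw ?f _ ?S")
proof -
  let ?f' = "\<lambda>(y, g) s. if s \<in> chain h then y else if neg s \<in> chain h then - y else g s"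
  have hX: "h \<in> X" "h \<notin> Range E" using h by (auto simp: heads_def)
  have dis: "s \<in> chain h \<Longrightarrow> neg s \<notin> chain h" for s
    using stable_separated[OF X hX(1)] by (auto simp: in_neg_image)
  have clX: "twin h \<subseteq> X" using stable_twin[OF X hX(1)] .
  have twin: "s \<in> twin h \<longleftrightarrow> s \<in> chain h \<or> neg s \<in> chain h" for s by (auto simp: twin_def in_neg_image)
  have const: "g s = g h" if "g \<in> labels X U" "s \<in> chain h" for g s
    using that clX hX(1) by (auto simp: labels_def twin linked_def)
  have nconst: "g s = - g h" if "g \<in> labels X U" "neg s \<in> chain h" for g s
    using const[OF that] that(1) by (auto simp: labels_def)
  have 1: "\<forall>g\<in>labels X U. ?f' (?f g) = g"
  proof (intro ballI ext)
    fix g s assume g: "g \<in> labels X U"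
    show "?f' (?f g) s = g s"
      using const[OF g, of s] nconst[OF g, of s] by (simp add: twin)
  qed
  have 2: "\<forall>x\<in>?S. ?f (?f' x) = x"
    by (auto simp: fun_eq_iff twin labels_def)
  have 3: "?f ` labels X U \<subseteq> ?S"
  proof (rule image_subsetI)
    fix g assume g: "g \<in> labels X U"
    have "\<bar>g s\<bar> \<noteq> \<bar>g h\<bar>" if s: "s \<in> X - twin h" for s
    proof
      assume "\<bar>g s\<bar> = \<bar>g h\<bar>"
      then have "g s = g h \<or> g (neg s) = g h" using g by (auto simp: labels_def abs_if split: if_splits)
      moreover have "linked h t" if "t \<in> X" "g h = g t" for t
        using g hX(1) that unfolding labels_def by blast
      ultimately have "linked h s \<or> linked h (neg s)"
        using s stable_neg[OF X, of s] by force
      then show False using s linked_head[OF hX(2) chain_refl] by (auto simp: twin)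
    qed
    then have "(\<lambda>s. if s \<in> twin h then 0 else g s) \<in> labels (X - twin h) (U - {\<bar>g h\<bar>})"
      using g by (auto simp: labels_def neg_twin)
    then show "?f g \<in> ?S"
      using g hX(1) by (auto simp: labels_def)
  qed
  have 4: "?f' ` ?S \<subseteq> labels X U"
  proof (rule image_subsetI)
    fix x assume "x \<in> ?S"
    then obtain y g where x: "x = (y, g)" and y: "y \<noteq> 0" "\<bar>y\<bar> \<in> U"
      and g: "g \<in> labels (X - twin h) (U - {\<bar>y\<bar>})" by auto
    let ?g = "\<lambda>s. if s \<in> chain h then y else if neg s \<in> chain h then - y else g s"
    have odd: "?g (neg s) = - ?g s" for s
      using g dis[of s] by (auto simp: labels_def)
    have "\<forall>s. s \<notin> X - twin h \<longrightarrow> g s = 0" "\<forall>s\<in>X - twin h. g s \<noteq> 0 \<and> \<bar>g s\<bar> \<in> U - {\<bar>y\<bar>}"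
      using g unfolding labels_def by blast+
    then have "\<bar>g s\<bar> \<noteq> \<bar>y\<bar>" if "s \<notin> twin h" for s
      using that y(1) by (cases "s \<in> X") auto
    then have out: "g s \<noteq> y" "g s \<noteq> - y" if "s \<notin> twin h" for s
      using that by force+
    have c1: "?g s = ?g t \<longleftrightarrow> linked s t" if "s \<in> chain h" for s t
      unfolding linked_head[OF hX(2) that] using that y out[of t] by (auto simp: twin)
    have c2: "?g s = ?g t \<longleftrightarrow> linked s t" if "neg s \<in> chain h" for s t
      using c1[OF that, of "neg t"] unfolding odd linked_neg by simp
    have "?g s = ?g t \<longleftrightarrow> linked s t" if "s \<in> X" "t \<in> X" for s t
    proof -
      consider "s \<in> chain h" | "neg s \<in> chain h" | "t \<in> chain h" | "neg t \<in> chain h" | "s \<notin> twin h" "t \<notin> twin h"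
        by (auto simp: twin)
      then show ?thesis
      proof cases
        case 5
        then have "?g s = g s" "?g t = g t" by (auto simp: twin)
        then show ?thesis using g that 5 unfolding labels_def by auto
      next
        case 1 then show ?thesis using c1 by blast
      next
        case 2 then show ?thesis using c2 by blast
      next
        case 3 then show ?thesis
          unfolding linked_sym[of s t] eq_commute[of "?g s" "?g t"] by (rule c1)
      next
        case 4 then show ?thesis
          unfolding linked_sym[of s t] eq_commute[of "?g s" "?g t"] by (rule c2)
      qed
    qed
    moreover have "?g s = 0" if "s \<notin> X" for s
      using that clX g by (auto simp: twin labels_def)
    moreover have "?g s \<noteq> 0 \<and> \<bar>?g s\<bar> \<in> U" if "s \<in> X" for s
      using that y g by (auto simp: twin labels_def)
    ultimately show "?f' x \<in> labels X U"
      unfolding x labels_def using odd by simp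
  qed
  show ?thesis by (rule bij_betw_byWitness[OF 1 2 3 4])
qed

lemma card_signed: assumes "finite U" "U \<subseteq> {0<..}"
  shows "finite {y::int. y \<noteq> 0 \<and> \<bar>y\<bar> \<in> U}" "card {y::int. y \<noteq> 0 \<and> \<bar>y\<bar> \<in> U} = 2 * card U"
proof -
  have e: "{y::int. y \<noteq> 0 \<and> \<bar>y\<bar> \<in> U} = U \<union> uminus ` U"
  proof (intro equalityI subsetI)
    fix y assume "y \<in> {y::int. y \<noteq> 0 \<and> \<bar>y\<bar> \<in> U}"
    then show "y \<in> U \<union> uminus ` U"
      using image_eqI[of y uminus "- y" U] by (cases "y > 0") auto
  qed (use assms(2) in force)
  have "y \<notin> uminus ` U" if "y \<in> U" for y
  proof
    assume "y \<in> uminus ` U"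
    then obtain z where "z \<in> U" "y = - z" by auto
    moreover have "0 < y" "0 < z" using that \<open>z \<in> U\<close> assms(2) by auto
    ultimately show False by simp
  qed
  then have "U \<inter> uminus ` U = {}" by blast
  then show "card {y::int. y \<noteq> 0 \<and> \<bar>y\<bar> \<in> U} = 2 * card U"
    unfolding e using assms(1) by (subst card_Un_disjoint) (auto simp: card_image)
  show "finite {y::int. y \<noteq> 0 \<and> \<bar>y\<bar> \<in> U}" unfolding e using assms(1) by simp
qed

lemma card_labels:
  "stable X \<Longrightarrow> card (heads X) = 2 * e \<Longrightarrow> finite U \<Longrightarrow> U \<subseteq> {0<..} \<Longrightarrow>
    finite (labels X U) \<and> int (card (labels X U)) = 2 ^ e * ffact (card U) e"
proof (induction e arbitrary: X U)
  case 0
  then have "X = {}" using heads_empty by simp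
  then have "labels X U = {\<lambda>_. 0}" by (auto simp: labels_def fun_eq_iff)
  then show ?case by simp
next
  case (Suc e)
  then obtain h where h: "h \<in> heads X" by fastforce
  let ?Y = "{y. y \<noteq> 0 \<and> \<bar>y\<bar> \<in> U}"
  have "card (heads (X - twin h)) = 2 * e" using card_heads_diff[OF Suc.prems(1) h] Suc.prems(2) by simp
  then have IH: "finite (labels (X - twin h) (U - {\<bar>y\<bar>})) \<and>
    int (card (labels (X - twin h) (U - {\<bar>y\<bar>}))) = 2 ^ e * ffact (card U - 1) e" if "y \<in> ?Y" for y
    using Suc.IH[OF stable_diff[OF Suc.prems(1) h], of "U - {\<bar>y\<bar>}"] that Suc.prems(3,4) by auto
  note Y = card_signed[OF Suc.prems(3,4)]
  have fin: "finite (labels X U)"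
    unfolding bij_betw_finite[OF labels_step[OF Suc.prems(1) h]] using IH Y(1) by blast
  have "card (labels X U) = (\<Sum>y\<in>?Y. card (labels (X - twin h) (U - {\<bar>y\<bar>})))"
    unfolding bij_betw_same_card[OF labels_step[OF Suc.prems(1) h]]
    using IH Y(1) by (intro card_SigmaI) auto
  then have "int (card (labels X U)) = (\<Sum>y\<in>?Y. 2 ^ e * ffact (card U - 1) e)"
    unfolding of_nat_sum using IH by (auto intro: sum.cong)
  also have "\<dots> = 2 ^ Suc e * (int (card U) * ffact (card U - 1) e)" by (simp add: Y(2))
  \<comment> \<open>If \<open>U\<close> is empty then \<open>card U - 1\<close> is truncated, but
    the first factor vanishes on the left and the factor for \<open>i = 0\<close> on the
    right.\<close>
  also have "int (card U) * ffact (card U - 1) e = ffact (card U) (Suc e)"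
  proof (cases "card U")
    case 0
    have "ffact 0 (Suc e) = 0" unfolding ffact_def by (subst prod.lessThan_Suc_shift) simp
    then show ?thesis using 0 by simp
  next
    case (Suc n)
    then show ?thesis by (simp only: diff_Suc_1 ffact_Suc_Suc of_nat_Suc add.commute)
  qed
  finally show ?case using fin by simp
qed

text \<open>The zero block is a single chain: the letters of \<open>chain (neg c)\<close> follow
  \<open>neg c\<close>, and their negatives lead to \<open>c\<close>.\<close>

lemma mid_linked: assumes c: "(c, neg c) \<in> E" and s: "s \<in> twin (neg c)" and t: "t \<in> twin (neg c)" shows "linked s t"
proof -
  have *: "neg c \<in> chain u" if "u \<in> neg ` chain (neg c)" for u
    using that chain_neg[of u c] chain_E[OF _ c] by (auto simp: in_neg_image)
  have **: "c \<in> chain u" if "u \<in> neg ` chain (neg c)" for u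
    using that chain_neg[of u c] by (auto simp: in_neg_image)
  show ?thesis
    using s t *[of s] *[of t] **[of s] **[of t] chain_linear chain_linear' chain_trans
    unfolding twin_def linked_def by (metis Un_iff)
qed

text \<open>Neighbours of equal value are joined, so the level sets of \<open>g\<close> are the
  chains of \<open>arcs g\<close>. Conversely the level sets together with \<open>prec\<close>
  determine who the neighbours are.\<close>

lemma arcs_eq_iff:
  assumes odd: "\<And>s. g (neg s) = - g s"
  shows "arcs g = E \<longleftrightarrow> (\<forall>s t. g s = g t \<longleftrightarrow> linked s t)"
proof
  assume e: "arcs g = E"
  have chain: "g s = g t" if "t \<in> chain s" for s t
  proof -
    have "(s, t) \<in> E\<^sup>*" using that by (simp add: chain_def)
    then show ?thesis by induction (use e in \<open>auto simp: arcs_def\<close>)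
  qed
  have "t \<in> chain s" if "prec s t" "g s = g t" for s t
    using that
  proof (induction "card {u. prec s u}" arbitrary: s rule: less_induct)
    case less
    show ?case
    proof (cases "(s, t) \<in> E")
      case True then show ?thesis using chain_step by blast
    next
      case False
      then obtain u where u: "prec s u" "prec u t" "g u = g s" using e less.prems by (auto simp: arcs_def)
      define W where "W = {u. prec s u \<and> g u = g s}"
      \<comment> \<open>The first letter after \<open>s\<close> with the value of \<open>s\<close>;
        it is the successor of \<open>s\<close> in \<open>E\<close>.\<close>
      obtain w where w: "w \<in> W" "\<And>v. v \<in> W \<Longrightarrow> \<not> prec v w"
      proof -
        have "wf {(x, y). prec x y}"
        proof (rule finite_acyclic_wf)
          have "trans {(x, y). prec x y}" by (auto intro: transI dest: prec_trans)
          then show "acyclic {(x, y). prec x y}" by (simp add: acyclic_def trancl_id)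
        qed simp
        moreover have "u \<in> W" using u by (simp add: W_def)
        ultimately have "\<exists>w\<in>W. \<forall>v. (v, w) \<in> {(x, y). prec x y} \<longrightarrow> v \<notin> W"
          unfolding wf_eq_minimal by (elim allE impE) assumption+
        then show ?thesis using that by blast
      qed
      have sw: "(s, w) \<in> E"
        unfolding e[symmetric] arcs_def using w by (auto simp: W_def)
      have wt: "w = t \<or> prec w t" using prec_total[of w t] w(2)[of t] less.prems by (auto simp: W_def)
      then show ?thesis
      proof
        assume "prec w t"
        have "{u. prec w u} \<subset> {u. prec s u}"
          using w(1) prec_trans prec_irrefl unfolding W_def by blast
        then have "card {u. prec w u} < card {u. prec s u}" by (simp add: psubset_card_mono)
        then have "t \<in> chain w" using less.hyps \<open>prec w t\<close> w(1) less.prems by (auto simp: W_def)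
        then show ?thesis using chain_step[OF sw] chain_trans by blast
      qed (use chain_step[OF sw] in auto)
    qed
  qed
  then show "\<forall>s t. g s = g t \<longleftrightarrow> linked s t"
    using chain prec_total unfolding linked_def by (metis chain_refl)
next
  assume c: "\<forall>s t. g s = g t \<longleftrightarrow> linked s t"
  have up: "t \<in> chain s" if "prec s t" "g s = g t" for s t
    using that c chain_prec[of s t] prec_asym prec_irrefl unfolding linked_def by blast
  show "arcs g = E"
  proof (intro equalityI subrelI)
    fix s t assume st: "(s, t) \<in> arcs g"
    then have "t \<in> chain s" "s \<noteq> t" using up by (auto simp: arcs_def)
    then obtain u where u: "(s, u) \<in> E" "t \<in> chain u"
      by (metis DomainE empty_iff chain_insert chain_single insert_iff)
    then have "g s = g u" "prec s u" using c E_prec chain_step by (auto simp: linked_def)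
    then have "u = t" using st chain_prec[OF u(2)] by (auto simp: arcs_def)
    then show "(s, t) \<in> E" using u by simp
  next
    fix s t assume st: "(s, t) \<in> E"
    have "g u \<noteq> g s" if "prec s u" "prec u t" for u
    proof
      assume "g u = g s"
      then have "u \<in> chain s" using up that by simp
      then have "u \<in> chain t" using chain_insert[OF st] that(1) by auto
      then show False using chain_prec that(2) prec_asym prec_irrefl by metis
    qed
    moreover have "g s = g t" using c chain_step[OF st] by (auto simp: linked_def)
    ultimately show "(s, t) \<in> arcs g" using E_prec[OF st] by (auto simp: arcs_def)
  qed
qed

text \<open>An arc \<open>(d, neg d)\<close> forces the value 0 on the zero block because
  \<open>g\<close> is odd. Conversely a letter of value 0 is linked to its negative, which happens
  only in the zero block.\<close>

lemma arcs_labels: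
  "{g. (\<forall>s. g (neg s) = - g s) \<and> (\<forall>s. \<bar>g s\<bar> \<le> n) \<and> arcs g = E} = labels (avail mid) {1..n}" if "0 \<le> n"
proof (intro equalityI subsetI)
  fix g assume g: "g \<in> {g. (\<forall>s. g (neg s) = - g s) \<and> (\<forall>s. \<bar>g s\<bar> \<le> n) \<and> arcs g = E}"
  then have c: "\<And>s t. g s = g t \<longleftrightarrow> linked s t" using arcs_eq_iff[of g] by auto
  have 1: "g s = 0" if "s \<notin> avail mid" for s
  proof (cases rule: mid_cases)
    case (self d)
    have "linked d (neg d)" using chain_step[OF self(1)] by (simp add: linked_def)
    then have "g (neg d) = 0" using c[of d "neg d"] g by auto
    moreover have "linked s (neg d)"
      using mid_linked[OF self(1)] that self(3) by (simp add: twin_def)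
    ultimately show ?thesis using c by metis
  qed (use that in auto)
  have 2: "g s \<noteq> 0" if "s \<in> avail mid" for s
  proof
    assume "g s = 0"
    then have "g s = g (neg s)" using g by auto
    then have "linked s (neg s)" using c by blast
    moreover have "neg s \<in> avail mid" using that stable_mid stable_neg by blast
    ultimately show False using that stable_mid unfolding stable_def linked_def by (metis neg_neg)
  qed
  have 3: "1 \<le> \<bar>g s\<bar>" if "s \<in> avail mid" for s using 2[OF that] by linarith
  show "g \<in> labels (avail mid) {1..n}"
    using g 1 2 3 c by (simp add: labels_def)
next
  fix g assume g: "g \<in> labels (avail mid) {1..n}"
  have "g s = g t \<longleftrightarrow> linked s t" for s t
  proof -
    consider "s \<in> avail mid" "t \<in> avail mid" | "s \<in> avail mid \<longleftrightarrow> t \<notin> avail mid" | "s \<notin> avail mid" "t \<notin> avail mid"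
      by blast
    then show ?thesis
    proof cases
      case 1 then show ?thesis using g by (auto simp: labels_def)
    next
      case 2
      then have "\<not> linked s t" using linked_stable[OF stable_mid] by blast
      moreover have "g s \<noteq> g t" using 2 g by (auto simp: labels_def)
      ultimately show ?thesis by blast
    next
      case 3
      then have "g s = g t" using g by (auto simp: labels_def)
      moreover have "linked s t"
        by (cases rule: mid_cases) (use 3 mid_linked in auto)
      ultimately show ?thesis by blast
    qed
  qed
  moreover have odd: "\<And>s. g (neg s) = - g s" using g by (auto simp: labels_def)
  ultimately have "arcs g = E" using arcs_eq_iff by blast
  moreover have "\<bar>g s\<bar> \<le> n" for s using g that by (cases "s \<in> avail mid") (auto simp: labels_def)
  ultimately show "g \<in> {g. (\<forall>s. g (neg s) = - g s) \<and> (\<forall>s. \<bar>g s\<bar> \<le> n) \<and> arcs g = E}"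
    using odd by simp
qed

lemma card_arcs:
  "int (card {g. (\<forall>s. g (neg s) = - g s) \<and> (\<forall>s. \<bar>g s\<bar> \<le> int (CARD('a) div 2)) \<and> arcs g = E})
   = 2 ^ nblocks * ffact (CARD('a) div 2) nblocks"
  unfolding arcs_labels[OF of_nat_0_le_iff] using card_labels[OF stable_mid nblocks, of "{1..int (CARD('a) div 2)}"]
  by force

text \<open>The chains outside the zero block correspond to the nonzero values of \<open>g\<close>,
  and these values come in pairs \<open>y\<close>, \<open>- y\<close>.\<close>

lemma card_abs_arcs:
  assumes odd: "\<And>s. g (neg s) = - g s" and g: "arcs g = E"
  shows "card {\<bar>g s\<bar> | s. g s \<noteq> 0} = nblocks"
proof -
  define n where "n = Max (range (\<lambda>s. \<bar>g s\<bar>))"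
  have le: "\<bar>g s\<bar> \<le> n" for s by (simp add: n_def)
  then have "0 \<le> n" using abs_ge_zero order_trans by blast
  then have lab: "g \<in> labels (avail mid) {1..n}" using arcs_labels[of n] odd g le by blast
  let ?X = "avail mid"
  have c: "\<And>s t. g s = g t \<longleftrightarrow> linked s t" using arcs_eq_iff[of g] odd g by blast
  have X: "g s = 0 \<longleftrightarrow> s \<notin> ?X" for s using lab by (auto simp: labels_def)
  have "bij_betw g (heads ?X) (g ` ?X)"
  proof (rule bij_betw_imageI)
    show "inj_on g (heads ?X)"
      using c head_chain by (auto simp: inj_on_def heads_def linked_def)
    show "g ` heads ?X = g ` ?X"
    proof (intro equalityI subsetI)
      fix y assume "y \<in> g ` ?X"
      then obtain s where s: "s \<in> ?X" "y = g s" by auto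
      obtain h where h: "h \<notin> Range E" "s \<in> chain h" using head_ex by blast
      then have "h \<in> heads ?X" using s stable_chain[OF stable_mid] by (auto simp: heads_def)
      moreover have "g h = y" using c h s by (auto simp: linked_def)
      ultimately show "y \<in> g ` heads ?X" by blast
    qed (auto simp: heads_def)
  qed
  then have "card (g ` ?X) = 2 * nblocks" using nblocks bij_betw_same_card by metis
  moreover have "g ` ?X = {y. y \<noteq> 0 \<and> \<bar>y\<bar> \<in> {\<bar>g s\<bar> | s. g s \<noteq> 0}}"
  proof (intro equalityI subsetI)
    fix y assume "y \<in> {y. y \<noteq> 0 \<and> \<bar>y\<bar> \<in> {\<bar>g s\<bar> | s. g s \<noteq> 0}}"
    then obtain s where s: "g s \<noteq> 0" "\<bar>y\<bar> = \<bar>g s\<bar>" by auto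
    then have "y = g s \<or> y = g (neg s)" using odd by (auto simp: abs_if split: if_splits)
    moreover have "s \<in> ?X" "neg s \<in> ?X" using s odd X[of s] X[of "neg s"] by auto
    ultimately show "y \<in> g ` ?X" by blast
  qed (use X in auto)
  moreover have "finite {\<bar>g s\<bar> | s. g s \<noteq> 0}"
    by (rule finite_subset[of _ "range (\<lambda>s. \<bar>g s\<bar>)"]) auto
  ultimately show ?thesis using card_signed(2)[of "{\<bar>g s\<bar> | s. g s \<noteq> 0}"] by force
qed

text \<open>An orbit in \<open>E\<close> has two elements unless it is that of an arc
  \<open>(c, neg c)\<close>, and \<open>E\<close> has one arc for every letter that is not a head.
  Both counts are corrected by \<open>length mid\<close>, which is 1 if there is such an arc, and
  with it a zero block, and 0 otherwise.\<close>

lemma card_orbit: "card (orbit ` E) + nblocks = CARD('a) div 2"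
proof -
  define S where "S = {e \<in> E. bar e = e}"
  have S: "S = {(c, neg c) | c. (c, neg c) \<in> E}" by (auto simp: S_def)
  have cS: "card S = length mid" "card (orbit ` S) = card S"
  proof -
    have "card S = length mid \<and> card (orbit ` S) = card S"
    proof (cases rule: mid_cases)
      case (self c)
      then have "S = {(c, neg c)}" unfolding S using E_self by auto
      then show ?thesis using self by simp
    next
      case none
      then have "S = {}" unfolding S by auto
      then show ?thesis using none by simp
    qed
    then show "card S = length mid" "card (orbit ` S) = card S" by blast+
  qed
  have bE: "bar e \<in> E" if "e \<in> E" for e using that E_sym by (cases e) auto
  have "2 * card (orbit ` (E - S)) = card (\<Union>(orbit ` (E - S)))"
  proof (rule card_partition)
    fix c assume "c \<in> orbit ` (E - S)"
    then obtain e where "c = {e, bar e}" "bar e \<noteq> e" by (auto simp: S_def orbit_def)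
    then show "card c = 2" by (metis card_2_iff)
  next
    fix c d assume "c \<in> orbit ` (E - S)" "d \<in> orbit ` (E - S)" "c \<noteq> d"
    then show "c \<inter> d = {}" using orbit_eq by (metis disjoint_iff image_iff)
  qed auto
  moreover have "\<Union>(orbit ` (E - S)) = E - S"
  proof (intro equalityI subsetI)
    fix x assume "x \<in> \<Union>(orbit ` (E - S))"
    then obtain e where "e \<in> E" "bar e \<noteq> e" "x = e \<or> x = bar e" by (auto simp: orbit_def S_def)
    then show "x \<in> E - S" using bE[of e] bar_bar[of e] unfolding S_def by force
  next
    fix x assume "x \<in> E - S"
    then show "x \<in> \<Union>(orbit ` (E - S))" unfolding orbit_def by blast
  qed
  ultimately have "2 * card (orbit ` (E - S)) = card (E - S)" by simp
  moreover have "card (orbit ` E) = card (orbit ` (E - S)) + card (orbit ` S)"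
  proof -
    have "orbit ` E = orbit ` (E - S) \<union> orbit ` S" by (auto simp: S_def)
    moreover have "orbit ` (E - S) \<inter> orbit ` S = {}"
      using orbit_eq by (auto simp: S_def orbit_def) 
    ultimately show ?thesis by (simp add: card_Un_disjoint)
  qed
  moreover have "card (E - S) + card S = card E"
  proof -
    have "S \<subseteq> E" by (auto simp: S_def)
    then show ?thesis by (simp add: card_Diff_subset card_mono)
  qed
  ultimately have 1: "2 * card (orbit ` E) = card E + length mid" using cS by linarith
  have "card E = card (Range E)"
  proof -
    have "inj_on snd E" using E_inj by (auto simp: inj_on_def)
    then show ?thesis by (simp add: Range_snd card_image)
  qed
  moreover have "card (- Range E) = 2 * nblocks + length mid"
  proof (cases rule: mid_cases)
    case (self c)
    obtain h where h: "h \<notin> Range E" "neg c \<in> chain h" using head_ex by blast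
    have "linked h s" if "s \<in> twin h" for s
    proof -
      have "h \<in> twin h" by (simp add: twin_def)
      then show ?thesis using mid_linked[OF self(1), unfolded twin_mid[OF self(1) h]] that by blast
    qed
    then have "twin h = chain h" using linked_head[OF h(1) chain_refl] by (auto simp: twin_def)
    then have e: "- Range E = insert h (heads (avail mid))"
      unfolding self(3) twin_mid[OF self(1) h] heads_def using h head_chain by auto
    have "h \<notin> heads (avail mid)"
      unfolding self(3) twin_mid[OF self(1) h] heads_def by (simp add: twin_def)
    then show ?thesis unfolding e using nblocks self(2) by simp
  next
    case none
    then have "- Range E = heads (avail mid)" by (auto simp: heads_def)
    then show ?thesis using nblocks none by simp
  qed
  moreover have "card (- Range E) + card (Range E) = CARD('a)"
    using card_Un_disjoint[of "- Range E" "Range E"] by simp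
  ultimately have "CARD('a) = 2 * (card (orbit ` E) + nblocks)" using 1 by simp
  then show ?thesis by simp
qed

end

section \<open>Symmetric antichains\<close>

text \<open>Kept abstract so that the result on floors can be applied to the reversed order, which
  gives the one on ceilings.\<close>

locale involutive_poset =
  fixes P :: "'e set" and r :: "'e \<Rightarrow> 'e \<Rightarrow> bool" and b :: "'e \<Rightarrow> 'e"
  assumes fin: "finite P"
    and r_refl: "r x x"
    and r_trans: "r x y \<Longrightarrow> r y z \<Longrightarrow> r x z"
    and r_antisym: "r x y \<Longrightarrow> r y x \<Longrightarrow> x = y"
    and b_b: "b (b x) = x"
    and b_P: "x \<in> P \<Longrightarrow> b x \<in> P"
    and r_b: "r x y \<Longrightarrow> r (b x) (b y)"
begin

definition filters :: "'e set set" where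
  "filters = {D. D \<subseteq> P \<and> b ` D \<subseteq> D \<and> (\<forall>x\<in>D. \<forall>y\<in>P. r x y \<longrightarrow> y \<in> D)}"

definition floors :: "'e set \<Rightarrow> 'e set" where
  "floors D = {e \<in> D. D - {e, b e} \<in> filters}"

definition ceils :: "'e set \<Rightarrow> 'e set" where
  "ceils D = {e \<in> P - D. D \<union> {e, b e} \<in> filters}"

definition antichain_sets :: "'e set set" where
  "antichain_sets = {A. A \<subseteq> P \<and> b ` A \<subseteq> A \<and> (\<forall>x\<in>A. \<forall>y\<in>A. r x y \<longrightarrow> x = y)}"

text \<open>The elements \<open>e\<close> and \<open>b e\<close> are incomparable or equal, since
  \<open>b\<close> turns \<open>r (b e) e\<close> into \<open>r e (b e)\<close>. So both can be
  removed at once as soon as \<open>e\<close> is minimal.\<close>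

lemma floors_eq: assumes "D \<in> filters" shows "floors D = {e \<in> D. \<forall>x\<in>D. r x e \<longrightarrow> x = e}"
proof (intro equalityI subsetI)
  fix e assume "e \<in> floors D"
  then have e: "e \<in> D" "D - {e, b e} \<in> filters" by (auto simp: floors_def)
  have "x = e" if "x \<in> D" "r x e" for x
  proof (rule ccontr)
    assume "x \<noteq> e"
    show False
    proof (cases "x = b e")
      case True
      then have "r e x" using r_b[OF that(2)] b_b by simp
      then show ?thesis using r_antisym that(2) \<open>x \<noteq> e\<close> by blast
    next
      case False
      then show ?thesis using e \<open>x \<noteq> e\<close> that assms unfolding filters_def by blast
    qed
  qed
  then show "e \<in> {e \<in> D. \<forall>x\<in>D. r x e \<longrightarrow> x = e}" using e by blast
next
  fix e assume e: "e \<in> {e \<in> D. \<forall>x\<in>D. r x e \<longrightarrow> x = e}"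
  have bD: "b x \<in> D" if "x \<in> D" for x using assms that by (auto simp: filters_def)
  have "D - {e, b e} \<in> filters"
    unfolding filters_def
  proof (intro CollectI conjI ballI impI)
    show "D - {e, b e} \<subseteq> P" using assms by (auto simp: filters_def)
    show "b ` (D - {e, b e}) \<subseteq> D - {e, b e}"
    proof (rule image_subsetI)
      fix x assume "x \<in> D - {e, b e}"
      then show "b x \<in> D - {e, b e}" using bD b_b by (metis Diff_iff insert_iff empty_iff)
    qed
    fix x y assume x: "x \<in> D - {e, b e}" and y: "y \<in> P" and xy: "r x y"
    have "y \<in> D" using assms x y xy by (auto simp: filters_def)
    moreover have "y \<noteq> e" using x e xy by blast
    moreover have "y \<noteq> b e"
    proof
      assume "y = b e"
      then have "r (b x) e" using r_b[OF xy] b_b by simp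
      then have "b x = e" using e bD x by blast
      then have "x = b e" using b_b[of x] by simp
      then show False using x by blast
    qed
    ultimately show "y \<in> D - {e, b e}" by blast
  qed
  then show "e \<in> floors D" using e by (simp add: floors_def)
qed

lemma ex_minimal: assumes "D \<subseteq> P" "x \<in> D" shows "\<exists>e\<in>D. r e x \<and> (\<forall>y\<in>D. r y e \<longrightarrow> y = e)"
proof -
  have "finite D" using assms(1) fin finite_subset by blast
  then show ?thesis using assms(2)
  proof (induction "card {y \<in> D. r y x}" arbitrary: x rule: less_induct)
    case less
    show ?case
    proof (cases "\<forall>y\<in>D. r y x \<longrightarrow> y = x")
      case True then show ?thesis using less.prems r_refl by blast
    next
      case False
      then obtain y where y: "y \<in> D" "r y x" "y \<noteq> x" by blast
      then have "x \<in> {z \<in> D. r z x}" "x \<notin> {z \<in> D. r z y}" using less.prems r_refl r_antisym by blast+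
      moreover have "{z \<in> D. r z y} \<subseteq> {z \<in> D. r z x}" using y r_trans by blast
      ultimately have "{z \<in> D. r z y} \<subset> {z \<in> D. r z x}" by blast
      then have "card {z \<in> D. r z y} < card {z \<in> D. r z x}" using less.prems(1) by (intro psubset_card_mono) auto
      then obtain e where "e \<in> D" "r e y" "\<forall>z\<in>D. r z e \<longrightarrow> z = e" using less.hyps less.prems(1) y(1) by blast
      then show ?thesis using y r_trans by blast
    qed
  qed
qed

text \<open>The inverse sends an antichain to the upper set that it generates.\<close>

lemma bij_floors: "bij_betw floors filters antichain_sets"
proof -
  define up where "up A = {y \<in> P. \<exists>x\<in>A. r x y}" for A
  have 1: "\<forall>D\<in>filters. up (floors D) = D"
  proof
    fix D assume D: "D \<in> filters"
    have "D \<subseteq> P" using D by (simp add: filters_def)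
    show "up (floors D) = D"
    proof (intro equalityI subsetI)
      fix y assume "y \<in> D"
      then obtain e where "e \<in> floors D" "r e y" using ex_minimal[OF \<open>D \<subseteq> P\<close>] unfolding floors_eq[OF D] by blast
      then show "y \<in> up (floors D)" using \<open>y \<in> D\<close> \<open>D \<subseteq> P\<close> unfolding up_def by blast
    next
      fix y assume "y \<in> up (floors D)"
      then show "y \<in> D" using D unfolding up_def floors_def filters_def by blast
    qed
  qed
  have up_filters: "up A \<in> filters" if "A \<in> antichain_sets" for A
    unfolding filters_def up_def
  proof (intro CollectI conjI ballI impI)
    show "b ` {y \<in> P. \<exists>x\<in>A. r x y} \<subseteq> {y \<in> P. \<exists>x\<in>A. r x y}"
    proof (rule image_subsetI)
      fix y assume "y \<in> {y \<in> P. \<exists>x\<in>A. r x y}"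
      then obtain x where "y \<in> P" "x \<in> A" "r x y" by blast
      moreover have "b x \<in> A" using \<open>x \<in> A\<close> that by (auto simp: antichain_sets_def)
      ultimately show "b y \<in> {y \<in> P. \<exists>x\<in>A. r x y}" using b_P r_b by blast
    qed
  qed (use r_trans in blast)+
  have 2: "\<forall>A\<in>antichain_sets. floors (up A) = A"
  proof
    fix A assume A: "A \<in> antichain_sets"
    show "floors (up A) = A"
      unfolding floors_eq[OF up_filters[OF A]]
    proof (intro equalityI subsetI)
      fix e assume e: "e \<in> {e \<in> up A. \<forall>x\<in>up A. r x e \<longrightarrow> x = e}"
      then obtain x where x: "x \<in> A" "r x e" unfolding up_def by blast
      then have "x \<in> up A" using A r_refl unfolding antichain_sets_def up_def by blast
      then have "x = e" using e x(2) by blast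
      then show "e \<in> A" using x(1) by simp
    next
      fix e assume e: "e \<in> A"
      have "x = e" if "x \<in> P" "a \<in> A" "r a x" "r x e" for x a
      proof -
        have "a = e" using r_trans that A e unfolding antichain_sets_def by blast
        then show ?thesis using that r_antisym by blast
      qed
      moreover have "e \<in> P" using e A by (auto simp: antichain_sets_def)
      moreover have "r e e" by (rule r_refl)
      ultimately show "e \<in> {e \<in> up A. \<forall>x\<in>up A. r x e \<longrightarrow> x = e}"
        using e unfolding up_def by blast
    qed
  qed
  have 3: "floors ` filters \<subseteq> antichain_sets"
  proof (rule image_subsetI)
    fix D assume D: "D \<in> filters"
    have "b e \<in> floors D" if "e \<in> floors D" for e
    proof -
      have "{b e, b (b e)} = {e, b e}" using b_b by auto
      moreover have "b e \<in> D" using that D unfolding floors_def filters_def by blast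
      ultimately show ?thesis using that unfolding floors_def by simp
    qed
    then have "b ` floors D \<subseteq> floors D" by blast
    moreover have "floors D \<subseteq> P" using D by (auto simp: floors_def filters_def)
    moreover have "x = y" if "x \<in> floors D" "y \<in> floors D" "r x y" for x y
      using that unfolding floors_eq[OF D] by simp
    ultimately show "floors D \<in> antichain_sets" unfolding antichain_sets_def by simp
  qed
  have 4: "up ` antichain_sets \<subseteq> filters" using up_filters by blast
  show ?thesis by (rule bij_betw_byWitness[OF 1 2 3 4])
qed

lemma dual: "involutive_poset P (\<lambda>x y. r y x) b"
  using fin r_refl r_trans r_antisym b_b b_P r_b by unfold_locales blast+

lemma filters_dual: assumes "D \<subseteq> P" shows "P - D \<in> involutive_poset.filters P (\<lambda>x y. r y x) b \<longleftrightarrow> D \<in> filters"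
proof -
  have *: "b ` (P - D) \<subseteq> P - D" if "b ` D \<subseteq> D" for D
  proof (rule image_subsetI)
    fix x assume x: "x \<in> P - D"
    have "b x \<notin> D"
    proof
      assume "b x \<in> D"
      then have "b (b x) \<in> D" using that by blast
      then show False using x b_b[of x] by simp
    qed
    then show "b x \<in> P - D" using x b_P by blast
  qed
  have "P - (P - D) = D" using assms by blast
  then have 1: "b ` (P - D) \<subseteq> P - D \<longleftrightarrow> b ` D \<subseteq> D" using *[of D] *[of "P - D"] by auto
  show ?thesis
    unfolding involutive_poset.filters_def[OF dual] filters_def using assms 1 by blast
qed

text \<open>The ceilings of \<open>D\<close> are the floors of its complement for the reversed
  order, and reversal does not change the antichains.\<close>

lemma bij_ceils: "bij_betw ceils filters antichain_sets"
proof -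
  interpret d: involutive_poset P "\<lambda>x y. r y x" b by (rule dual)
  have anti: "d.antichain_sets = antichain_sets" unfolding d.antichain_sets_def antichain_sets_def
    by (intro Collect_cong conj_cong refl iffI ballI impI; metis)
  have "bij_betw (\<lambda>D. P - D) filters d.filters"
  proof (rule bij_betw_byWitness[where f' = "\<lambda>D. P - D"])
    show "(\<lambda>D. P - D) ` filters \<subseteq> d.filters" using filters_dual by (auto simp: filters_def)
    show "(\<lambda>D. P - D) ` d.filters \<subseteq> filters"
    proof (rule image_subsetI)
      fix D assume D: "D \<in> d.filters"
      then have "P - (P - D) = D" by (auto simp: d.filters_def)
      then show "P - D \<in> filters" using filters_dual[of "P - D"] D by simp
    qed
  qed (auto simp: filters_def d.filters_def)
  then have "bij_betw (d.floors \<circ> (\<lambda>D. P - D)) filters antichain_sets"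
    using bij_betw_trans d.bij_floors unfolding anti by blast
  moreover have "(d.floors \<circ> (\<lambda>D. P - D)) D = ceils D" if D: "D \<in> filters" for D
  proof -
    have "P - D - {e, b e} \<in> d.filters \<longleftrightarrow> D \<union> {e, b e} \<in> filters" if "e \<in> P - D" for e
    proof -
      have "D \<union> {e, b e} \<subseteq> P" using that D b_P by (auto simp: filters_def)
      moreover have "P - D - {e, b e} = P - (D \<union> {e, b e})" by blast
      ultimately show ?thesis using filters_dual[of "D \<union> {e, b e}"] by simp
    qed
    then show ?thesis by (auto simp: d.floors_def ceils_def)
  qed
  ultimately show ?thesis using bij_betw_cong[of filters "d.floors \<circ> (\<lambda>D. P - D)" ceils] by blast
qed

end

section \<open>Symmetric antichains of pairs, summed over all orders\<close>

context signed_order begin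

definition pairs :: "('a \<times> 'a) set \<Rightarrow> ('a \<times> 'a) set" where
  "pairs L = {(s, t) \<in> L. prec s t}"

text \<open>\<open>e'\<close> spans at least the interval of \<open>L\<close> that \<open>e\<close> spans.\<close>

definition le :: "('a \<times> 'a) set \<Rightarrow> 'a \<times> 'a \<Rightarrow> 'a \<times> 'a \<Rightarrow> bool" where
  "le L e e' \<longleftrightarrow> (fst e' = fst e \<or> (fst e', fst e) \<in> L) \<and> (snd e = snd e' \<or> (snd e, snd e') \<in> L)"

lemma poset_pairs: assumes "symlin L" shows "involutive_poset (pairs L) (le L) bar"
proof
  note L = symlinD[OF assms]
  show "le L x y \<Longrightarrow> le L y z \<Longrightarrow> le L x z" for x y z
    using L(2)[of "fst z" "fst y" "fst x"] L(2)[of "snd x" "snd y" "snd z"] by (auto simp: le_def)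
  show "le L x y \<Longrightarrow> le L y x \<Longrightarrow> x = y" for x y
    using L(5)[of "fst x" "fst y"] L(5)[of "snd x" "snd y"]
    unfolding le_def prod_eq_iff by metis
  show "x \<in> pairs L \<Longrightarrow> bar x \<in> pairs L" for x
    using L(4) by (auto simp: pairs_def bar_def)
  show "le L x y \<Longrightarrow> le L (bar x) (bar y)" for x y
    using L(4) by (auto simp: le_def bar_def)
qed (auto simp: le_def)

definition upsets :: "('a \<times> 'a) set \<Rightarrow> ('a \<times> 'a) set set" where
  "upsets L = involutive_poset.filters (pairs L) (le L) bar"

definition floor_pairs :: "('a \<times> 'a) set \<Rightarrow> ('a \<times> 'a) set \<Rightarrow> ('a \<times> 'a) set" where
  "floor_pairs L D = {e \<in> D. D - orbit e \<in> upsets L}"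

definition ceil_pairs :: "('a \<times> 'a) set \<Rightarrow> ('a \<times> 'a) set \<Rightarrow> ('a \<times> 'a) set" where
  "ceil_pairs L D = {e \<in> pairs L - D. D \<union> orbit e \<in> upsets L}"

lemma upsets_iff: assumes "symlin L"
  shows "D \<in> upsets L \<longleftrightarrow> D \<subseteq> pairs L \<and> bar ` D \<subseteq> D \<and> (\<forall>x\<in>D. \<forall>y\<in>pairs L. le L x y \<longrightarrow> y \<in> D)"
  unfolding upsets_def involutive_poset.filters_def[OF poset_pairs[OF assms]] by simp

definition antichains :: "('a \<times> 'a) set \<Rightarrow> ('a \<times> 'a) set set" where
  "antichains L = {A. A \<subseteq> pairs L \<and> bar ` A \<subseteq> A \<and> (\<forall>x\<in>A. \<forall>y\<in>A. le L x y \<longrightarrow> x = y)}"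

lemma bij_floor_pairs: assumes "symlin L" shows "bij_betw (floor_pairs L) (upsets L) (antichains L)"
proof -
  interpret involutive_poset "pairs L" "le L" bar by (rule poset_pairs[OF assms])
  show ?thesis using bij_floors
    unfolding antichains_def antichain_sets_def upsets_def floor_pairs_def[abs_def] floors_def[abs_def] orbit_def .
qed

lemma bij_ceil_pairs: assumes "symlin L" shows "bij_betw (ceil_pairs L) (upsets L) (antichains L)"
proof -
  interpret involutive_poset "pairs L" "le L" bar by (rule poset_pairs[OF assms])
  show ?thesis using bij_ceils
    unfolding antichains_def antichain_sets_def upsets_def ceil_pairs_def[abs_def] ceils_def[abs_def] orbit_def .
qed

text \<open>If \<open>(a, a')\<close> is in \<open>L\<close> but \<open>(b, b')\<close> is not, the
  pair \<open>(a', b')\<close> spans part of what \<open>(a, b)\<close> spans, so they are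
  comparable. So are two pairs with a common start, which gives \<open>E_fun\<close>, and the pairs
  \<open>(c, neg c)\<close> and \<open>(d, neg d)\<close>, as \<open>neg\<close> reverses
  \<open>L\<close>, which gives \<open>E_self\<close>.\<close>

lemma antichains_linext:
  "{(L, E). symlin L \<and> E \<in> antichains L} = {(L, E). chains neg prec E \<and> L \<in> chains.linext neg E}"
proof (intro equalityI subrelI)
  fix L E assume "(L, E) \<in> {(L, E). symlin L \<and> E \<in> antichains L}"
  then have L: "symlin L" and E: "E \<in> antichains L" by auto
  note l = symlinD[OF L]
  have EL: "(s, t) \<in> L" "prec s t" if "(s, t) \<in> E" for s t
    using E that by (auto simp: antichains_def pairs_def)
  have antiD: "x = y" if "x \<in> E" "y \<in> E" "le L x y" for x y
    using E that unfolding antichains_def by blast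
  have anti: "(s, t) = (s', t')" if "(s, t) \<in> E" "(s', t') \<in> E" "s' = s \<or> (s', s) \<in> L" "t = t' \<or> (t, t') \<in> L" for s t s' t'
    using antiD[of "(s, t)" "(s', t')"] that by (simp add: le_def)
  have c: "chains neg prec E"
  proof unfold_locales
    show "(s, t) \<in> E \<Longrightarrow> prec s t" for s t using EL by blast
    show "(neg t, neg s) \<in> E" if "(s, t) \<in> E" for s t
      using E that by (force simp: antichains_def)
    show "t = u" if "(s, t) \<in> E" "(s, u) \<in> E" for s t u
      using anti[OF that] anti[OF that(2,1)] l(3)[of t u] by blast
    show "c = d" if "(c, neg c) \<in> E" "(d, neg d) \<in> E" for c d
      using anti[OF that] anti[OF that(2,1)] l(3)[of c d] l(4) by blast
  qed
  moreover have "L \<in> chains.linext neg E"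
    unfolding chains.linext_def[OF c]
  proof (intro CollectI conjI allI impI)
    fix a b a' b' assume ab: "(a, b) \<in> E" "(a', b') \<in> E" "(a, a') \<in> L"
    show "(b, b') \<in> L"
    proof (rule ccontr)
      assume "(b, b') \<notin> L"
      then have "b' = b \<or> (b', b) \<in> L" using l(3) by blast
      then have "(a', b') = (a, b)" using anti[OF ab(2,1)] ab(3) by blast
      then show False using ab(3) l(1) by auto
    qed
  qed (use L EL in auto)
  ultimately show "(L, E) \<in> {(L, E). chains neg prec E \<and> L \<in> chains.linext neg E}" by simp
next
  fix L E assume LE: "(L, E) \<in> {(L, E). chains neg prec E \<and> L \<in> chains.linext neg E}"
  then interpret chains neg prec E by simp
  from LE have L: "symlin L" and EL: "E \<subseteq> L" and mono: "\<And>a b a' b'. (a, b) \<in> E \<Longrightarrow> (a', b') \<in> E \<Longrightarrow> (a, a') \<in> L \<Longrightarrow> (b, b') \<in> L"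
    by (auto simp: linext_def)
  note l = symlinD[OF L]
  have "E \<in> antichains L"
    unfolding antichains_def
  proof (intro CollectI conjI ballI impI)
    show "E \<subseteq> pairs L" using EL E_prec by (auto simp: pairs_def)
    show "bar ` E \<subseteq> E" using E_sym by auto
    fix x y assume x: "x \<in> E" and y: "y \<in> E" and le: "le L x y"
    obtain s t s' t' where e: "x = (s, t)" "y = (s', t')" by (cases x, cases y)
    have "s' = s"
    proof (rule ccontr)
      assume "s' \<noteq> s"
      then have "(t', t) \<in> L" using le x y e mono by (auto simp: le_def)
      then show False using le l(1,5) e by (auto simp: le_def)
    qed
    then show "x = y" using x y e E_fun by auto
  qed
  then show "(L, E) \<in> {(L, E). symlin L \<and> E \<in> antichains L}" using L by simp
qed

definition states :: "(('a \<times> 'a) set \<times> ('a \<times> 'a) set) set" where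
  "states = {(L, D). symlin L \<and> D \<in> upsets L}"

definition odd_funs :: "('a \<Rightarrow> int) set" where
  "odd_funs = {g. (\<forall>s. g (neg s) = - g s) \<and> (\<forall>s. \<bar>g s\<bar> \<le> int (CARD('a) div 2))}"

definition corank :: "('a \<Rightarrow> int) \<Rightarrow> nat" where
  "corank g = CARD('a) div 2 - card {\<bar>g s\<bar> | s. g s \<noteq> 0}"

lemma finite_odd_funs: "finite odd_funs"
proof (rule finite_subset)
  show "odd_funs \<subseteq> (PiE UNIV (\<lambda>_. {- int (CARD('a) div 2)..int (CARD('a) div 2)}))"
    by (auto simp: odd_funs_def abs_le_iff) (smt (verit))+
  show "finite (PiE (UNIV :: 'a set) (\<lambda>_. {- int (CARD('a) div 2)..int (CARD('a) div 2)}))"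
    by (intro finite_PiE) auto
qed

text \<open>Both sums are grouped by \<open>E\<close>. The summand is constant on each group by
  \<open>card_orbit\<close> and \<open>card_abs_arcs\<close>, so it suffices that
  \<open>card_linext\<close> and \<open>card_arcs\<close> give the same size.\<close>

lemma sum_antichains:
  fixes f :: "nat \<Rightarrow> 'b::comm_ring_1"
  shows "(\<Sum>(L, E)\<in>{(L, E). symlin L \<and> E \<in> antichains L}. f (card (orbit ` E)))
    = (\<Sum>g\<in>odd_funs. f (corank g))"
proof -
  define Es where "Es = {E. chains neg prec E}"
  have "(\<Sum>(L, E)\<in>{(L, E). symlin L \<and> E \<in> antichains L}. f (card (orbit ` E)))
     = (\<Sum>(E, L)\<in>(SIGMA E:Es. chains.linext neg E). f (card (orbit ` E)))"
    unfolding antichains_linext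
    by (rule sum.reindex_bij_witness[of _ "\<lambda>(E, L). (L, E)" "\<lambda>(L, E). (E, L)"]) (auto simp: Es_def)
  also have "\<dots> = (\<Sum>E\<in>Es. \<Sum>L\<in>chains.linext neg E. f (card (orbit ` E)))"
    by (rule sum.Sigma[symmetric]) auto
  also have "\<dots> = (\<Sum>E\<in>Es. \<Sum>g\<in>{g\<in>odd_funs. arcs g = E}. f (corank g))"
  proof (rule sum.cong[OF refl])
    fix E assume "E \<in> Es"
    then interpret chains neg prec E by (simp add: Es_def)
    have "(\<Sum>g\<in>{g\<in>odd_funs. arcs g = E}. f (corank g))
       = (\<Sum>g\<in>{g\<in>odd_funs. arcs g = E}. f (card (orbit ` E)))"
    proof (rule sum.cong[OF refl])
      fix g assume "g \<in> {g\<in>odd_funs. arcs g = E}"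
      then have "card {\<bar>g s\<bar> | s. g s \<noteq> 0} = nblocks"
        by (intro card_abs_arcs) (auto simp: odd_funs_def)
      moreover have "CARD('a) div 2 - nblocks = card (orbit ` E)" using card_orbit by simp
      ultimately show "f (corank g) = f (card (orbit ` E))" by (simp add: corank_def)
    qed
    moreover have "card linext = card {g\<in>odd_funs. arcs g = E}"
      using card_arcs card_linext unfolding odd_funs_def by (simp add: conj_assoc)
    ultimately show "(\<Sum>L\<in>linext. f (card (orbit ` E))) =
       (\<Sum>g\<in>{g\<in>odd_funs. arcs g = E}. f (corank g))"
      by simp
  qed
  also have "\<dots> = (\<Sum>g\<in>odd_funs. f (corank g))"
    by (rule sum.group) (use finite_odd_funs chains_arcs in \<open>auto simp: Es_def odd_funs_def\<close>)
  finally show ?thesis .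
qed

lemma sum_upsets:
  fixes f :: "nat \<Rightarrow> 'b::comm_ring_1"
  shows "(\<Sum>(L, D)\<in>states. f (card (orbit ` floor_pairs L D)))
    = (\<Sum>g\<in>odd_funs. f (corank g))" (is "?F = ?S")
    "(\<Sum>(L, D)\<in>states. f (card (orbit ` ceil_pairs L D)))
    = (\<Sum>g\<in>odd_funs. f (corank g))" (is "?C = ?S")
proof -
  have *: "(\<Sum>(L, D)\<in>states. f (card (orbit ` F L D))) = ?S"
    if "\<And>L. symlin L \<Longrightarrow> bij_betw (F L) (upsets L) (antichains L)" for F
  proof -
    have "(\<Sum>(L, D)\<in>states. f (card (orbit ` F L D)))
       = (\<Sum>(L, D)\<in>Sigma {L. symlin L} upsets. f (card (orbit ` F L D)))"
      by (rule sum.cong) (auto simp: states_def)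
    also have "\<dots> = (\<Sum>L\<in>{L. symlin L}. \<Sum>D\<in>upsets L. f (card (orbit ` F L D)))"
      by (rule sum.Sigma[symmetric]) auto
    also have "\<dots> = (\<Sum>L\<in>{L. symlin L}. \<Sum>E\<in>antichains L. f (card (orbit ` E)))"
      by (intro sum.cong refl sum.reindex_bij_betw that) simp
    also have "\<dots> = (\<Sum>(L, E)\<in>Sigma {L. symlin L} antichains. f (card (orbit ` E)))"
      by (rule sum.Sigma) auto
    also have "\<dots> = (\<Sum>(L, E)\<in>{(L, E). symlin L \<and> E \<in> antichains L}. f (card (orbit ` E)))"
      by (rule sum.cong) auto
    finally show ?thesis using sum_antichains by simp
  qed
  show "?F = ?S" by (rule *[OF bij_floor_pairs])
  show "?C = ?S" by (rule *[OF bij_ceil_pairs])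
qed

end

section \<open>Regions and walls of an arrangement\<close>

text \<open>Different indices may name the same hyperplane, so hyperplanes are compared through
  \<open>hyp\<close> and not through their indices.\<close>

locale arrangement =
  fixes I :: "'i set" and a :: "'i \<Rightarrow> 'a::euclidean_space" and b :: "'i \<Rightarrow> real"
  assumes finite_I: "finite I" and a_nz: "i \<in> I \<Longrightarrow> a i \<noteq> 0"
begin

definition hyp :: "'i \<Rightarrow> 'a set" where "hyp i = {x. a i \<bullet> x = b i}"

definition off :: "'i \<Rightarrow> 'a \<Rightarrow> real" where "off i x = a i \<bullet> x - b i"

definition generic :: "'a \<Rightarrow> bool" where "generic x \<longleftrightarrow> (\<forall>i\<in>I. off i x \<noteq> 0)"

definition cell :: "'a \<Rightarrow> 'a set" where "cell x = {y. \<forall>i\<in>I. 0 < off i x * off i y}"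

lemma off_affine: "u + v = 1 \<Longrightarrow> off i (u *\<^sub>R x + v *\<^sub>R y) = u * off i x + v * off i y"
proof -
  assume "u + v = 1"
  then have "b i = u * b i + v * b i" by (metis distrib_right mult_1)
  then show ?thesis by (simp add: off_def inner_add_right algebra_simps)
qed

lemma off_0_iff: "off i x = 0 \<longleftrightarrow> x \<in> hyp i"
  by (auto simp: off_def hyp_def)

lemma Compl_Union: "- \<Union> (hyp ` I) = {x. generic x}"
  by (auto simp: generic_def off_0_iff)

lemma cell_eq: "cell x = (\<Inter>i\<in>I. {y. (off i x *\<^sub>R a i) \<bullet> y > off i x * b i})"
  by (auto simp: cell_def off_def algebra_simps)

lemma open_cell: "open (cell x)"
  unfolding cell_eq by (intro open_INT finite_I ballI open_halfspace_gt)

lemma convex_cell: "convex (cell x)"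
  unfolding cell_eq by (intro convex_INT convex_halfspace_gt)

lemma generic_cell: "generic x \<Longrightarrow> x \<in> cell x"
  by (auto simp: generic_def cell_def zero_less_mult_iff linorder_neq_iff)

lemma cell_generic: "y \<in> cell x \<Longrightarrow> generic y"
  by (auto simp: generic_def cell_def)

text \<open>A cell is convex, and a connected set on which some \<open>off i\<close> changes sign
  meets \<open>hyp i\<close>.\<close>

lemma connected_component_cell:
  assumes "generic x" shows "connected_component_set {x. generic x} x = cell x"
proof
  show "cell x \<subseteq> connected_component_set {x. generic x} x"
    by (rule connected_component_maximal)
      (use generic_cell[OF assms] convex_connected[OF convex_cell] cell_generic in auto)
  show "connected_component_set {x. generic x} x \<subseteq> cell x"
  proof
    fix y assume "y \<in> connected_component_set {x. generic x} x"
    then obtain T where T: "connected T" "T \<subseteq> {x. generic x}" "x \<in> T" "y \<in> T"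
      by (auto simp: connected_component_def)
    have "0 < off i x * off i y" if i: "i \<in> I" for i
    proof (rule ccontr)
      assume neg: "\<not> 0 < off i x * off i y"
      have "(a i \<bullet> x \<le> b i \<and> b i \<le> a i \<bullet> y) \<or> (a i \<bullet> y \<le> b i \<and> b i \<le> a i \<bullet> x)"
        using neg by (auto simp: off_def not_less mult_le_0_iff)
      then obtain z where "z \<in> T" "a i \<bullet> z = b i"
        using connected_ivt_hyperplane[OF T(1,3,4)] connected_ivt_hyperplane[OF T(1,4,3)] by blast
      then show False using T(2) i by (auto simp: generic_def off_def)
    qed
    then show "y \<in> cell x" by (simp add: cell_def)
  qed
qed

lemma regions_eq: "regions (hyp ` I) = cell ` {x. generic x}"
  unfolding regions_def Compl_Union components_def using connected_component_cell by auto

lemma closure_cell_nonneg: assumes "p \<in> closure (cell x)" "i \<in> I" shows "0 \<le> off i x * off i p"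
proof -
  have "closed {y. (off i x *\<^sub>R a i) \<bullet> y \<ge> off i x * b i}" by (rule closed_halfspace_ge)
  moreover have "cell x \<subseteq> {y. (off i x *\<^sub>R a i) \<bullet> y \<ge> off i x * b i}"
    using assms(2) by (auto simp: cell_eq less_imp_le)
  ultimately have "p \<in> {y. (off i x *\<^sub>R a i) \<bullet> y \<ge> off i x * b i}"
    using assms(1) closure_minimal by blast
  then show ?thesis by (simp add: off_def algebra_simps)
qed

lemma in_closure_cell:
  assumes "generic x" "\<And>i. i \<in> I \<Longrightarrow> 0 \<le> off i x * off i p" shows "p \<in> closure (cell x)"
proof (cases "p = x")
  case True
  then show ?thesis using generic_cell[OF assms(1)] closure_subset by blast
next
  case False
  have "open_segment p x \<subseteq> cell x"
  proof
    fix y assume "y \<in> open_segment p x"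
    then obtain u where u: "0 < u" "u < 1" "y = (1 - u) *\<^sub>R p + u *\<^sub>R x" by (auto simp: in_segment)
    have "0 < off i x * off i y" if i: "i \<in> I" for i
    proof -
      have "off i x * off i y = (1 - u) * (off i x * off i p) + u * (off i x * off i x)"
        unfolding u(3) by (subst off_affine) (auto simp: algebra_simps)
      moreover have "0 < off i x * off i x" using assms(1) i
        by (auto simp: generic_def zero_less_mult_iff linorder_neq_iff)
      ultimately show ?thesis using u assms(2)[OF i] by (simp add: add_nonneg_pos)
    qed
    then show "y \<in> cell x" by (simp add: cell_def)
  qed
  then have "closure (open_segment p x) \<subseteq> closure (cell x)" by (rule closure_mono)
  then show ?thesis using False by (auto simp: closure_open_segment)
qed

text \<open>A facet lies in no hyperplane but the one it spans, so averaging finitely many of its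
  points leads off all the others. Conversely, near such a point \<open>p\<close> all of
  \<open>hyp i\<close> belongs to the closure of the cell, and a relatively open part of
  \<open>hyp i\<close> spans it.\<close>

lemma wall_iff:
  assumes x: "generic x" and i: "i \<in> I"
  shows "hyp i \<in> walls (hyp ` I) (cell x) \<longleftrightarrow>
    (\<exists>p. off i p = 0 \<and> (\<forall>j\<in>I. hyp j \<noteq> hyp i \<longrightarrow> 0 < off j x * off j p))"
  (is "_ \<longleftrightarrow> ?R")
proof
  assume "hyp i \<in> walls (hyp ` I) (cell x)"
  then obtain F where F: "F facet_of closure (cell x)" "hyp i = affine hull F" by (auto simp: walls_def)
  have Fc: "convex F" "F \<subseteq> closure (cell x)" "F \<noteq> {}"
    using F(1) facet_of_imp_face_of face_of_imp_convex face_of_imp_subset facet_of_def by blast+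
  have "\<exists>p\<in>F. \<forall>j\<in>J. hyp j \<noteq> hyp i \<longrightarrow> 0 < off j x * off j p" if "finite J" "J \<subseteq> I" for J
    using that
  proof (induction J)
    case empty then show ?case using Fc(3) by blast
  next
    case (insert j J)
    then obtain p where p: "p \<in> F" "\<forall>j\<in>J. hyp j \<noteq> hyp i \<longrightarrow> 0 < off j x * off j p" by auto
    show ?case
    proof (cases "hyp j = hyp i")
      case True then show ?thesis using p by auto
    next
      case False
      have j: "j \<in> I" using insert by simp
      have "\<not> F \<subseteq> hyp j"
      proof
        assume "F \<subseteq> hyp j"
        then have "hyp i \<subseteq> hyp j"
          unfolding F(2) by (intro hull_minimal) (auto simp: hyp_def affine_hyperplane)
        moreover have "aff_dim (hyp i) = aff_dim (hyp j)"
          unfolding hyp_def using a_nz[OF i] a_nz[OF j] by (simp add: aff_dim_hyperplane)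
        ultimately have "hyp i = hyp j"
          by (metis affine_hyperplane affine_dim_equal aff_dim_empty F(2) Fc(3) affine_affine_hull hull_subset hyp_def subset_empty)
        then show False using False by simp
      qed
      then obtain r where r: "r \<in> F" "off j r \<noteq> 0" by (auto simp: off_0_iff)
      define m where "m = (1/2) *\<^sub>R p + (1/2) *\<^sub>R r"
      have nn: "0 \<le> off k x * off k y" if "y \<in> F" "k \<in> I" for k y
        using closure_cell_nonneg Fc(2) that by blast
      have m: "off k x * off k m = (off k x * off k p + off k x * off k r) / 2" for k
        unfolding m_def by (subst off_affine) (auto simp: algebra_simps)
      have "m \<in> F" unfolding m_def using Fc(1) p(1) r(1) by (intro convexD) auto
      moreover have "0 < off j x * off j r"
        using nn[OF r(1) j] r(2) x j by (auto simp: generic_def less_le)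
      then have "0 < off j x * off j m" unfolding m using nn[OF p(1) j] by simp
      moreover have "\<forall>k\<in>J. hyp k \<noteq> hyp i \<longrightarrow> 0 < off k x * off k m"
      proof (intro ballI impI)
        fix k assume k: "k \<in> J" "hyp k \<noteq> hyp i"
        then have "0 < off k x * off k p" "0 \<le> off k x * off k r"
          using p nn[OF r(1)] insert.prems by auto
        then show "0 < off k x * off k m" unfolding m by simp
      qed
      ultimately show ?thesis by auto
    qed
  qed
  then obtain p where p: "p \<in> F" "\<forall>j\<in>I. hyp j \<noteq> hyp i \<longrightarrow> 0 < off j x * off j p"
    using finite_I by blast
  have "p \<in> hyp i" unfolding F(2) using p(1) by (rule hull_inc)
  then show "?R"
    using p off_0_iff by blast
next
  assume "?R"
  then obtain p where p: "off i p = 0" "\<And>j. j \<in> I \<Longrightarrow> hyp j \<noteq> hyp i \<Longrightarrow> 0 < off j x * off j p" by blast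
  let ?S = "closure (cell x)"
  define F where "F = ?S \<inter> hyp i"
  define T where "T = (\<Inter>j\<in>{j\<in>I. hyp j \<noteq> hyp i}. {y. (off j x *\<^sub>R a j) \<bullet> y > off j x * b j})"
  have T: "y \<in> T \<longleftrightarrow> (\<forall>j\<in>I. hyp j \<noteq> hyp i \<longrightarrow> 0 < off j x * off j y)" for y
    by (auto simp: T_def off_def algebra_simps)
  have "open T" unfolding T_def using finite_I by (intro open_INT ballI open_halfspace_gt) simp
  have pT: "p \<in> hyp i \<inter> T" using p by (simp add: T off_0_iff)
  have sub: "hyp i \<inter> T \<subseteq> F"
  proof
    fix y assume y: "y \<in> hyp i \<inter> T"
    have "0 \<le> off j x * off j y" if "j \<in> I" for j
    proof (cases "hyp j = hyp i")
      case True
      then have "off j y = 0" using y by (simp add: off_0_iff)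
      then show ?thesis by simp
    next
      case False
      then show ?thesis using y T that by (simp add: less_imp_le)
    qed
    then show "y \<in> F" using in_closure_cell[OF x] y by (simp add: F_def)
  qed
  have aff: "affine (hyp i)" by (simp add: hyp_def affine_hyperplane)
  have "affine hull (hyp i \<inter> T) = affine hull (hyp i)"
    using pT by (intro affine_hull_convex_Int_open affine_imp_convex aff \<open>open T\<close>) auto
  then have "affine hull (hyp i \<inter> T) = hyp i" using aff by (simp add: affine_hull_eq)
  moreover have "affine hull (hyp i \<inter> T) \<subseteq> affine hull F" using sub by (rule hull_mono)
  moreover have "affine hull F \<subseteq> hyp i" by (intro hull_minimal aff) (auto simp: F_def)
  ultimately have hull: "affine hull F = hyp i" by blast
  have face: "F face_of ?S"
  proof -
    have e: "hyp i = {y. (off i x *\<^sub>R a i) \<bullet> y = off i x * b i}"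
      using x i by (auto simp: hyp_def generic_def)
    have "(off i x *\<^sub>R a i) \<bullet> y \<ge> off i x * b i" if "y \<in> ?S" for y
      using closure_cell_nonneg[OF that i] by (simp add: off_def algebra_simps)
    then show ?thesis unfolding F_def e
      by (intro face_of_Int_supporting_hyperplane_ge convex_closure convex_cell)
  qed
  have "aff_dim F = DIM('a) - 1"
  proof -
    have "aff_dim F = aff_dim (hyp i)" unfolding hull[symmetric] by simp
    then show ?thesis unfolding hyp_def using a_nz[OF i] by (simp add: aff_dim_hyperplane)
  qed
  moreover have "aff_dim ?S = DIM('a)"
    using aff_dim_open[OF open_cell] generic_cell[OF x] by (auto simp: closure_aff_dim)
  moreover have "F \<noteq> {}" using sub pT by blast
  ultimately have "F facet_of ?S" using face by (simp add: facet_of_def)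
  then show "hyp i \<in> walls (hyp ` I) (cell x)" unfolding walls_def using i hull by auto
qed

text \<open>Continue the segment from \<open>x\<close> to \<open>p\<close> a little beyond
  \<open>p\<close>.\<close>

lemma cross_wall:
  assumes x: "generic x" and i: "i \<in> I" and p: "off i p = 0" "\<And>j. j \<in> I \<Longrightarrow> hyp j \<noteq> hyp i \<Longrightarrow> 0 < off j x * off j p"
  shows "\<exists>y. \<forall>j\<in>I. if hyp j = hyp i then off j x * off j y < 0 else 0 < off j x * off j y"
proof -
  define f where "f j d = off j x * off j ((1 + d) *\<^sub>R p + (- d) *\<^sub>R x)" for j and d :: real
  have f: "f j d = (1 + d) * (off j x * off j p) - d * (off j x * off j x)" for j d
    unfolding f_def by (subst off_affine) (auto simp: algebra_simps)
  have "\<forall>\<^sub>F d in at_right 0. \<forall>j\<in>{j\<in>I. hyp j \<noteq> hyp i}. 0 < f j d"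
  proof (rule eventually_ball_finite)
    show "\<forall>j\<in>{j\<in>I. hyp j \<noteq> hyp i}. \<forall>\<^sub>F d in at_right 0. 0 < f j d"
    proof
      fix j assume j: "j \<in> {j\<in>I. hyp j \<noteq> hyp i}"
      have "((\<lambda>d. f j d) \<longlongrightarrow> (1 + 0) * (off j x * off j p) - 0 * (off j x * off j x)) (at_right 0)"
        unfolding f by (intro tendsto_intros)
      then show "\<forall>\<^sub>F d in at_right 0. 0 < f j d"
        using p(2) j by (intro order_tendstoD(1)) auto
    qed
  qed (use finite_I in auto)
  then have "\<forall>\<^sub>F d in at_right (0::real). 0 < d \<and> (\<forall>j\<in>{j\<in>I. hyp j \<noteq> hyp i}. 0 < f j d)"
    by (intro eventually_conj eventually_at_right_less)
  then have "\<exists>d>0. \<forall>j\<in>{j\<in>I. hyp j \<noteq> hyp i}. 0 < f j d"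
    by (rule eventually_happens'[rotated]) simp
  then obtain d where d: "0 < d" "\<And>j. j \<in> I \<Longrightarrow> hyp j \<noteq> hyp i \<Longrightarrow> 0 < f j d" by blast
  have "f j d < 0" if "j \<in> I" "hyp j = hyp i" for j
  proof -
    have "off j p = 0" using p(1) that off_0_iff by blast
    moreover have "0 < off j x * off j x" using x that
      by (auto simp: generic_def zero_less_mult_iff linorder_neq_iff)
    ultimately show ?thesis unfolding f using d(1) by simp
  qed
  then show ?thesis using d(2) unfolding f_def by (intro exI) auto
qed

lemma wall_between:
  assumes x: "generic x" and i: "i \<in> I"
    and y: "\<And>j. j \<in> I \<Longrightarrow> hyp j \<noteq> hyp i \<Longrightarrow> 0 < off j x * off j y" "off i x * off i y < 0"
  shows "hyp i \<in> walls (hyp ` I) (cell x)"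
proof -
  \<comment> \<open>The parameter at which the segment from \<open>x\<close> to \<open>y\<close>
    meets \<open>hyp i\<close>.\<close>
  define u where "u = off i x / (off i x - off i y)"
  have u: "0 < u" "u < 1" "(1 - u) * off i x + u * off i y = 0"
    using y(2) by (auto simp: u_def mult_less_0_iff field_simps)
  define p where "p = (1 - u) *\<^sub>R x + u *\<^sub>R y"
  have "off i p = 0" unfolding p_def using u by (subst off_affine) auto
  moreover have "0 < off j x * off j p" if "j \<in> I" "hyp j \<noteq> hyp i" for j
  proof -
    have "off j x * off j p = (1 - u) * (off j x * off j x) + u * (off j x * off j y)"
      unfolding p_def by (subst off_affine) (auto simp: algebra_simps)
    then show ?thesis using u y(1)[OF that] by (simp add: add_nonneg_pos)
  qed
  ultimately show ?thesis using wall_iff[OF x i] by blast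
qed

text \<open>This eliminates facets: a hyperplane is a wall if reversing the sign at it alone yields
  the sign vector of another region.\<close>

lemma wall_iff_cross:
  assumes x: "generic x" and i: "i \<in> I"
  shows "hyp i \<in> walls (hyp ` I) (cell x) \<longleftrightarrow>
    (\<exists>y. \<forall>j\<in>I. if hyp j = hyp i then off j x * off j y < 0 else 0 < off j x * off j y)"
  (is "_ \<longleftrightarrow> ?R")
proof
  assume "hyp i \<in> walls (hyp ` I) (cell x)"
  then obtain p where "off i p = 0" "\<And>j. j \<in> I \<Longrightarrow> hyp j \<noteq> hyp i \<Longrightarrow> 0 < off j x * off j p"
    unfolding wall_iff[OF x i] by blast
  then show "?R"
    by (rule cross_wall[OF x i])
next
  assume "?R"
  then obtain y where "\<And>j. j \<in> I \<Longrightarrow> if hyp j = hyp i then off j x * off j y < 0 else 0 < off j x * off j y"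
    by blast
  from this[OF i] this show "hyp i \<in> walls (hyp ` I) (cell x)"
    by (intro wall_between[OF x i, of y]) (auto split: if_splits)
qed

text \<open>The definitions admit any equation of the hyperplane. Coefficients need not be compared:
  an open half-space of one equation is connected, so if it had points on both sides for the other
  equation, it would meet the hyperplane.\<close>

lemma opposite_iff:
  assumes x: "generic x" and i: "i \<in> I" and b: "0 < b i"
  shows "opposite_half_spaces (hyp i) (cell x) {0} \<longleftrightarrow> 0 < off i x"
    "same_half_space (hyp i) (cell x) {0} \<longleftrightarrow> off i x < 0"
proof -
  have xc: "x \<in> cell x" using x generic_cell by blast
  have pos: "0 < off i y" if "0 < off i x" "y \<in> cell x" for y
    using that i by (auto simp: cell_def zero_less_mult_iff)
  have neg: "off i y < 0" if "off i x < 0" "y \<in> cell x" for y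
    using that i by (auto simp: cell_def zero_less_mult_iff)
  have con: "connected {y::'a. c \<bullet> y < d}" for c d by (intro convex_connected convex_halfspace_lt)
  show "opposite_half_spaces (hyp i) (cell x) {0} \<longleftrightarrow> 0 < off i x"
  proof
    assume "opposite_half_spaces (hyp i) (cell x) {0}"
    then obtain c d where c: "hyp i = {x. c \<bullet> x = d}" "c \<bullet> x < d" "d < 0"
      using xc by (auto simp: opposite_half_spaces_def)
    show "0 < off i x"
    proof (rule ccontr)
      assume "\<not> 0 < off i x"
      then have "a i \<bullet> x < b i" using x i by (auto simp: generic_def off_def)
      then obtain z where "a i \<bullet> z < b i" "c \<bullet> z = d"
        using connected_ivt_hyperplane[OF con, of x "a i" "b i" 0 c d] c b by auto
      then have "z \<in> hyp i" unfolding c(1) by simp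
      then show False using \<open>a i \<bullet> z < b i\<close> by (simp add: hyp_def)
    qed
  next
    assume "0 < off i x"
    then show "opposite_half_spaces (hyp i) (cell x) {0}"
      unfolding opposite_half_spaces_def using a_nz[OF i] pos b
      by (intro exI[of _ "- a i"] exI[of _ "- b i"]) (auto simp: hyp_def off_def)
  qed
  show "same_half_space (hyp i) (cell x) {0} \<longleftrightarrow> off i x < 0"
  proof
    assume "same_half_space (hyp i) (cell x) {0}"
    then obtain c d where c: "hyp i = {x. c \<bullet> x = d}" "c \<bullet> x < d" "0 < d"
      using xc by (auto simp: same_half_space_def)
    show "off i x < 0"
    proof (rule ccontr)
      assume "\<not> off i x < 0"
      then have "b i \<le> a i \<bullet> x" by (auto simp: off_def)
      then obtain z where "a i \<bullet> z = b i" "c \<bullet> z < d"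
        using connected_ivt_hyperplane[OF con, of 0 c d x "a i" "b i"] c b by auto
      then have "z \<in> hyp i" by (simp add: hyp_def)
      then show False using \<open>c \<bullet> z < d\<close> unfolding c(1) by simp
    qed
  next
    assume "off i x < 0"
    then show "same_half_space (hyp i) (cell x) {0}"
      unfolding same_half_space_def using a_nz[OF i] neg b
      by (intro exI[of _ "a i"] exI[of _ "b i"]) (auto simp: hyp_def off_def)
  qed
qed

end

section \<open>The type C Shi arrangement\<close>

lemma ex_between:
  fixes A B :: "real set"
  assumes "finite A" "finite B" "\<And>l u. l \<in> A \<Longrightarrow> u \<in> B \<Longrightarrow> l < u"
  shows "\<exists>y. (\<forall>l\<in>A. l < y) \<and> (\<forall>u\<in>B. y < u)"
proof (cases "A = {} \<or> B = {}")
  case True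
  moreover have "\<exists>y. \<forall>l\<in>A. l < y"
    using assms(1) by (intro exI[of _ "Max A + 1"]) (auto intro: le_less_trans[OF Max_ge])
  moreover have "\<exists>y. \<forall>u\<in>B. y < u"
  proof (intro exI ballI)
    show "Min B - 1 < u" if "u \<in> B" for u using Min_le[OF assms(2) that] by simp
  qed
  ultimately show ?thesis by auto
next
  case False
  then have "Max A < Min B" using assms by simp
  then obtain y where "Max A < y" "y < Min B" using dense by blast
  then show ?thesis using assms(1,2) False by (auto intro!: exI[of _ y])
qed

text \<open>Values are assigned from the end of \<open>u\<close>, the smallest first. A new value
  must exceed the old ones, and exceed \<open>1 + y t\<close> exactly when \<open>(h, t)\<close> is
  in \<open>F\<close>. By \<open>F1\<close> and \<open>F2\<close> every lower bound is smaller than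
  every upper bound.\<close>

lemma realise_list:
  fixes F L :: "('a \<times> 'a) set"
  assumes F1: "\<And>r s t. (s, t) \<in> F \<Longrightarrow> (r, s) \<in> L \<Longrightarrow> (r, t) \<in> F"
    and F2: "\<And>s t u. (s, t) \<in> F \<Longrightarrow> (t, u) \<in> L \<Longrightarrow> (s, u) \<in> F"
  shows "distinct u \<Longrightarrow> before u \<subseteq> L \<Longrightarrow> \<exists>y :: 'a \<Rightarrow> real. \<forall>(s, t)\<in>before u. y t < y s \<and>
    (if (s, t) \<in> F then 1 < y s - y t else y s - y t < 1)"
proof (induction u)
  case Nil then show ?case by simp
next
  case (Cons h v)
  have "distinct v" "before v \<subseteq> L" using Cons.prems by auto
  then obtain y :: "'a \<Rightarrow> real" where y0: "\<forall>(s, t)\<in>before v. y t < y s \<and>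
    (if (s, t) \<in> F then 1 < y s - y t else y s - y t < 1)" using Cons.IH by blast
  have y: "y t < y s" "(s, t) \<in> F \<Longrightarrow> 1 < y s - y t" "(s, t) \<notin> F \<Longrightarrow> y s - y t < 1"
    if "(s, t) \<in> before v" for s t
    using bspec[OF y0 that] by auto
  define A where "A = y ` set v \<union> (\<lambda>t. 1 + y t) ` {t \<in> set v. (h, t) \<in> F}"
  define B where "B = (\<lambda>t. 1 + y t) ` {t \<in> set v. (h, t) \<notin> F}"
  have hL: "(h, t) \<in> L" if "t \<in> set v" for t using Cons.prems(2) that by auto
  have vL: "before v \<subseteq> L" using Cons.prems(2) by auto
  have "l < u" if "l \<in> A" "u \<in> B" for l u
  proof -
    from that obtain t where t: "t \<in> set v" "(h, t) \<notin> F" "u = 1 + y t" by (auto simp: B_def)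
    consider r where "r \<in> set v" "l = y r" | r where "r \<in> set v" "(h, r) \<in> F" "l = 1 + y r"
      using \<open>l \<in> A\<close> by (auto simp: A_def)
    then show ?thesis
    proof cases
      case 1
      have "(r, t) \<notin> F" using F1 hL[OF 1(1)] t(2) by blast
      then show ?thesis using y(1)[of t r] y(3)[of r t] before_total[OF 1(1) t(1)] 1 t(3) by (cases "r = t") auto
    next
      case 2
      have "(r, t) \<notin> before v" using F2 vL 2 t(2) by blast
      moreover have "r \<noteq> t" using 2 t by blast
      ultimately show ?thesis using y(1)[of t r] before_total[OF 2(1) t(1)] 2 t(3) by auto
    qed
  qed
  then have "\<exists>c. (\<forall>l\<in>A. l < c) \<and> (\<forall>u\<in>B. c < u)"
    by (intro ex_between) (simp_all add: A_def B_def)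
  then obtain c where c: "\<And>l. l \<in> A \<Longrightarrow> l < c" "\<And>u. u \<in> B \<Longrightarrow> c < u" by blast
  have "(y(h := c)) t < (y(h := c)) s \<and>
      (if (s, t) \<in> F then 1 < (y(h := c)) s - (y(h := c)) t else (y(h := c)) s - (y(h := c)) t < 1)"
    if "(s, t) \<in> before (h # v)" for s t
  proof (cases "s = h")
    case True
    then have t: "t \<in> set v" "t \<noteq> h" using that Cons.prems(1) by (auto dest: before_set)
    have "y t < c" using t by (intro c(1)) (auto simp: A_def)
    moreover have "1 + y t < c" if "(h, t) \<in> F" using t that by (intro c(1)) (auto simp: A_def)
    moreover have "c < 1 + y t" if "(h, t) \<notin> F" using t that by (intro c(2)) (auto simp: B_def)
    ultimately show ?thesis using True t by auto
  next
    case False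
    then have "(s, t) \<in> before v" "t \<noteq> h" using that Cons.prems(1) by (auto dest: before_set)
    then show ?thesis using y False by auto
  qed
  then show ?case by blast
qed

context signed_order begin

lemma realise:
  assumes L: "symlin L" and D: "D \<in> upsets L"
  shows "\<exists>y :: 'a \<Rightarrow> real. (\<forall>s. y (neg s) = - y s) \<and> (\<forall>(s, t)\<in>L. y t < y s) \<and>
    (\<forall>(s, t)\<in>pairs L. if (s, t) \<in> D then 1 < y s - y t else y s - y t < 1)"
proof -
  note l = symlinD[OF L]
  have DP: "D \<subseteq> pairs L" and Db: "bar ` D \<subseteq> D" and Du: "\<And>x y. x \<in> D \<Longrightarrow> y \<in> pairs L \<Longrightarrow> le L x y \<Longrightarrow> y \<in> D"
    using D unfolding upsets_iff[OF L] by blast+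
  \<comment> \<open>\<open>D\<close> only concerns pairs that agree with \<open>prec\<close>, but
    \<open>realise_list\<close> needs an upper set of all pairs. \<open>F\<close> is the one
    generated by \<open>D\<close>, and by \<open>FD\<close> it adds nothing among the pairs of
    \<open>pairs L\<close>.\<close>
  define F where "F = {e. \<exists>d\<in>D. le L d e}"
  have "trans L" using L by (simp add: symlin_def)
  then have "\<exists>u. distinct u \<and> set u = UNIV \<and> before u \<subseteq> L"
    by (intro ex_sorted_list) (use l(1,3) in auto)
  then obtain u where u: "distinct u" "set u = UNIV" "before u \<subseteq> L" by blast
  have Lu: "L \<subseteq> before u"
  proof (rule subrelI)
    fix s t assume "(s, t) \<in> L"
    then show "(s, t) \<in> before u" using before_total[of s u t] u l(1) l(5)[of s t] by auto
  qed
  have "\<exists>y :: 'a \<Rightarrow> real. \<forall>(s, t)\<in>before u. y t < y s \<and>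
    (if (s, t) \<in> F then 1 < y s - y t else y s - y t < 1)"
  proof (rule realise_list[OF _ _ u(1,3)])
    show "(r, t) \<in> F" if "(s, t) \<in> F" "(r, s) \<in> L" for r s t
      using that l(2)[of r s] by (auto simp: F_def le_def)
    show "(s, t') \<in> F" if "(s, t) \<in> F" "(t, t') \<in> L" for s t t'
      using that l(2)[of _ t t'] by (auto simp: F_def le_def)
  qed
  then obtain y :: "'a \<Rightarrow> real" where y0: "\<forall>(s, t)\<in>before u. y t < y s \<and>
    (if (s, t) \<in> F then 1 < y s - y t else y s - y t < 1)" by blast
  have y: "y t < y s" "(s, t) \<in> F \<Longrightarrow> 1 < y s - y t" "(s, t) \<notin> F \<Longrightarrow> y s - y t < 1"
    if "(s, t) \<in> L" for s t
    using bspec[OF y0 subsetD[OF Lu that]] by auto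
  have FD: "e \<in> F \<longleftrightarrow> e \<in> D" if "e \<in> pairs L" for e
    using Du[OF _ that] by (auto simp: F_def le_def)
  \<comment> \<open>The average of \<open>y\<close> and its mirror image, which satisfies the same
    inequalities since \<open>L\<close> and \<open>D\<close> are symmetric; this makes the point
    odd.\<close>
  define z where "z s = (y s - y (neg s)) / 2" for s
  have z: "z s - z t = ((y s - y t) + (y (neg t) - y (neg s))) / 2" for s t
    by (simp add: z_def field_simps)
  have "z t < z s" if "(s, t) \<in> L" for s t
    using y(1)[OF that] y(1)[OF l(4)[OF that]] z[of s t] by simp
  moreover have "if (s, t) \<in> D then 1 < z s - z t else z s - z t < 1" if st: "(s, t) \<in> pairs L" for s t
  proof -
    have sL: "(s, t) \<in> L" "(neg t, neg s) \<in> L" "(neg t, neg s) \<in> pairs L"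
      using st l(4) by (auto simp: pairs_def)
    have "bar (s, t) \<in> D \<longleftrightarrow> (s, t) \<in> D" using Db bar_bar by (metis image_subset_iff)
    then have "(neg t, neg s) \<in> D \<longleftrightarrow> (s, t) \<in> D" by simp
    then have F: "(neg t, neg s) \<in> F \<longleftrightarrow> (s, t) \<in> D" "(s, t) \<in> F \<longleftrightarrow> (s, t) \<in> D"
      using FD[OF st] FD[OF sL(3)] by blast+
    show ?thesis
    proof (cases "(s, t) \<in> D")
      case True
      then have "1 < y s - y t" "1 < y (neg t) - y (neg s)" using F y(2) sL by blast+
      then show ?thesis using True unfolding z by simp
    next
      case False
      then have "y s - y t < 1" "y (neg t) - y (neg s) < 1" using F y(3) sL by blast+
      then show ?thesis using False unfolding z by simp
    qed
  qed
  moreover have "z (neg s) = - z s" for s unfolding z_def neg_neg minus_divide_left by simp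
  ultimately show ?thesis by (intro exI[of _ z]) auto
qed

end

text \<open>The symbol \<open>i\<close> is encoded as \<open>(i, True)\<close> and \<open>- i\<close> as \<open>(i, False)\<close>.\<close>

definition sneg :: "'n \<times> bool \<Rightarrow> 'n \<times> bool" where "sneg s = (fst s, \<not> snd s)"

definition sprec :: "'n::linorder \<times> bool \<Rightarrow> 'n \<times> bool \<Rightarrow> bool" where
  "sprec s t \<longleftrightarrow> (if snd s then snd t \<longrightarrow> fst s < fst t else \<not> snd t \<and> fst t < fst s)"

interpretation symb: signed_order "sneg :: 'n::{finite,linorder} \<times> bool \<Rightarrow> _" sprec
proof
  show "sprec s u" if "sprec s t" "sprec t u" for s t u :: "'n \<times> bool"
    using that by (auto simp: sprec_def split: if_splits)
  show "sprec s t \<or> sprec t s" if "s \<noteq> t" for s t :: "'n \<times> bool"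
    using that by (auto simp: sprec_def prod_eq_iff)
qed (auto simp: sneg_def sprec_def prod_eq_iff)

definition axis_of :: "'n \<times> bool \<Rightarrow> real ^ 'n" where
  "axis_of s = (if snd s then axis (fst s) 1 else - axis (fst s) 1)"

lemma axis_of_neg: "axis_of (sneg s) = - axis_of s"
  by (simp add: axis_of_def sneg_def)

lemma axis_of_inner: "axis_of s \<bullet> axis_of t = (if s = t then 1 else if s = sneg t then - 1 else 0)"
  by (auto simp: axis_of_def sneg_def inner_axis_axis prod_eq_iff)

lemma axis_of_inj: "axis_of s = axis_of t \<Longrightarrow> s = t"
  using axis_of_inner[of s t] axis_of_inner[of t t] by (auto split: if_splits)

lemma inner_axis_of: "axis_of (i, True) \<bullet> x = x $ i" "axis_of (i, False) \<bullet> x = - x $ i"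
  by (simp_all add: axis_of_def inner_axis')

section \<open>Hyperplanes indexed by pairs of signed symbols\<close>

definition root_vec :: "('n \<times> bool) \<times> ('n \<times> bool) \<Rightarrow> real ^ 'n" where
  "root_vec e = axis_of (fst e) - axis_of (snd e)"

lemma inner_root_vec: "root_vec e \<bullet> x = axis_of (fst e) \<bullet> x - axis_of (snd e) \<bullet> x"
  by (simp add: root_vec_def inner_diff_left)

text \<open>The vector of \<open>(s, t)\<close> is the sum of the signed unit vectors of
  \<open>s\<close> and \<open>sneg t\<close>, which determines them up to their order;
  \<open>bar\<close> exchanges the two.\<close>

lemma root_vec_orbit:
  fixes e e' :: "('n::{finite,linorder} \<times> bool) \<times> ('n \<times> bool)"
  assumes "fst e \<noteq> snd e" "root_vec e = root_vec e'" shows "e' \<in> symb.orbit e"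
proof -
  obtain s t s' t' where e: "e = (s, t)" "e' = (s', t')" by (cases e, cases e')
  have eq: "axis_of s + axis_of (sneg t) = axis_of s' + axis_of (sneg t')" using assms(2) by (simp add: root_vec_def e axis_of_neg)
  have "0 < axis_of s \<bullet> (axis_of s + axis_of (sneg t))"
    using assms(1) by (auto simp: inner_add_right axis_of_inner e)
  then have "0 < axis_of s \<bullet> axis_of s' + axis_of s \<bullet> axis_of (sneg t')" unfolding eq by (simp add: inner_add_right)
  then have "s = s' \<or> s = sneg t'" by (auto simp: axis_of_inner split: if_splits)
  then show ?thesis
  proof
    assume "s = s'"
    then have "t = t'" using eq axis_of_inj[of "sneg t" "sneg t'"] by simp
    then show ?thesis using \<open>s = s'\<close> by (simp add: e symb.orbit_def)
  next
    assume "s = sneg t'"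
    then have "sneg t = s'" using eq axis_of_inj[of "sneg t" s'] by simp
    then show ?thesis using \<open>s = sneg t'\<close> by (auto simp: e symb.orbit_def)
  qed
qed

lemma root_vec_bar: "root_vec (symb.bar e) = root_vec e"
  by (simp add: root_vec_def symb.bar_def axis_of_neg)

text \<open>A redundant list: \<open>e\<close> and \<open>bar e\<close> name the same hyperplane,
  and so do \<open>(s, t)\<close> and \<open>(t, s)\<close> at level 0. The redundancy keeps the
  symmetry under negation visible.\<close>

definition shi_idx :: "((('n::{finite,linorder} \<times> bool) \<times> ('n \<times> bool)) \<times> real) set" where
  "shi_idx = {e. fst e \<noteq> snd e} \<times> {0} \<union> {(s, t). sprec s t} \<times> {1}"

lemma shi_idx_iff: "j \<in> shi_idx \<longleftrightarrow> snd j = 0 \<and> fst (fst j) \<noteq> snd (fst j) \<or> snd j = 1 \<and> sprec (fst (fst j)) (snd (fst j))"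
  by (cases j) (auto simp: shi_idx_def)

interpretation arr: arrangement "shi_idx :: ((('n::{finite,linorder} \<times> bool) \<times> ('n \<times> bool)) \<times> real) set"
  "\<lambda>j. root_vec (fst j)" snd
proof
  show "finite (shi_idx :: ((('n \<times> bool) \<times> ('n \<times> bool)) \<times> real) set)" by (simp add: shi_idx_def)
  show "root_vec (fst i) \<noteq> 0" if "i \<in> shi_idx" for i :: "(('n \<times> bool) \<times> ('n \<times> bool)) \<times> real"
    using that axis_of_inj[of "fst (fst i)" "snd (fst i)"] by (auto simp: shi_idx_def root_vec_def)
qed

lemma arr_off: "arr.off ((s, t), c) x = axis_of s \<bullet> x - axis_of t \<bullet> x - c"
  by (simp add: arr.off_def inner_root_vec)

lemma hyp_orbit:
  assumes "sprec (fst e) (snd e)" "j \<in> shi_idx"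
  shows "arr.hyp j = arr.hyp (e, 1) \<longleftrightarrow> snd j = 1 \<and> fst j \<in> symb.orbit e"
proof
  let ?a = "root_vec (fst j)" and ?b = "root_vec e"
  assume h: "arr.hyp j = arr.hyp (e, 1)"
  have "0 \<notin> arr.hyp j" unfolding h by (simp add: arr.hyp_def)
  then have "snd j \<noteq> 0" by (simp add: arr.hyp_def)
  then have j: "snd j = 1" using assms(2) by (auto simp: shi_idx_iff)
  have ab: "?a \<bullet> x = 1 \<longleftrightarrow> ?b \<bullet> x = 1" for x using h j by (auto simp: arr.hyp_def)
  have ne: "fst e \<noteq> snd e" using assms(1) by auto
  have nz: "?a \<noteq> 0" "?b \<noteq> 0" using arr.a_nz[OF assms(2)] arr.a_nz[of "(e, 1)"] assms(1)
    by (auto simp: shi_idx_iff)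
  \<comment> \<open>The test point is the point of the hyperplane nearest to the origin; it must
    satisfy the other equation as well.\<close>
  have "?b \<bullet> ?a = ?a \<bullet> ?a" using ab[of "?a /\<^sub>R (?a \<bullet> ?a)"] nz by (simp add: field_simps)
  moreover have "?a \<bullet> ?b = ?b \<bullet> ?b" using ab[of "?b /\<^sub>R (?b \<bullet> ?b)"] nz by (simp add: field_simps)
  ultimately have "(?a - ?b) \<bullet> (?a - ?b) = 0" by (simp add: inner_diff inner_commute)
  then have "root_vec e = root_vec (fst j)" by simp
  then show "snd j = 1 \<and> fst j \<in> symb.orbit e" using root_vec_orbit[OF ne] j by blast
next
  assume "snd j = 1 \<and> fst j \<in> symb.orbit e"
  then show "arr.hyp j = arr.hyp (e, 1)" by (auto simp: arr.hyp_def symb.orbit_def root_vec_bar)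
qed

lemmas shi_simps = arr.hyp_def inner_root_vec inner_axis_of shi_idx_iff sprec_def

lemma shi_C_eq: "(shi_C :: (real ^ 'n::{finite,linorder}) set set) = arr.hyp ` shi_idx"
proof (intro equalityI subsetI)
  fix H :: "(real, 'n) vec set" assume "H \<in> shi_C"
  then consider i j where "i < j" "H = {x. x $ i - x $ j = 0}" | i j where "i < j" "H = {x. x $ i + x $ j = 0}"
    | k where "H = {x. 2 * x $ k = 0}" | i j where "i < j" "H = {x. x $ i - x $ j = 1}"
    | i j where "i < j" "H = {x. x $ i + x $ j = 1}" | k where "H = {x. 2 * x $ k = 1}"
    unfolding shi_C_def by blast
  then show "H \<in> arr.hyp ` shi_idx"
  proof cases
    case 1 then show ?thesis
      by (intro image_eqI[of _ _ "(((i, True), (j, True)), 0)"]) (auto simp: shi_simps)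
  next
    case 2 then show ?thesis
      by (intro image_eqI[of _ _ "(((i, True), (j, False)), 0)"]) (auto simp: shi_simps)
  next
    case 3 then show ?thesis
      by (intro image_eqI[of _ _ "(((k, True), (k, False)), 0)"]) (auto simp: shi_simps)
  next
    case 4 then show ?thesis
      by (intro image_eqI[of _ _ "(((i, True), (j, True)), 1)"]) (auto simp: shi_simps)
  next
    case 5 then show ?thesis
      by (intro image_eqI[of _ _ "(((i, True), (j, False)), 1)"]) (auto simp: shi_simps)
  next
    case 6 then show ?thesis
      by (intro image_eqI[of _ _ "(((k, True), (k, False)), 1)"]) (auto simp: shi_simps)
  qed
next
  have m: "{x. x $ i - x $ j = 0} \<in> shi_C" "{x. x $ i + x $ j = 0} \<in> shi_C"
    "{x. x $ i + x $ j = 1} \<in> shi_C" if "i < j" for i j :: 'n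
    unfolding shi_C_def using that by blast+
  have m0: "{x. x $ i - x $ j = 0} \<in> shi_C" if "i \<noteq> j" for i j :: 'n
  proof (cases "i < j")
    case False
    then have "{x::(real, 'n) vec. x $ j - x $ i = 0} \<in> shi_C" using that m(1)[of j i] by auto
    moreover have "{x::(real, 'n) vec. x $ i - x $ j = 0} = {x. x $ j - x $ i = 0}" by auto
    ultimately show ?thesis by simp
  qed (rule m)
  \<comment> \<open>The case \<open>i = j\<close> accounts for the hyperplanes
    \<open>2 * x $ k = c\<close>.\<close>
  have p: "{x. x $ i + x $ j = c} \<in> shi_C" if c: "c = 0 \<or> c = 1" for i j :: 'n and c :: real
  proof -
    consider "i < j" | "j < i" | "i = j" by (rule linorder_cases)
    then show ?thesis
    proof cases
      case 1 then show ?thesis using m(2,3) c by blast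
    next
      case 2
      have "{x::(real, 'n) vec. x $ i + x $ j = c} = {x. x $ j + x $ i = c}" by (simp add: add.commute)
      then show ?thesis using m(2,3)[OF 2] c by auto
    next
      case 3
      then have "{x::(real, 'n) vec. x $ i + x $ j = c} = {x. 2 * x $ i = c}" by simp
      moreover have "{x::(real, 'n) vec. 2 * x $ i = 0} \<in> shi_C" "{x::(real, 'n) vec. 2 * x $ i = 1} \<in> shi_C"
        unfolding shi_C_def by blast+
      ultimately show ?thesis using c by auto
    qed
  qed
  have m1: "{x. x $ i - x $ j = 1} \<in> shi_C" if "i < j" for i j :: 'n
    using that unfolding shi_C_def by blast
  fix H :: "(real, 'n) vec set" assume "H \<in> arr.hyp ` shi_idx"
  then obtain s t c where st: "((s, t), c) \<in> shi_idx" "H = arr.hyp ((s, t), c)" by auto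
  obtain i p j q where ij: "s = (i, p)" "t = (j, q)" by (cases s, cases t)
  have H: "H = {x. axis_of s \<bullet> x - axis_of t \<bullet> x = c}" by (simp add: st(2) arr.hyp_def inner_root_vec)
  have c: "c = 0 \<and> s \<noteq> t \<or> c = 1 \<and> sprec s t" using st(1) by (auto simp: shi_idx_def)
  show "H \<in> shi_C"
  proof (cases p; cases q)
    assume pq: p q
    have "H = {x. x $ i - x $ j = c}" using pq ij by (simp add: H inner_axis_of)
    then show ?thesis using c m0 m1 pq ij by (auto simp: sprec_def)
  next
    assume pq: p "\<not> q"
    have "H = {x. x $ i + x $ j = c}" using pq ij by (simp add: H inner_axis_of)
    then show ?thesis using c p by blast
  next
    assume pq: "\<not> p" q
    have "H = {x. - (x $ i + x $ j) = c}" using pq ij by (simp add: H inner_axis_of)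
    moreover have "c = 0" using c pq ij by (auto simp: sprec_def)
    ultimately have "H = {x. x $ i + x $ j = 0}" by (simp add: neg_equal_0_iff_equal del: minus_add_distrib)
    then show ?thesis using p by simp
  next
    assume pq: "\<not> p" "\<not> q"
    have "H = {x. x $ j - x $ i = c}" using pq ij by (simp add: H inner_axis_of)
    then show ?thesis using c m0 m1 pq ij by (auto simp: sprec_def)
  qed
qed

section \<open>Regions as pairs of an order and an upper set\<close>

definition order_of :: "real ^ 'n \<Rightarrow> (('n \<times> bool) \<times> ('n \<times> bool)) set" where
  "order_of x = {(s, t). axis_of t \<bullet> x < axis_of s \<bullet> x}"

definition far :: "real ^ 'n::{finite,linorder} \<Rightarrow> (('n \<times> bool) \<times> ('n \<times> bool)) set" where
  "far x = {(s, t). sprec s t \<and> 1 < axis_of s \<bullet> x - axis_of t \<bullet> x}"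

lemma ball_shi_idx: "(\<forall>j\<in>shi_idx. P j) \<longleftrightarrow>
    (\<forall>s t. s \<noteq> t \<longrightarrow> P ((s, t), 0)) \<and> (\<forall>s t. sprec s t \<longrightarrow> P ((s, t), 1))"
  unfolding shi_idx_def by auto

lemma generic_iff: "arr.generic x \<longleftrightarrow> (\<forall>s t. s \<noteq> t \<longrightarrow> axis_of s \<bullet> x \<noteq> axis_of t \<bullet> x) \<and>
    (\<forall>s t. sprec s t \<longrightarrow> axis_of s \<bullet> x - axis_of t \<bullet> x \<noteq> 1)"
  unfolding arr.generic_def ball_shi_idx arr_off by simp

lemma symlin_order_of: "arr.generic x \<Longrightarrow> symb.symlin (order_of x)"
  unfolding symb.symlin_def generic_iff
  by (auto simp: order_of_def axis_of_neg trans_def neq_iff)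

text \<open>The order is by decreasing value, so that pairs at distance greater than 1 belong to it,
  and spanning a larger interval only increases the distance.\<close>

lemma far_upsets: assumes "arr.generic x" shows "far x \<in> symb.upsets (order_of x)"
  unfolding symb.upsets_iff[OF symlin_order_of[OF assms]]
proof (intro conjI ballI impI)
  show "far x \<subseteq> symb.pairs (order_of x)"
    by (auto simp: far_def symb.pairs_def order_of_def)
  show "symb.bar ` far x \<subseteq> far x"
    by (auto simp: far_def symb.bar_def axis_of_neg)
  show "e' \<in> far x" if "e \<in> far x" "e' \<in> symb.pairs (order_of x)" "symb.le (order_of x) e e'" for e e'
    using that by (auto simp: far_def symb.pairs_def order_of_def symb.le_def)
qed

lemma ex_state:
  fixes L D :: "(('n::{finite,linorder} \<times> bool) \<times> ('n \<times> bool)) set"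
  assumes L: "symb.symlin L" and D: "D \<in> symb.upsets L"
  shows "\<exists>x. arr.generic x \<and> order_of x = L \<and> far x = D"
proof -
  obtain y :: "'n \<times> bool \<Rightarrow> real" where odd: "\<And>s. y (sneg s) = - y s" and yL: "\<And>s t. (s, t) \<in> L \<Longrightarrow> y t < y s"
    and yD: "\<And>s t. (s, t) \<in> symb.pairs L \<Longrightarrow> if (s, t) \<in> D then 1 < y s - y t else y s - y t < 1"
  proof -
    from symb.realise[OF L D] obtain y :: "'n \<times> bool \<Rightarrow> real" where y: "\<forall>s. y (sneg s) = - y s"
      "\<forall>(s, t)\<in>L. y t < y s" "\<forall>(s, t)\<in>symb.pairs L. if (s, t) \<in> D then 1 < y s - y t else y s - y t < 1"
      by blast
    show ?thesis by (rule that[of y]) (use y in blast)+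
  qed
  define x where "x = (\<chi> i. y (i, True))"
  have x: "axis_of s \<bullet> x = y s" for s
    using odd[of "(fst s, True)"] by (cases s; cases "snd s") (auto simp: x_def inner_axis_of sneg_def)
  note l = symb.symlinD[OF L]
  have DP: "D \<subseteq> symb.pairs L" using D unfolding symb.upsets_iff[OF L] by blast
  have gen: "arr.generic x"
    unfolding generic_iff x
  proof (intro conjI allI impI)
    fix s t :: "'n \<times> bool" assume "s \<noteq> t"
    then show "y s \<noteq> y t" using l(3)[of s t] yL by fastforce
  next
    fix s t :: "'n \<times> bool" assume "sprec s t"
    then have "s \<noteq> t" by auto
    show "y s - y t \<noteq> 1"
    proof (cases "(s, t) \<in> L")
      case True
      then show ?thesis using yD[of s t] \<open>sprec s t\<close> by (auto simp: symb.pairs_def split: if_splits)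
    next
      case False
      then show ?thesis using yL[of t s] l(3)[of s t] \<open>s \<noteq> t\<close> by auto
    qed
  qed
  have ord: "order_of x = L"
  proof (intro equalityI subrelI)
    fix s t assume "(s, t) \<in> order_of x"
    then have "y t < y s" by (simp add: order_of_def x)
    then show "(s, t) \<in> L" using l(3)[of s t] yL[of t s] by fastforce
  qed (use yL in \<open>auto simp: order_of_def x\<close>)
  moreover have "far x = D"
  proof (intro equalityI subrelI)
    fix s t assume st: "(s, t) \<in> far x"
    then have "(s, t) \<in> symb.pairs L" using far_upsets[OF gen]
      unfolding ord symb.upsets_iff[OF L] by blast
    then show "(s, t) \<in> D" using yD[of s t] st by (auto simp: far_def x split: if_splits)
  next
    fix s t assume st: "(s, t) \<in> D"
    then have "(s, t) \<in> symb.pairs L" using DP by blast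
    then show "(s, t) \<in> far x" using yD[of s t] st by (auto simp: far_def x symb.pairs_def)
  qed
  ultimately show ?thesis using gen by blast
qed

lemma off_pos:
  "0 < arr.off ((s, t), 0) x \<longleftrightarrow> (s, t) \<in> order_of x"
  "sprec s t \<Longrightarrow> 0 < arr.off ((s, t), 1) x \<longleftrightarrow> (s, t) \<in> far x"
  by (auto simp: arr_off order_of_def far_def)

lemma same_sign:
  assumes "arr.generic x" "arr.generic y" "j \<in> shi_idx"
  shows "0 < arr.off j x * arr.off j y \<longleftrightarrow> (0 < arr.off j x \<longleftrightarrow> 0 < arr.off j y)"
    "arr.off j x * arr.off j y < 0 \<longleftrightarrow> (0 < arr.off j x \<longleftrightarrow> \<not> 0 < arr.off j y)"
  using assms unfolding arr.generic_def by (auto simp: zero_less_mult_iff mult_less_0_iff linorder_neq_iff)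

text \<open>The signs at level 0 amount to the order and those at level 1 to the set
  \<open>far\<close>, so a region is the same as a state.\<close>

lemma in_cell_iff:
  fixes x y :: "real ^ 'a::{finite,linorder}"
  assumes x: "arr.generic x"
  shows "y \<in> arr.cell x \<longleftrightarrow> arr.generic y \<and> order_of y = order_of x \<and> far y = far x"
proof (cases "arr.generic y")
  case True
  have "y \<in> arr.cell x \<longleftrightarrow> (\<forall>j\<in>shi_idx. 0 < arr.off j x \<longleftrightarrow> 0 < arr.off j y)"
    unfolding arr.cell_def using same_sign(1)[OF x True] by simp
  also have "\<dots> \<longleftrightarrow> (\<forall>s t. s \<noteq> t \<longrightarrow> ((s, t) \<in> order_of x \<longleftrightarrow> (s, t) \<in> order_of y)) \<and>
      (\<forall>s t. sprec s t \<longrightarrow> ((s, t) \<in> far x \<longleftrightarrow> (s, t) \<in> far y))"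
    unfolding ball_shi_idx by (simp add: off_pos)
  also have "\<dots> \<longleftrightarrow> order_of y = order_of x \<and> far y = far x"
  proof -
    have "(s, t) \<in> order_of z \<Longrightarrow> s \<noteq> t" "(s, t) \<in> far z \<Longrightarrow> sprec s t" for s t and z :: "(real, 'a) vec"
      by (auto simp: order_of_def far_def)
    then show ?thesis by (intro iffI conjI equalityI subrelI; blast)
  qed
  finally show ?thesis using True by simp
qed (use arr.cell_generic in blast)

text \<open>Reversing the sign at this hyperplane alone keeps the order and toggles \<open>e\<close>
  and \<open>bar e\<close> in \<open>far x\<close>. By \<open>ex_state\<close> the result comes from
  a region exactly if it is again an upper set.\<close>

lemma wall_toggle:
  assumes x: "arr.generic x" and e: "sprec (fst e) (snd e)"
  defines "T \<equiv> if e \<in> far x then far x - symb.orbit e else far x \<union> symb.orbit e"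
  shows "arr.hyp (e, 1) \<in> walls shi_C (arr.cell x) \<longleftrightarrow> T \<in> symb.upsets (order_of x)"
proof -
  have i: "(e, 1) \<in> shi_idx" using e by (simp add: shi_idx_iff)
  have "symb.bar ` far x \<subseteq> far x"
    using far_upsets[OF x] unfolding symb.upsets_iff[OF symlin_order_of[OF x]] by blast
  then have "symb.bar e \<in> far x \<longleftrightarrow> e \<in> far x" by (metis image_subset_iff symb.bar_bar)
  then have T: "e' \<in> T \<longleftrightarrow> (if e' \<in> symb.orbit e then e' \<notin> far x else e' \<in> far x)" for e'
    by (auto simp: T_def symb.orbit_def)
  show ?thesis
    unfolding shi_C_eq arr.wall_iff_cross[OF x i]
  proof
    assume "\<exists>y. \<forall>j\<in>shi_idx. if arr.hyp j = arr.hyp (e, 1) then arr.off j x * arr.off j y < 0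
      else 0 < arr.off j x * arr.off j y"
    then obtain y where y: "\<And>j. j \<in> shi_idx \<Longrightarrow> if snd j = 1 \<and> fst j \<in> symb.orbit e
        then arr.off j x * arr.off j y < 0 else 0 < arr.off j x * arr.off j y"
      using hyp_orbit[OF e] by (metis (no_types, lifting))
    have gy: "arr.generic y"
      unfolding arr.generic_def using y by (metis less_irrefl mult_zero_right)
    have s: "(0 < arr.off j x \<longleftrightarrow> 0 < arr.off j y) \<longleftrightarrow> \<not> (snd j = 1 \<and> fst j \<in> symb.orbit e)" if "j \<in> shi_idx" for j
      using y[OF that] same_sign[OF x gy that] by (auto split: if_splits)
    have "(s, t) \<in> order_of y \<longleftrightarrow> (s, t) \<in> order_of x" for s t
    proof (cases "s = t")
      case False
      then show ?thesis using s[of "((s, t), 0)"] by (simp add: shi_idx_iff off_pos)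
    qed (simp add: order_of_def)
    then have o: "order_of y = order_of x" by auto
    have "(s, t) \<in> far y \<longleftrightarrow> (s, t) \<in> T" for s t
    proof (cases "sprec s t")
      case True
      then show ?thesis using s[of "((s, t), 1)"] by (auto simp: shi_idx_iff off_pos T)
    next
      case False
      moreover have "sprec (fst e') (snd e')" if "e' \<in> symb.orbit e" for e'
        using e that by (auto simp: symb.orbit_def symb.bar_def)
      from this[of "(s, t)"] have "(s, t) \<notin> symb.orbit e" using False by auto
      ultimately show ?thesis by (simp add: far_def T)
    qed
    then have "far y = T" by auto
    then show "T \<in> symb.upsets (order_of x)" using far_upsets[OF gy] o by simp
  next
    assume "T \<in> symb.upsets (order_of x)"
    then obtain y where y: "arr.generic y" "order_of y = order_of x" "far y = T"
      using ex_state symlin_order_of[OF x] by blast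
    have "if arr.hyp j = arr.hyp (e, 1) then arr.off j x * arr.off j y < 0 else 0 < arr.off j x * arr.off j y" if j: "j \<in> shi_idx" for j
      unfolding hyp_orbit[OF e j] same_sign[OF x y(1) j]
      using j y T off_pos[of "fst (fst j)" "snd (fst j)"] by (cases j) (auto simp: shi_idx_iff)
    then show "\<exists>y. \<forall>j\<in>shi_idx. if arr.hyp j = arr.hyp (e, 1) then arr.off j x * arr.off j y < 0
      else 0 < arr.off j x * arr.off j y"
      by blast
  qed
qed

section \<open>Floors, ceilings and the sums over regions\<close>

lemma card_image_eqI:
  assumes "\<And>x y. x \<in> A \<Longrightarrow> y \<in> A \<Longrightarrow> f x = f y \<longleftrightarrow> g x = g y"
  shows "card (f ` A) = card (g ` A)"
proof (rule bij_betw_same_card)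
  show "bij_betw (\<lambda>z. g (inv_into A f z)) (f ` A) (g ` A)"
  proof (rule bij_betw_imageI)
    show "inj_on (\<lambda>z. g (inv_into A f z)) (f ` A)"
      using assms by (auto simp: inj_on_def) (metis f_inv_into_f image_eqI inv_into_into)
    have "g (inv_into A f (f x)) = g x" if "x \<in> A" for x
      using assms that by (metis f_inv_into_f image_eqI inv_into_into)
    then show "(\<lambda>z. g (inv_into A f z)) ` f ` A = g ` A" by (auto simp: image_image)
  qed
qed

lemma card_hyp_orbit: assumes "\<And>e. e \<in> A \<Longrightarrow> sprec (fst e) (snd e)"
  shows "card ((\<lambda>e. arr.hyp (e, 1)) ` A) = card (symb.orbit ` A)"
proof (rule card_image_eqI)
  fix e e' assume e: "e \<in> A" "e' \<in> A"
  then have "(e, 1) \<in> shi_idx" using assms by (simp add: shi_idx_iff)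
  then show "arr.hyp (e, 1) = arr.hyp (e', 1) \<longleftrightarrow> symb.orbit e = symb.orbit e'"
    using hyp_orbit[OF assms[OF e(2)], of "(e, 1)"] symb.orbit_eq[of e' e] by auto
qed

lemma hyp_origin: assumes "H \<in> shi_C" "0 \<notin> H"
  obtains e where "sprec (fst e) (snd e)" "(e, 1) \<in> shi_idx" "H = arr.hyp (e, 1)"
proof -
  obtain j where j: "j \<in> shi_idx" "H = arr.hyp j" using assms(1) unfolding shi_C_eq by blast
  have "snd j \<noteq> 0" using assms(2) by (auto simp: j(2) arr.hyp_def)
  then have "sprec (fst (fst j)) (snd (fst j))" "j = (fst j, 1)" using j(1) by (auto simp: shi_idx_iff prod_eq_iff)
  then show ?thesis using that[of "fst j"] j by simp
qed

lemma card_walls: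
  assumes x: "arr.generic x"
    and P: "\<And>e. sprec (fst e) (snd e) \<Longrightarrow> e \<in> S \<longleftrightarrow>
      P (arr.hyp (e, 1)) \<and> arr.hyp (e, 1) \<in> walls shi_C (arr.cell x)"
    and S: "\<And>e. e \<in> S \<Longrightarrow> sprec (fst e) (snd e)"
  shows "card {H \<in> walls shi_C (arr.cell x). 0 \<notin> H \<and> P H} = card (symb.orbit ` S)"
proof -
  have "{H \<in> walls shi_C (arr.cell x). 0 \<notin> H \<and> P H} = (\<lambda>e. arr.hyp (e, 1)) ` S"
  proof (intro equalityI subsetI)
    fix H assume H: "H \<in> {H \<in> walls shi_C (arr.cell x). 0 \<notin> H \<and> P H}"
    then obtain e where "sprec (fst e) (snd e)" "H = arr.hyp (e, 1)"
      using hyp_origin[of H] unfolding walls_def by blast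
    then show "H \<in> (\<lambda>e. arr.hyp (e, 1)) ` S" using P H by blast
  next
    fix H assume "H \<in> (\<lambda>e. arr.hyp (e, 1)) ` S"
    then obtain e where e: "e \<in> S" "H = arr.hyp (e, 1)" by blast
    then have "0 \<notin> H" by (simp add: arr.hyp_def)
    then show "H \<in> {H \<in> walls shi_C (arr.cell x). 0 \<notin> H \<and> P H}" using e P S by blast
  qed
  then show ?thesis using card_hyp_orbit[OF S] by simp
qed

lemma num_floors_eq:
  assumes x: "arr.generic x"
  shows "num_floors shi_C (arr.cell x) = card (symb.orbit ` symb.floor_pairs (order_of x) (far x))"
  unfolding num_floors_def
proof (rule card_walls[OF x])
  fix e :: "('a \<times> bool) \<times> ('a \<times> bool)" assume e: "sprec (fst e) (snd e)"
  then have i: "(e, 1) \<in> shi_idx" by (simp add: shi_idx_iff)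
  have "opposite_half_spaces (arr.hyp (e, 1)) (arr.cell x) {0} \<longleftrightarrow> e \<in> far x"
    using arr.opposite_iff(1)[OF x i] off_pos(2)[of "fst e" "snd e" x] e by simp
  then show "e \<in> symb.floor_pairs (order_of x) (far x) \<longleftrightarrow>
      opposite_half_spaces (arr.hyp (e, 1)) (arr.cell x) {0} \<and> arr.hyp (e, 1) \<in> walls shi_C (arr.cell x)"
    unfolding wall_toggle[OF x e] symb.floor_pairs_def by auto
qed (auto simp: symb.floor_pairs_def far_def)

lemma num_ceilings_eq:
  assumes x: "arr.generic x"
  shows "num_ceilings shi_C (arr.cell x) = card (symb.orbit ` symb.ceil_pairs (order_of x) (far x))"
  unfolding num_ceilings_def
proof (rule card_walls[OF x])
  fix e :: "('a \<times> bool) \<times> ('a \<times> bool)" assume e: "sprec (fst e) (snd e)"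
  then have i: "(e, 1) \<in> shi_idx" by (simp add: shi_idx_iff)
  have "arr.off (e, 1) x \<noteq> 0" using x i by (simp add: arr.generic_def)
  then have "same_half_space (arr.hyp (e, 1)) (arr.cell x) {0} \<longleftrightarrow> e \<notin> far x"
    using arr.opposite_iff(2)[OF x i] off_pos(2)[of "fst e" "snd e" x] e by auto
  \<comment> \<open>Not being in \<open>far x\<close> does not yet place \<open>e\<close> in the
    order, as \<open>ceil_pairs\<close> demands; membership in an upper set does.\<close>
  moreover have "e \<in> symb.pairs (order_of x)" if "far x \<union> symb.orbit e \<in> symb.upsets (order_of x)"
    using that unfolding symb.upsets_iff[OF symlin_order_of[OF x]] by (auto simp: symb.orbit_def)
  ultimately show "e \<in> symb.ceil_pairs (order_of x) (far x) \<longleftrightarrow>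
      same_half_space (arr.hyp (e, 1)) (arr.cell x) {0} \<and> arr.hyp (e, 1) \<in> walls shi_C (arr.cell x)"
    unfolding wall_toggle[OF x e] symb.ceil_pairs_def by auto
qed (auto simp: symb.ceil_pairs_def symb.pairs_def)

text \<open>A state corresponds to the cell of any point that realises it; a choice of such points
  makes this a bijection.\<close>

lemma sum_regions:
  fixes F :: "(real ^ 'n::{finite,linorder}) set \<Rightarrow> 'b::comm_monoid_add"
  assumes "\<And>x. arr.generic x \<Longrightarrow> F (arr.cell x) = G (order_of x) (far x)"
  shows "(\<Sum>R\<in>regions shi_C. F R) = (\<Sum>(L, D)\<in>symb.states. G L D)"
proof -
  define pt :: "(('n \<times> bool) \<times> ('n \<times> bool)) set \<times> (('n \<times> bool) \<times> ('n \<times> bool)) set \<Rightarrow> (real, 'n) vec"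
    where "pt = (\<lambda>(L, D). SOME x. arr.generic x \<and> order_of x = L \<and> far x = D)"
  have pt: "arr.generic (pt (L, D)) \<and> order_of (pt (L, D)) = L \<and> far (pt (L, D)) = D"
    if "symb.symlin L" "D \<in> symb.upsets L" for L D
    unfolding pt_def prod.case using ex_state[OF that] by (rule someI_ex)
  have "bij_betw (\<lambda>e. arr.cell (pt e)) symb.states (regions shi_C)"
    unfolding shi_C_eq arr.regions_eq
  proof (rule bij_betw_imageI)
    show "inj_on (\<lambda>e. arr.cell (pt e)) symb.states"
    proof (rule inj_onI, clarsimp simp: symb.states_def)
      fix L D L' D'
      assume a: "symb.symlin L" "D \<in> symb.upsets L" "symb.symlin L'" "D' \<in> symb.upsets L'"
        and eq: "arr.cell (pt (L, D)) = arr.cell (pt (L', D'))"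
      have "pt (L', D') \<in> arr.cell (pt (L, D))" unfolding eq using pt[OF a(3,4)] arr.generic_cell by blast
      then show "L = L' \<and> D = D'" using in_cell_iff[of "pt (L, D)"] pt[OF a(1,2)] pt[OF a(3,4)] by auto
    qed
    show "(\<lambda>e. arr.cell (pt e)) ` symb.states = arr.cell ` {x. arr.generic x}"
    proof (intro equalityI subsetI)
      fix R :: "(real, 'n) vec set" assume "R \<in> arr.cell ` {x. arr.generic x}"
      then obtain x where x: "arr.generic x" "R = arr.cell x" by auto
      note st = symlin_order_of[OF x(1)] far_upsets[OF x(1)]
      have "arr.cell (pt (order_of x, far x)) = arr.cell x"
        using in_cell_iff[OF x(1)] in_cell_iff[of "pt (order_of x, far x)"] pt[OF st] by auto
      then show "R \<in> (\<lambda>e. arr.cell (pt e)) ` symb.states"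
        using st x(2) by (intro image_eqI[of _ _ "(order_of x, far x)"]) (auto simp: symb.states_def)
    qed (use pt in \<open>auto simp: symb.states_def\<close>)
  qed
  from sum.reindex_bij_betw[OF this, of F, symmetric]
  have "(\<Sum>R\<in>regions shi_C. F R) = (\<Sum>e\<in>symb.states. F (arr.cell (pt e)))" .
  also have "\<dots> = (\<Sum>(L, D)\<in>symb.states. G L D)"
    by (rule sum.cong) (use pt assms in \<open>auto simp: symb.states_def\<close>)
  finally show ?thesis .
qed

text \<open>A sequence is the restriction of an odd function to the positive symbols, and taking
  negatives adds no new absolute values.\<close>

lemma sum_seqs_C:
  "(\<Sum>a\<in>(seqs_C :: (int ^ 'n::{finite,linorder}) set). f (CARD('n) - distinct_abs a)) =
   (\<Sum>g\<in>(symb.odd_funs :: ('n \<times> bool \<Rightarrow> int) set). f (symb.corank g))"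
proof (rule sum.reindex_bij_witness[where i = "\<lambda>g. \<chi> i. g (i, True)"
    and j = "\<lambda>a s. if snd s then a $ fst s else - a $ fst s"])
  have C: "CARD('n \<times> bool) div 2 = CARD('n)" by simp
  fix a :: "(int, 'n) vec" assume "a \<in> seqs_C"
  let ?g = "\<lambda>s. if snd s then a $ fst s else - a $ fst s"
  have "\<bar>a $ i\<bar> \<le> int CARD('n)" for i
    using \<open>a \<in> seqs_C\<close> by (simp add: seqs_C_def abs_le_iff minus_le_iff)
  then show "?g \<in> symb.odd_funs"
    unfolding symb.odd_funs_def C by (auto simp: sneg_def)
  have "{\<bar>?g s\<bar> | s. ?g s \<noteq> 0} = {\<bar>a $ i\<bar> | i. a $ i \<noteq> 0}"
    by (auto split: if_splits)
  then show "f (symb.corank ?g) = f (CARD('n) - distinct_abs a)"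
    unfolding C distinct_abs_def symb.corank_def by simp
next
  have C: "CARD('n \<times> bool) div 2 = CARD('n)" by simp
  fix g :: "'n \<times> bool \<Rightarrow> int" assume g: "g \<in> symb.odd_funs"
  then have "g (i, False) = - g (i, True)" for i
    using spec[OF conjunct1[OF g[unfolded symb.odd_funs_def mem_Collect_eq]], of "(i, True)"]
    by (simp add: sneg_def)
  then show "(\<lambda>s. if snd s then (\<chi> i. g (i, True)) $ fst s else - (\<chi> i. g (i, True)) $ fst s) = g"
    by (auto simp: fun_eq_iff)
  show "(\<chi> i. g (i, True)) \<in> seqs_C"
    using g unfolding seqs_C_def symb.odd_funs_def C by (auto simp: abs_le_iff minus_le_iff)
qed (simp add: vec_eq_iff)

theorem theorem4:
  "(\<Sum>R\<in>regions (shi_C :: (real ^ 'n::{finite,linorder}) set set).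
      monom (1::int) (num_ceilings shi_C R)) =
   (\<Sum>R\<in>regions (shi_C :: (real ^ 'n::{finite,linorder}) set set).
      monom (1::int) (num_floors shi_C R)) \<and>
   (\<Sum>R\<in>regions (shi_C :: (real ^ 'n::{finite,linorder}) set set).
      monom (1::int) (num_floors shi_C R)) =
   (\<Sum>a\<in>(seqs_C :: (int ^ 'n::{finite,linorder}) set).
      monom (1::int) (CARD('n) - distinct_abs a))"
proof -
  have "(\<Sum>R\<in>regions (shi_C :: (real ^ 'n::{finite,linorder}) set set). monom (1::int) (num_floors shi_C R)) =
    (\<Sum>a\<in>(seqs_C :: (int ^ 'n::{finite,linorder}) set). monom (1::int) (CARD('n) - distinct_abs a))"
    unfolding sum_seqs_C symb.sum_upsets(1)[symmetric]
    by (rule sum_regions) (simp add: num_floors_eq)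
  moreover have "(\<Sum>R\<in>regions (shi_C :: (real ^ 'n::{finite,linorder}) set set). monom (1::int) (num_ceilings shi_C R)) =
    (\<Sum>a\<in>(seqs_C :: (int ^ 'n::{finite,linorder}) set). monom (1::int) (CARD('n) - distinct_abs a))"
    unfolding sum_seqs_C symb.sum_upsets(2)[symmetric]
    by (rule sum_regions) (simp add: num_ceilings_eq)
  ultimately show ?thesis by simp
qed

end
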